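(* Assume the spiked tensor model described in the context, and assume moreover that the ratio $\|\mathcal{P}\|_F^2/\sigma_N$ remains bounded as $N\to+\infty$. Fix $\ell\in[d]$ and, for $\tilde z\in\mathbb{C}\setminus\mathbb{R}$, let $$\widetilde{Q}^{(\ell)}(\tilde z)=\Big(\tfrac{1}{\sigma_N}\big[T^{(\ell)}T^{(\ell)\top}-\mu^{(\ell)}_N I_{n_\ell}\big]-\tilde z I_{n_\ell}\Big)^{-1}.$$ Then for every $\tilde z\in\mathbb{C}\setminus\mathbb{R}$, $\frac{1}{n_\ell}\operatorname{Tr}\widetilde Q^{(\ell)}(\tilde z)$ converges almost surely as $N\to+\infty$ to a deterministic limit $\widetilde m(\tilde z)$, which does not depend on $\ell$ and satisfies $$\widetilde m(\tilde z)^2+\tilde z\,\widetilde m(\tilde z)+1=0\qquad(\text{with }\operatorname{Im}\tilde z\,\operatorname{Im}\widetilde m(\tilde z)>0),$$ and $\widetilde Q^{(\ell)}(\tilde z)\longleftrightarrow \bar Q^{(\ell)}(\tilde z)$ in the sense of deterministic equivalents, where $$\bar Q^{(\ell)}(\tilde z)=\Big(\tfrac{1}{\sigma_N}P^{(\ell)}P^{(\ell)\top}+\tfrac{1}{\widetilde m(\tilde z)}I_{n_\ell}\Big)^{-1}.$$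
   Context: Spiked tensor model: $d\ge 3$ is fixed; $N\to+\infty$ is a positive integer parameter; dimensions $n_1,\dots,n_d$ depend on $N$ so that $n_\ell/N=c_\ell$ is a fixed positive constant for all $N$ larger than some $N_0$; ranks $r_1,\dots,r_d\ge1$ are fixed. $\mathcal{N}\in\mathbb{R}^{n_1\times\cdots\times n_d}$ has i.i.d. $\mathcal{N}(0,1)$ entries; $\mathcal{P}\in\mathbb{R}^{n_1\times\cdots\times n_d}$ is deterministic of the form $\mathcal{P}=\sum_{q_1\le r_1,\dots,q_d\le r_d}\mathcal{H}_{q_1,\dots,q_d}\,x^{(1)}_{q_1}\otimes\cdots\otimes x^{(d)}_{q_d}$, where $\mathcal{H}\in\mathbb{R}^{r_1\times\cdots\times r_d}$ and $X^{(\ell)}=[x^{(\ell)}_1,\dots,x^{(\ell)}_{r_\ell}]\in\mathbb{R}^{n_\ell\times r_\ell}$ has orthonormal columns. The observation is $\mathcal{T}=\mathcal{P}+\frac{1}{\sqrt N}\mathcal{N}$. For a tensor $\mathcal{A}$, the mode-$\ell$ unfolding $A^{(\ell)}$ is the $n_\ell\times\prod_{\ell'\ne\ell}n_{\ell'}$ matrix whose columns are the mode-$\ell$ fibers of $\mathcal{A}$ (vectors obtained by fixing all indices except the $\ell$-th), ordered so that $[y^{(1)}\otimes\cdots\otimes y^{(d)}]^{(\ell)}=y^{(\ell)}\big(\boxtimes_{\ell'\ne\ell}y^{(\ell')}\big)^\top$ with $\boxtimes$ the Kronecker product taken over $\ell'$ in increasing order. Define $\mu^{(\ell)}_N=\frac1N\prod_{\ell'\ne\ell}n_{\ell'}$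 and $\sigma_N=\frac1N\sqrt{\prod_{\ell\in[d]}n_\ell}$. Deterministic equivalent: for random $X$ and deterministic $\bar X$ (both $n\times n$, depending on $N$), $X\leftrightarrow\bar X$ means that for all deterministic sequences of matrices $A\in\mathbb{R}^{n\times n}$ with bounded spectral norm and vectors $a,b\in\mathbb{R}^n$ with bounded Euclidean norms, $\frac1n\operatorname{Tr}A(X-\bar X)\to0$ and $a^\top(X-\bar X)b\to0$ almost surely as $N\to+\infty$. *)

theory Defs
  imports "HOL-Probability.Probability" "Jordan_Normal_Form.Gauss_Jordan_Elimination"
begin

text \<open>Tensors of order d with dimensions n 0, ..., n (d-1) are functions from
multi-indices (nat => nat) to reals; only indices in tidx d n matter.
Modes are numbered 0..d-1 (the paper uses 1..d).\<close>

definition tidx :: "nat \<Rightarrow> (nat \<Rightarrow> nat) \<Rightarrow> (nat \<Rightarrow> nat) set" where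
  "tidx d n = {i. (\<forall>l<d. i l < n l) \<and> (\<forall>l. d \<le> l \<longrightarrow> i l = 0)}"

text \<open>Decode the column index c of the mode-l mode_unfold into the multi-index:
the other modes l' are taken in increasing order, as in a Kronecker product
(first factor most significant).\<close>

definition unfold_index :: "nat \<Rightarrow> (nat \<Rightarrow> nat) \<Rightarrow> nat \<Rightarrow> nat \<Rightarrow> nat \<Rightarrow> (nat \<Rightarrow> nat)" where
  "unfold_index d n l a c = (\<lambda>l'. if l' = l then a
      else if l' < d then (c div (\<Prod>l''\<in>{l'<..<d} - {l}. n l'')) mod n l' else 0)"

definition mode_unfold :: "nat \<Rightarrow> (nat \<Rightarrow> nat) \<Rightarrow> nat \<Rightarrow> ((nat \<Rightarrow> nat) \<Rightarrow> real) \<Rightarrow> real mat" where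
  "mode_unfold d n l T = mat (n l) (\<Prod>l'\<in>{..<d} - {l}. n l')
      (\<lambda>(a, c). T (unfold_index d n l a c))"

definition mtrace :: "'a::comm_ring_1 mat \<Rightarrow> 'a" where
  "mtrace A = (\<Sum>i<dim_row A. A $$ (i, i))"

definition minv :: "'a::field mat \<Rightarrow> 'a mat" where
  "minv A = (case mat_inverse A of Some B \<Rightarrow> B | None \<Rightarrow> 0\<^sub>m (dim_row A) (dim_col A))"

definition cmat :: "real mat \<Rightarrow> complex mat" where
  "cmat A = map_mat complex_of_real A"

definition cvec :: "real vec \<Rightarrow> complex vec" where
  "cvec v = map_vec complex_of_real v"

definition vnorm :: "real vec \<Rightarrow> real" where
  "vnorm v = sqrt (\<Sum>i<dim_vec v. (v $ i)\<^sup>2)"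

definition spec_norm :: "real mat \<Rightarrow> real" where
  "spec_norm A = Sup {vnorm (A *\<^sub>v v) | v. v \<in> carrier_vec (dim_col A) \<and> vnorm v \<le> 1}"

definition det_equiv ::
  "'w measure \<Rightarrow> (nat \<Rightarrow> nat) \<Rightarrow> (nat \<Rightarrow> 'w \<Rightarrow> complex mat) \<Rightarrow> (nat \<Rightarrow> complex mat) \<Rightarrow> bool" where
  "det_equiv M n X Xbar \<longleftrightarrow>
     (\<forall>(A :: nat \<Rightarrow> real mat) (a :: nat \<Rightarrow> real vec) (b :: nat \<Rightarrow> real vec).
        (\<forall>N. A N \<in> carrier_mat (n N) (n N) \<and> a N \<in> carrier_vec (n N) \<and> b N \<in> carrier_vec (n N))
        \<and> (\<exists>C. \<forall>N. spec_norm (A N) \<le> C) \<and> (\<exists>C. \<forall>N. vnorm (a N) \<le> C) \<and> (\<exists>C. \<forall>N. vnorm (b N) \<le> C)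
      \<longrightarrow> (AE \<omega> in M. (\<lambda>N. mtrace (cmat (A N) * (X N \<omega> - Xbar N)) / of_nat (n N)) \<longlonglongrightarrow> 0)
        \<and> (AE \<omega> in M. (\<lambda>N. cvec (a N) \<bullet> ((X N \<omega> - Xbar N) *\<^sub>v cvec (b N))) \<longlonglongrightarrow> 0))"

end

theory Submission
  imports Defs "Jordan_Normal_Form.Determinant"
begin

text \<open>
Fix $N$ and a mode, write $n$, $p$ for the dimensions of the unfolding, $s = 1/\sqrt{np}$ and
$G = \sqrt N T = G_0 + W$ with $W$ the unfolded noise. The centred Gram matrix is then
$B = s (G G^T - p I)$, with resolvent $Q = (B - z)^{-1}$, $m_N = \mathrm{tr}\, Q / n$ and spike
$\Lambda = s G_0 G_0^T$, whose trace stays bounded. For vectors $u, v$ put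
$\Phi = u^T (zQ + I + m_N Q - \Lambda Q) v$. Gaussian integration by parts in every entry of $W$,
with test function $|\Phi|^4 \bar\Phi$, bounds $E |\Phi|^6$ by the sixth moment of the cross term
$s G_0 W^T$ plus terms of order $n^{-3}$ and $(n/p)^3$; all other quantities are bounded
deterministically, because $\|Q\| \le 1/|\mathrm{Im}\, z|$ and $\|G^T Q\| = O(\sqrt p)$. As $d \ge 3$, this
gives $E |\Phi|^6 = O(N^{-3/2})$ uniformly over unit vectors, which is summable.

Averaging over $u = v = e_k$ yields $m_N^2 + z m_N + 1 \to 0$, an equation that is stable since
$(m_N - m)(m_N + m + z) = m_N^2 + z m_N + 1$ and $|\mathrm{Im}(m_N + m + z)| \ge |\mathrm{Im}\, z|$.
Taking $u = \bar Q a$ turns the smallness of $\Phi$ into that of $a^T (\bar Q - Q) v$.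
\<close>

section \<open>Gaussian integration by parts\<close>

text \<open>Why the sixth moment: nothing relates the noises of different N, so almost sure
  convergence has to come from summability. The slowest error is the cross term, whose mean square
  is bounded by a multiple of s n = sqrt (n / p), of order N^(-(d-2)/2). At d = 3 a fourth moment
  would give only 1 / N; the sixth is the first even moment with a summable bound. Testing \<Phi>
  against a power of itself controls bias and fluctuation at once, so neither a concentration
  inequality nor a comparison with the unspiked model is needed. The form of \<Phi> is forced. The
  resolvent equation says z Q + I = B Q. In B Q = s (G G^T - p) Q the signal part gives \<Lambda> Q
  plus the cross term. The noise part gives, after integration by parts, s p Q - (s^2 n p) m_N Q
  plus small terms: the centring removes s p Q, and the choice of s makes the second coefficient 1.
  Where \<Phi> vanishes, Q is the inverse of \<Lambda> - z - m_N, and 1 / m = -(z + m) identifies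
  the limit with the stated equivalent.\<close>

definition gauss :: "real measure" where
  "gauss = density lborel (\<lambda>x. ennreal (std_normal_density x))"

lemma sets_gauss [measurable_cong, simp]: "sets gauss = sets borel"
  by (simp add: gauss_def)

lemma space_gauss [simp]: "space gauss = UNIV"
  by (simp add: gauss_def)

lemma prob_space_gauss: "prob_space gauss"
  unfolding gauss_def by (rule prob_space_normal_density) simp

interpretation gauss: prob_space gauss
  by (rule prob_space_gauss)

interpretation gauss_prod: product_sigma_finite "\<lambda>_. gauss"
  by standard

lemma integrable_gauss_abs: "integrable gauss (\<lambda>x. \<bar>x\<bar>)"
proof -
  have "integrable lborel (\<lambda>x. std_normal_density x * \<bar>x\<bar>^(2 * 0 + 1))"
    using std_normal_moment_abs_odd[of 0] by (rule integrable.intros)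
  then show ?thesis
    unfolding gauss_def by (subst integrable_density) (auto simp: ac_simps)
qed

lemma integrable_gauss_linear_growth:
  fixes h :: "real \<Rightarrow> 'b::{banach, second_countable_topology}"
  assumes [measurable]: "h \<in> borel_measurable borel" and "\<And>x. norm (h x) \<le> a + b * \<bar>x\<bar>"
  shows "integrable gauss h"
proof (rule Bochner_Integration.integrable_bound)
  show "integrable gauss (\<lambda>x. a + b * \<bar>x\<bar>)"
    using integrable_gauss_abs by auto
  show "AE x in gauss. norm (h x) \<le> norm (a + b * \<bar>x\<bar>)"
    using assms(2) by (intro AE_I2) (metis abs_ge_self order_trans real_norm_def)
qed (simp add: measurable_cong_sets[OF sets_gauss refl])

lemma std_normal_density_deriv:
  "(std_normal_density has_real_derivative - x * std_normal_density x) (at x)"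
proof -
  have "((\<lambda>x. (1 / sqrt (2 * pi)) * exp (- x\<^sup>2 / 2)) has_real_derivative
      (1 / sqrt (2 * pi)) * (exp (- x\<^sup>2 / 2) * (- x))) (at x)"
    by (intro DERIV_cmult) (auto intro!: derivative_eq_intros)
  then show ?thesis by (simp add: std_normal_density_def[abs_def] algebra_simps)
qed

lemma std_normal_density_tendsto_0:
  "(std_normal_density \<longlongrightarrow> 0) at_top" "(std_normal_density \<longlongrightarrow> 0) at_bot"
proof -
  show top: "(std_normal_density \<longlongrightarrow> 0) at_top"
  proof (rule tendsto_sandwich[of "\<lambda>_. 0" _ _ "\<lambda>x. 1 / x"])
    show "\<forall>\<^sub>F x in at_top. std_normal_density x \<le> 1 / x"
    proof (rule eventually_at_top_linorderI[of 1])
      fix x :: real assume x: "1 \<le> x"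
      have "std_normal_density x \<le> exp (- x\<^sup>2 / 2)"
      proof -
        have "1 \<le> sqrt (2 * pi)" using pi_gt3 by simp
        then show ?thesis
          unfolding std_normal_density_def by (simp add: divide_le_eq)
      qed
      also have "\<dots> = 1 / exp (x\<^sup>2 / 2)"
        by (simp add: exp_minus inverse_eq_divide)
      also have "\<dots> \<le> 1 / x"
      proof (rule divide_left_mono)
        have "x \<le> 1 + x\<^sup>2 / 2"
          using sum_squares_ge_zero[of "x - 1" 0] by (simp add: algebra_simps power2_eq_square)
        also have "\<dots> \<le> exp (x\<^sup>2 / 2)" by (rule exp_ge_add_one_self)
        finally show "x \<le> exp (x\<^sup>2 / 2)" .
      qed (use x in auto)
      finally show "std_normal_density x \<le> 1 / x" .
    qed
  qed (auto intro!: tendsto_divide_0 filterlim_at_top_imp_at_infinity filterlim_ident)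
  have "std_normal_density (- x) = std_normal_density x" for x
    by (simp add: std_normal_density_def)
  then show "(std_normal_density \<longlongrightarrow> 0) at_bot"
    using top by (simp add: filterlim_at_bot_mirror)
qed

text \<open>Stein's identity: the integrand \<open>f\<close> is the derivative of the density times
  \<open>h\<close>, and boundedness of \<open>h\<close> kills the boundary terms. For
  \<open>h'\<close> only linear growth is asked, because the derivatives used later contain an entry
  of G itself.\<close>

lemma gauss_ibp_line:
  fixes h h' :: "real \<Rightarrow> complex"
  assumes der: "\<And>x. (h has_vector_derivative h' x) (at x)"
    and cont: "continuous_on UNIV h'"
    and bound: "\<And>x. norm (h x) \<le> C"
    and bound': "\<And>x. norm (h' x) \<le> a + b * \<bar>x\<bar>"
  shows "(\<integral>x. x *\<^sub>R h x \<partial>gauss) = (\<integral>x. h' x \<partial>gauss)"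
proof -
  have conth: "continuous_on UNIV h"
    using der by (meson continuous_at_imp_continuous_on has_vector_derivative_continuous)
  note [measurable] = borel_measurable_continuous_onI[OF conth] borel_measurable_continuous_onI[OF cont]
  have C: "C \<ge> 0" using bound[of 0] norm_ge_zero order_trans by blast
  have I1: "integrable gauss (\<lambda>x. x *\<^sub>R h x)"
    by (rule integrable_gauss_linear_growth[of _ 0 C])
       (auto simp: mult.commute[of C] intro!: mult_left_mono bound)
  have I2: "integrable gauss h'"
    by (rule integrable_gauss_linear_growth[OF _ bound']) measurable
  define f where "f x = std_normal_density x *\<^sub>R (h' x - x *\<^sub>R h x)" for x
  define F where "F x = std_normal_density x *\<^sub>R h x" for x
  have I: "integrable gauss (\<lambda>x. h' x - x *\<^sub>R h x)"
    using I1 I2 by auto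
  then have If: "integrable lborel f"
    unfolding gauss_def f_def by (subst (asm) integrable_density) auto
  have dF: "(F has_vector_derivative f x) (at x)" for x
    unfolding F_def f_def using has_vector_derivative_scaleR[OF std_normal_density_deriv der]
    by (simp add: algebra_simps)
  have lim: "(F \<longlongrightarrow> 0) G" if "(std_normal_density \<longlongrightarrow> 0) G" for G
  proof (rule Lim_null_comparison)
    show "\<forall>\<^sub>F x in G. norm (F x) \<le> std_normal_density x * C"
      unfolding F_def by (auto intro!: always_eventually mult_left_mono bound)
    show "((\<lambda>x. std_normal_density x * C) \<longlongrightarrow> 0) G"
      using tendsto_mult[OF that tendsto_const[of C]] by simp
  qed
  have "(LBINT x=-\<infinity>..\<infinity>. f x) = 0 - 0"
  proof (rule interval_integral_FTC_integrable)
    show "isCont f x" for x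
      unfolding f_def normal_density_def using conth cont
      by (auto intro!: continuous_intros simp: continuous_on_eq_continuous_at)
    show "set_integrable lborel (einterval (- \<infinity>) \<infinity>) f"
      using If by (simp add: einterval_def set_integrable_def)
    show "((F \<circ> real_of_ereal) \<longlongrightarrow> 0) (at_right (- \<infinity>))"
      using lim[OF std_normal_density_tendsto_0(2)]
      by (simp add: ereal_tendsto_simps)
    show "((F \<circ> real_of_ereal) \<longlongrightarrow> 0) (at_left \<infinity>)"
      using lim[OF std_normal_density_tendsto_0(1)]
      by (simp add: ereal_tendsto_simps)
  qed (use dF in auto)
  then have "(\<integral>x. f x \<partial>lborel) = 0"
    by (simp add: interval_lebesgue_integral_def einterval_def set_lebesgue_integral_def)
  then have "(\<integral>x. h' x - x *\<^sub>R h x \<partial>gauss) = 0"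
    unfolding gauss_def f_def by (subst integral_density) auto
  then show ?thesis
    using I1 I2 by simp
qed

lemma integrable_gauss_component:
  assumes "finite I" "i \<in> I"
  shows "integrable (Pi\<^sub>M I (\<lambda>_. gauss)) (\<lambda>w. \<bar>w i\<bar>)"
proof -
  have "distr (Pi\<^sub>M I (\<lambda>_. gauss)) gauss (\<lambda>w. w i) = gauss"
    using assms by (intro distr_PiM_component prob_space_gauss)
  then have "integrable (distr (Pi\<^sub>M I (\<lambda>_. gauss)) gauss (\<lambda>w. w i)) (\<lambda>x. \<bar>x\<bar>)"
    using integrable_gauss_abs by simp
  then show ?thesis
    by (subst (asm) integrable_distr_eq) (use assms in auto)
qed

text \<open>Fubini with coordinate \<open>i\<close> integrated innermost reduces this to the line.
  Derivatives are phrased through \<open>w(i := t)\<close> because that is how the product integral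
  splits. Integrability is exported too, since the identity is later summed over all
  entries.\<close>

lemma gauss_ibp:
  fixes h h' :: "('i \<Rightarrow> real) \<Rightarrow> complex"
  assumes I: "finite I" "i \<in> I"
    and meas [measurable]: "h \<in> borel_measurable (Pi\<^sub>M I (\<lambda>_. gauss))"
      "h' \<in> borel_measurable (Pi\<^sub>M I (\<lambda>_. gauss))"
    and der: "\<And>w t. ((\<lambda>t. h (w(i := t))) has_vector_derivative h' (w(i := t))) (at t)"
    and cont: "\<And>w. continuous_on UNIV (\<lambda>t. h' (w(i := t)))"
    and bound: "\<And>w. norm (h w) \<le> C"
    and bound': "\<And>w. norm (h' w) \<le> a + b * (\<Sum>k\<in>I. \<bar>w k\<bar>)"
  shows "(\<integral>w. w i *\<^sub>R h w \<partial>Pi\<^sub>M I (\<lambda>_. gauss)) = (\<integral>w. h' w \<partial>Pi\<^sub>M I (\<lambda>_. gauss))"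
    and "integrable (Pi\<^sub>M I (\<lambda>_. gauss)) (\<lambda>w. w i *\<^sub>R h w)"
    and "integrable (Pi\<^sub>M I (\<lambda>_. gauss)) h'"
proof -
  let ?J = "I - {i}"
  have ins: "insert i ?J = I" using I by auto
  have C: "C \<ge> 0" using bound norm_ge_zero order_trans by blast
  have [measurable]: "(\<lambda>w. w i) \<in> borel_measurable (Pi\<^sub>M I (\<lambda>_. gauss))"
    using I by (auto intro!: measurable_component_singleton simp: measurable_cong_sets[OF refl sets_gauss[symmetric]])
  show 1: "integrable (Pi\<^sub>M I (\<lambda>_. gauss)) (\<lambda>w. w i *\<^sub>R h w)"
  proof (rule Bochner_Integration.integrable_bound)
    show "integrable (Pi\<^sub>M I (\<lambda>_. gauss)) (\<lambda>w. C * \<bar>w i\<bar>)"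
      using integrable_gauss_component[OF I] by auto
    show "AE w in Pi\<^sub>M I (\<lambda>_. gauss). norm (w i *\<^sub>R h w) \<le> norm (C * \<bar>w i\<bar>)"
      using C bound by (intro AE_I2) (simp add: abs_mult mult.commute[of C] mult_left_mono)
  qed measurable
  interpret P: prob_space "Pi\<^sub>M I (\<lambda>_. gauss)"
    by (intro prob_space_PiM prob_space_gauss)
  show 2: "integrable (Pi\<^sub>M I (\<lambda>_. gauss)) h'"
  proof (rule Bochner_Integration.integrable_bound)
    show "integrable (Pi\<^sub>M I (\<lambda>_. gauss)) (\<lambda>w. a + b * (\<Sum>k\<in>I. \<bar>w k\<bar>))"
      using integrable_gauss_component[OF I(1)] by auto
    show "AE w in Pi\<^sub>M I (\<lambda>_. gauss). norm (h' w) \<le> norm (a + b * (\<Sum>k\<in>I. \<bar>w k\<bar>))"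
      using bound' by (intro AE_I2) (metis abs_ge_self order_trans real_norm_def)
  qed measurable
  have inner: "(\<integral>y. y *\<^sub>R h (x(i := y)) \<partial>gauss) = (\<integral>y. h' (x(i := y)) \<partial>gauss)" for x
  proof (rule gauss_ibp_line[where C = C])
    show "norm (h' (x(i := y))) \<le> (a + b * (\<Sum>k\<in>?J. \<bar>x k\<bar>)) + b * \<bar>y\<bar>" for y
    proof -
      have "(\<Sum>k\<in>I. \<bar>(x(i := y)) k\<bar>) = \<bar>y\<bar> + (\<Sum>k\<in>?J. \<bar>x k\<bar>)"
        using I by (subst sum.remove[of I i]) auto
      then show ?thesis using bound'[of "x(i := y)"] by (simp add: algebra_simps)
    qed
  qed (use der cont bound in auto)
  have "(\<integral>w. w i *\<^sub>R h w \<partial>Pi\<^sub>M I (\<lambda>_. gauss)) = (\<integral>x. (\<integral>y. y *\<^sub>R h (x(i := y)) \<partial>gauss) \<partial>Pi\<^sub>M ?J (\<lambda>_. gauss))"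
    using gauss_prod.product_integral_insert[of ?J i "\<lambda>w. w i *\<^sub>R h w", unfolded ins, OF _ _ 1] I(1) by simp
  also have "\<dots> = (\<integral>x. (\<integral>y. h' (x(i := y)) \<partial>gauss) \<partial>Pi\<^sub>M ?J (\<lambda>_. gauss))"
    by (simp add: inner)
  also have "\<dots> = (\<integral>w. h' w \<partial>Pi\<^sub>M I (\<lambda>_. gauss))"
    using gauss_prod.product_integral_insert[of ?J i h', unfolded ins, OF _ _ 2] I(1) by simp
  finally show "(\<integral>w. w i *\<^sub>R h w \<partial>Pi\<^sub>M I (\<lambda>_. gauss)) = (\<integral>w. h' w \<partial>Pi\<^sub>M I (\<lambda>_. gauss))" .
qed

lemma gauss_components_indep:
  assumes "finite I" "I \<noteq> {}"
  shows "prob_space.indep_vars (Pi\<^sub>M I (\<lambda>_. gauss)) (\<lambda>_. borel) (\<lambda>i w. w i) I"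
proof -
  interpret P: prob_space "Pi\<^sub>M I (\<lambda>_. gauss)"
    by (intro prob_space_PiM prob_space_gauss)
  have "P.indep_vars (\<lambda>_. gauss) (\<lambda>i w. w i) I"
  proof (subst P.indep_vars_iff_distr_eq_PiM'[OF assms(2)])
    have "distr (Pi\<^sub>M I (\<lambda>_. gauss)) (Pi\<^sub>M I (\<lambda>_. gauss)) (\<lambda>w. \<lambda>i\<in>I. w i) =
          distr (Pi\<^sub>M I (\<lambda>_. gauss)) (Pi\<^sub>M I (\<lambda>_. gauss)) (\<lambda>w. w)"
      by (intro distr_cong) (auto simp: space_PiM PiE_def extensional_restrict)
    moreover have "Pi\<^sub>M I (\<lambda>i. distr (Pi\<^sub>M I (\<lambda>_. gauss)) gauss (\<lambda>w. w i)) = Pi\<^sub>M I (\<lambda>_. gauss)"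
      using assms(1) by (intro PiM_cong refl distr_PiM_component prob_space_gauss)
    ultimately show "distr (Pi\<^sub>M I (\<lambda>_. gauss)) (Pi\<^sub>M I (\<lambda>_. gauss)) (\<lambda>w. \<lambda>i\<in>I. w i) =
        Pi\<^sub>M I (\<lambda>i. distr (Pi\<^sub>M I (\<lambda>_. gauss)) gauss (\<lambda>w. w i))"
      by (simp add: distr_id2)
  qed auto
  then show ?thesis
    unfolding P.indep_vars_def by (simp cong: measurable_cong_sets)
qed

text \<open>A linear form in independent standard normals is normal with variance the sum of the
  squared coefficients, and 15 = 1 * 3 * 5 is the sixth moment of a standard normal.\<close>

lemma gauss_linear_form_sixth_moment:
  fixes x :: "'i \<Rightarrow> real"
  assumes I: "finite I" "J \<subseteq> I"
  shows "integrable (Pi\<^sub>M I (\<lambda>_. gauss)) (\<lambda>w. (\<Sum>j\<in>J. x j * w j) ^ 6)"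
    and "(\<integral>w. (\<Sum>j\<in>J. x j * w j) ^ 6 \<partial>Pi\<^sub>M I (\<lambda>_. gauss)) = 15 * (\<Sum>j\<in>J. (x j)\<^sup>2) ^ 3"
proof -
  let ?M = "Pi\<^sub>M I (\<lambda>_. gauss)"
  interpret P: prob_space ?M
    by (intro prob_space_PiM prob_space_gauss)
  have finJ: "finite J" using I finite_subset by blast
  \<comment> \<open>Zero coefficients are dropped because a normal law with deviation 0 has no
    density.\<close>
  define K where "K = {j\<in>J. x j \<noteq> 0}"
  have K: "finite K" "K \<subseteq> I" "K \<subseteq> J" using finJ I by (auto simp: K_def)
  have sumK: "(\<Sum>j\<in>J. x j * w j) = (\<Sum>j\<in>K. x j * w j)" for w :: "'i \<Rightarrow> real"
    using finJ unfolding K_def by (intro sum.mono_neutral_right) auto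
  have sumK2: "(\<Sum>j\<in>J. (x j)\<^sup>2) = (\<Sum>j\<in>K. (x j)\<^sup>2)"
    using finJ unfolding K_def by (intro sum.mono_neutral_right) auto
  have "integrable ?M (\<lambda>w. (\<Sum>j\<in>J. x j * w j) ^ 6) \<and>
    (\<integral>w. (\<Sum>j\<in>J. x j * w j) ^ 6 \<partial>?M) = 15 * (\<Sum>j\<in>J. (x j)\<^sup>2) ^ 3"
  proof (cases "K = {}")
    case True
    then show ?thesis unfolding sumK sumK2 by simp
  next
    case False
    then have Ine: "I \<noteq> {}" using K by auto
    have ind: "P.indep_vars (\<lambda>_. borel) (\<lambda>j w. x j * w j) K"
    proof (rule P.indep_vars_compose2[where Y = "\<lambda>j t. x j * t" and M' = "\<lambda>_. borel"])
      show "P.indep_vars (\<lambda>_. borel) (\<lambda>i w. w i) K"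
        using gauss_components_indep[OF I(1) Ine] K(2) by (rule P.indep_vars_subset)
    qed auto
    have nrm: "distributed ?M lborel (\<lambda>w. x j * w j) (normal_density 0 \<bar>x j\<bar>)" if j: "j \<in> K" for j
    proof -
      have "distr ?M gauss (\<lambda>w. w j) = gauss"
        using I K j by (intro distr_PiM_component prob_space_gauss) auto
      moreover have "distr ?M gauss (\<lambda>w. w j) = distr ?M lborel (\<lambda>w. w j)"
        by (intro distr_cong) auto
      ultimately have "distributed ?M lborel (\<lambda>w. w j) std_normal_density"
        unfolding distributed_def using K j by (auto simp: gauss_def[symmetric])
      from P.normal_density_affine[OF this, of "x j" 0] j show ?thesis
        by (simp add: K_def)
    qed
    define sg where "sg = sqrt (\<Sum>j\<in>K. (x j)\<^sup>2)"
    have "distributed ?M lborel (\<lambda>w. \<Sum>j\<in>K. x j * w j)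
       (normal_density (\<Sum>j\<in>K. 0) (sqrt (\<Sum>j\<in>K. \<bar>x j\<bar>\<^sup>2)))"
      by (rule P.sum_indep_normal[OF K(1) False ind _ nrm]) (auto simp: K_def)
    then have D: "distributed ?M lborel (\<lambda>w. \<Sum>j\<in>K. x j * w j) (normal_density 0 sg)"
      by (simp add: sg_def)
    have sg: "sg > 0"
      unfolding sg_def using False K by (auto intro!: sum_pos simp: K_def)
    have mom: "has_bochner_integral lborel (\<lambda>t. normal_density 0 sg t * (t - 0) ^ (2 * 3))
       (fact (2 * 3) / ((2 / sg\<^sup>2) ^ 3 * fact 3))"
      by (rule normal_moment_even[OF sg])
    have mom': "has_bochner_integral lborel (\<lambda>t. normal_density 0 sg t * t ^ 6) (15 * sg ^ 6)"
      using mom sg by (simp add: fact_numeral field_simps power_numeral_reduce)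
    have "integrable ?M (\<lambda>w. (\<Sum>j\<in>K. x j * w j) ^ 6)"
      using distributed_integrable[OF D, of "\<lambda>t. t ^ 6"] mom'
      by (auto simp: has_bochner_integral_iff)
    moreover have "(\<integral>w. (\<Sum>j\<in>K. x j * w j) ^ 6 \<partial>?M) = 15 * sg ^ 6"
      using distributed_integral[OF D, of "\<lambda>t. t ^ 6"] mom'
      by (auto simp: has_bochner_integral_iff)
    moreover have "sg ^ 6 = (\<Sum>j\<in>K. (x j)\<^sup>2) ^ 3"
    proof -
      have "sg ^ 6 = (sg\<^sup>2) ^ 3" by (simp flip: power_mult)
      then show ?thesis by (simp add: sg_def sum_nonneg)
    qed
    ultimately show ?thesis unfolding sumK sumK2 by simp
  qed
  then show "integrable ?M (\<lambda>w. (\<Sum>j\<in>J. x j * w j) ^ 6)"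
    "(\<integral>w. (\<Sum>j\<in>J. x j * w j) ^ 6 \<partial>?M) = 15 * (\<Sum>j\<in>J. (x j)\<^sup>2) ^ 3" by auto
qed

section \<open>Resolvents of Gram matrices\<close>

text \<open>Vectors of length $n$ are functions on the naturals of which only the values below $n$ matter;
\<open>dot\<close> is bilinear, not sesquilinear.\<close>

definition nrm :: "nat \<Rightarrow> (nat \<Rightarrow> complex) \<Rightarrow> real" where
  "nrm n v = L2_set (\<lambda>a. cmod (v a)) {..<n}"

definition dot :: "nat \<Rightarrow> (nat \<Rightarrow> complex) \<Rightarrow> (nat \<Rightarrow> complex) \<Rightarrow> complex" where
  "dot n u v = (\<Sum>a<n. u a * v a)"

definition std_basis :: "nat \<Rightarrow> nat \<Rightarrow> complex" where
  "std_basis k a = (if a = k then 1 else 0)"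

lemma nrm_nonneg [simp]: "nrm n v \<ge> 0"
  by (simp add: nrm_def)

lemma nrm_power2: "(nrm n v)\<^sup>2 = (\<Sum>a<n. (cmod (v a))\<^sup>2)"
  by (simp add: nrm_def L2_set_def sum_nonneg)

lemma cmod_le_nrm: "a < n \<Longrightarrow> cmod (v a) \<le> nrm n v"
  unfolding nrm_def by (rule member_le_L2_set) auto

lemma nrm_std_basis [simp]: "k < n \<Longrightarrow> nrm n (std_basis k) = 1"
  by (simp add: nrm_def L2_set_def std_basis_def if_distrib[of cmod] if_distrib[of "\<lambda>x. x ^ 2"] cong: if_cong)

lemma nrm_cnj [simp]: "nrm n (\<lambda>a. cnj (v a)) = nrm n v"
  by (simp add: nrm_def)

lemma cmod_sum_mult_le_L2_set:
  fixes f g :: "'b \<Rightarrow> complex"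
  shows "cmod (\<Sum>i\<in>A. f i * g i) \<le> L2_set (\<lambda>i. cmod (f i)) A * L2_set (\<lambda>i. cmod (g i)) A"
proof -
  have "cmod (\<Sum>i\<in>A. f i * g i) \<le> (\<Sum>i\<in>A. cmod (f i * g i))"
    by (rule norm_sum)
  also have "\<dots> = (\<Sum>i\<in>A. \<bar>cmod (f i)\<bar> * \<bar>cmod (g i)\<bar>)"
    by (simp add: norm_mult)
  also have "\<dots> \<le> L2_set (\<lambda>i. cmod (f i)) A * L2_set (\<lambda>i. cmod (g i)) A"
    by (rule L2_set_mult_ineq)
  finally show ?thesis .
qed

lemma cmod_dot_le: "cmod (dot n u v) \<le> nrm n u * nrm n v"
  unfolding dot_def nrm_def by (rule cmod_sum_mult_le_L2_set)

lemma dot_commute: "dot n u v = dot n v u"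
  by (simp add: dot_def mult.commute)

lemma dot_std_basis [simp]: "k < n \<Longrightarrow> dot n (std_basis k) v = v k"
  by (simp add: dot_def std_basis_def if_distrib[of "\<lambda>x. x * _"] cong: if_cong)

lemma dot_cnj: "dot n v (\<lambda>a. cnj (v a)) = of_real ((nrm n v)\<^sup>2)"
  by (simp add: dot_def nrm_power2 complex_norm_square del: of_real_power)

lemma L2_set_prod:
  fixes f :: "nat \<Rightarrow> complex" and g :: "nat \<Rightarrow> complex"
  shows "L2_set (\<lambda>(a, j). cmod (f a * g j)) ({..<n} \<times> {..<p}) = nrm n f * nrm p g"
  unfolding L2_set_def nrm_def
  by (simp add: real_sqrt_mult[symmetric] sum_product sum.cartesian_product norm_mult
      power_mult_distrib case_prod_beta)

lemma L2_set_cmod_add_le: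
  fixes f g :: "'b \<Rightarrow> complex"
  shows "L2_set (\<lambda>i. cmod (f i + g i)) A \<le> L2_set (\<lambda>i. cmod (f i)) A + L2_set (\<lambda>i. cmod (g i)) A"
proof -
  have "L2_set (\<lambda>i. cmod (f i + g i)) A \<le> L2_set (\<lambda>i. cmod (f i) + cmod (g i)) A"
    by (intro L2_set_mono norm_triangle_ineq) auto
  also have "\<dots> \<le> L2_set (\<lambda>i. cmod (f i)) A + L2_set (\<lambda>i. cmod (g i)) A"
    by (rule L2_set_triangle_ineq)
  finally show ?thesis .
qed

lemma L2_set_cmod_sum_le:
  fixes f :: "'c \<Rightarrow> 'b \<Rightarrow> complex"
  assumes "finite K"
  shows "L2_set (\<lambda>i. cmod (\<Sum>k\<in>K. f k i)) A \<le> (\<Sum>k\<in>K. L2_set (\<lambda>i. cmod (f k i)) A)"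
  using assms
proof (induction K rule: finite_induct)
  case (insert k K)
  then show ?case
    using L2_set_cmod_add_le[of "f k" "\<lambda>i. \<Sum>k\<in>K. f k i" A] by simp
qed (simp add: L2_set_def)

lemma L2_set_cmod_mult:
  fixes f :: "'b \<Rightarrow> complex"
  shows "L2_set (\<lambda>i. cmod (c * f i)) A = cmod c * L2_set (\<lambda>i. cmod (f i)) A"
  by (simp add: norm_mult L2_set_right_distrib)

text \<open>Caratheodory's form of the derivative. It fits the resolvent identity, which delivers
  the difference quotient in closed form, so that continuity alone yields differentiability and no
  matrix calculus is needed.\<close>

lemma has_vector_derivative_difference_quotient:
  fixes f :: "real \<Rightarrow> complex"
  assumes "\<And>y. f y - f x = of_real (y - x) * D y" and "isCont D x"
  shows "(f has_vector_derivative D x) (at x)"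
proof -
  have "((\<lambda>y. norm (D y - D x)) \<longlongrightarrow> 0) (at x)"
    using assms(2) unfolding isCont_def by (intro tendsto_norm_zero LIM_zero)
  then have "((\<lambda>y. norm (f y - f x - (y - x) *\<^sub>R D x) / norm (y - x)) \<longlongrightarrow> 0) (at x)"
  proof (rule Lim_transform_eventually)
    show "\<forall>\<^sub>F y in at x. norm (D y - D x) = norm (f y - f x - (y - x) *\<^sub>R D x) / norm (y - x)"
      unfolding assms(1) eventually_at_filter
      by (rule always_eventually)
        (auto simp: scaleR_conv_of_real norm_mult simp flip: right_diff_distrib of_real_diff)
  qed
  then show ?thesis
    by (simp add: has_vector_derivative_def has_derivative_iff_norm bounded_linear_scaleR_left)
qed

text \<open>Q is described only by the entrywise equation (B - z) Q = I, for every noise array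
  \<open>w\<close>. Symmetry, norm bounds and smoothness are all derived from this equation; actual
  matrix inverses appear only when the locale is instantiated.\<close>

locale gram_resolvent =
  fixes n p :: nat and s :: real and z :: complex and G0 :: "nat \<Rightarrow> nat \<Rightarrow> real"
    and Q :: "(nat \<times> nat \<Rightarrow> real) \<Rightarrow> nat \<Rightarrow> nat \<Rightarrow> complex"
  assumes n_pos: "0 < n" and n_le_p: "n \<le> p"
    and s_eq: "s = 1 / sqrt (real n * real p)"
    and z_im: "Im z \<noteq> 0"
    and Q_eq: "\<And>w a b. a < n \<Longrightarrow> b < n \<Longrightarrow>
      of_real s * ((\<Sum>j<p. of_real (G0 a j + w (a, j)) * (\<Sum>k<n. of_real (G0 k j + w (k, j)) * Q w k b))
        - of_nat p * Q w a b) - z * Q w a b = (if a = b then 1 else 0)"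
begin

definition "\<eta> = \<bar>Im z\<bar>"

text \<open>Chosen so that G^T Q has operator norm at most sqrt (K p), see
  \<open>nrm_Y_le\<close>.\<close>

definition "K = 1 / \<eta> + (cmod z + 1) / \<eta>\<^sup>2"

definition G :: "(nat \<times> nat \<Rightarrow> real) \<Rightarrow> nat \<Rightarrow> nat \<Rightarrow> complex" where
  "G w a j = of_real (G0 a j + w (a, j))"

definition GT :: "(nat \<times> nat \<Rightarrow> real) \<Rightarrow> (nat \<Rightarrow> complex) \<Rightarrow> nat \<Rightarrow> complex" where
  "GT w q j = (\<Sum>k<n. G w k j * q k)"

definition R :: "(nat \<times> nat \<Rightarrow> real) \<Rightarrow> (nat \<Rightarrow> complex) \<Rightarrow> nat \<Rightarrow> complex" where
  "R w v a = (\<Sum>b<n. Q w a b * v b)"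

definition Y :: "(nat \<times> nat \<Rightarrow> real) \<Rightarrow> (nat \<Rightarrow> complex) \<Rightarrow> nat \<Rightarrow> complex" where
  "Y w v = GT w (R w v)"

lemma p_pos: "0 < p" using n_pos n_le_p by simp
lemma \<eta>_pos: "\<eta> > 0" using z_im by (simp add: \<eta>_def)
lemma s_pos: "s > 0" using n_pos p_pos by (simp add: s_eq)
lemma K_pos: "K > 0" using \<eta>_pos by (simp add: K_def add_pos_pos add_nonneg_pos)
lemma s2_eq: "s\<^sup>2 * real n * real p = 1" using n_pos p_pos by (simp add: s_eq power_divide)
lemma s_p: "s * sqrt (real p) = 1 / sqrt (real n)"
  using n_pos p_pos by (simp add: s_eq real_sqrt_mult)
lemma inv_s_le: "1 / s \<le> real p"
proof -
  have "1 / s = sqrt (real n * real p)" by (simp add: s_eq)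
  also have "\<dots> \<le> sqrt (real p * real p)"
    using n_le_p by (intro real_sqrt_le_mono mult_right_mono) auto
  finally show ?thesis by simp
qed

lemma R_eq:
  assumes "a < n"
  shows "of_real s * ((\<Sum>j<p. G w a j * Y w v j) - of_nat p * R w v a) - z * R w v a = v a"
proof -
  have 1: "(\<Sum>j<p. G w a j * Y w v j) =
      (\<Sum>b<n. (\<Sum>j<p. G w a j * (\<Sum>k<n. G w k j * Q w k b)) * v b)"
  proof -
    have "(\<Sum>j<p. G w a j * Y w v j) = (\<Sum>j<p. \<Sum>k<n. \<Sum>b<n. G w a j * (G w k j * Q w k b) * v b)"
      by (simp add: Y_def GT_def R_def sum_distrib_left mult.assoc)
    also have "\<dots> = (\<Sum>j<p. \<Sum>b<n. \<Sum>k<n. G w a j * (G w k j * Q w k b) * v b)"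
      by (intro sum.cong refl sum.swap)
    also have "\<dots> = (\<Sum>b<n. \<Sum>j<p. \<Sum>k<n. G w a j * (G w k j * Q w k b) * v b)"
      by (rule sum.swap)
    finally show ?thesis by (simp add: sum_distrib_left sum_distrib_right)
  qed
  have "of_real s * ((\<Sum>j<p. G w a j * Y w v j) - of_nat p * R w v a) - z * R w v a =
    (\<Sum>b<n. (of_real s * ((\<Sum>j<p. G w a j * (\<Sum>k<n. G w k j * Q w k b)) - of_nat p * Q w a b) - z * Q w a b) * v b)"
    unfolding 1 R_def
    by (simp add: sum_distrib_left sum_subtractf sum.distrib algebra_simps)
  also have "\<dots> = (\<Sum>b<n. (if a = b then 1 else 0) * v b)"
    using Q_eq[OF assms, of _ w] by (intro sum.cong refl) (simp add: G_def)
  also have "\<dots> = v a"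
    using assms by (simp add: if_distrib[of "\<lambda>x. x * _"] cong: if_cong)
  finally show ?thesis .
qed

text \<open>Write u as (B - z) Q u and move G onto the other factor. Symmetry of Q, both norm bounds
  and the difference formula \<open>f_diff\<close> are all instances of this identity.\<close>

lemma dot_resolvent:
  "dot n u q = of_real s * dot p (Y w u) (GT w q) - (of_real s * of_nat p + z) * dot n (R w u) q"
proof -
  have "dot n u q = (\<Sum>a<n. (of_real s * ((\<Sum>j<p. G w a j * Y w u j) - of_nat p * R w u a) - z * R w u a) * q a)"
    unfolding dot_def by (intro sum.cong refl) (simp add: R_eq)
  also have "\<dots> = of_real s * (\<Sum>a<n. \<Sum>j<p. G w a j * Y w u j * q a)
      - (of_real s * of_nat p + z) * dot n (R w u) q"
    by (simp add: dot_def sum_distrib_left sum_distrib_right sum_subtractf algebra_simps sum.distrib)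
  also have "(\<Sum>a<n. \<Sum>j<p. G w a j * Y w u j * q a) = (\<Sum>j<p. \<Sum>a<n. G w a j * Y w u j * q a)"
    by (rule sum.swap)
  also have "\<dots> = dot p (Y w u) (GT w q)"
    by (simp add: dot_def GT_def sum_distrib_left mult_ac)
  finally show ?thesis .
qed

text \<open>Q is known only as a right inverse, so symmetry needs an argument: expanding either side
  by \<open>dot_resolvent\<close> gives an expression symmetric in u and v.\<close>

lemma R_sym: "dot n u (R w v) = dot n v (R w u)"
  using dot_resolvent[of u "R w v" w] dot_resolvent[of v "R w u" w]
  by (simp add: dot_commute[of _ "R w u" "R w v"] dot_commute[of _ "Y w u" "Y w v"] flip: Y_def)

text \<open>Pairing with the conjugate makes everything on the right real except z. The imaginary
  part then bounds Q, the real part bounds G^T Q.\<close>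

lemma R_norm_identity:
  "dot n u (\<lambda>a. cnj (R w u a)) =
     of_real s * of_real ((nrm p (Y w u))\<^sup>2) - (of_real s * of_nat p + z) * of_real ((nrm n (R w u))\<^sup>2)"
proof -
  have "GT w (\<lambda>a. cnj (R w u a)) = (\<lambda>j. cnj (Y w u j))"
    by (simp add: Y_def GT_def G_def fun_eq_iff)
  then show ?thesis
    using dot_resolvent[of u "\<lambda>a. cnj (R w u a)" w] by (simp add: dot_cnj)
qed

lemma nrm_R_le: "nrm n (R w u) \<le> nrm n u / \<eta>"
proof -
  let ?r = "nrm n (R w u)"
  have "Im (dot n u (\<lambda>a. cnj (R w u a))) = - Im z * ?r\<^sup>2"
    unfolding R_norm_identity by simp
  then have "\<eta> * ?r\<^sup>2 = \<bar>Im (dot n u (\<lambda>a. cnj (R w u a)))\<bar>"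
    by (simp add: \<eta>_def abs_mult)
  also have "\<dots> \<le> nrm n u * ?r"
    using abs_Im_le_cmod cmod_dot_le[of n u "\<lambda>a. cnj (R w u a)"] by (metis nrm_cnj order_trans)
  finally have "?r * (\<eta> * ?r) \<le> ?r * nrm n u" by (simp add: power2_eq_square mult_ac)
  then have "\<eta> * ?r \<le> nrm n u \<or> ?r = 0"
    using nrm_nonneg[of n "R w u"] by (metis mult_le_cancel_left_pos order_le_less)
  then show ?thesis
    using \<eta>_pos by (auto simp: field_simps)
qed

text \<open>The real part of \<open>R_norm_identity\<close> is solved for the norm of G^T Q u. Both
  the centring s p and the factor 1 / s contribute at most order p after division by s. The bound
  holds for every realisation: large entries of G are compensated by Q, so the noise never has to be
  truncated.\<close>

lemma nrm_Y_le: "nrm p (Y w u) \<le> sqrt (K * real p) * nrm n u"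
proof -
  let ?r = "nrm n (R w u)" and ?y = "nrm p (Y w u)" and ?u = "nrm n u"
  have r: "?r \<le> ?u / \<eta>" by (rule nrm_R_le)
  have r2: "?r\<^sup>2 \<le> ?u\<^sup>2 / \<eta>\<^sup>2"
    using power_mono[OF r, of 2] by (simp add: power_divide)
  have "Re (dot n u (\<lambda>a. cnj (R w u a))) = s * ?y\<^sup>2 - (s * real p + Re z) * ?r\<^sup>2"
    unfolding R_norm_identity by simp
  moreover have "Re (dot n u (\<lambda>a. cnj (R w u a))) \<le> ?u * ?r"
    using complex_Re_le_cmod cmod_dot_le[of n u "\<lambda>a. cnj (R w u a)"] by (metis nrm_cnj order_trans)
  ultimately have "s * ?y\<^sup>2 \<le> ?u * ?r + (s * real p + Re z) * ?r\<^sup>2" by linarith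
  also have "\<dots> \<le> ?u * ?r + (s * real p + cmod z) * ?r\<^sup>2"
    by (intro add_left_mono mult_right_mono) (auto simp: complex_Re_le_cmod)
  also have "\<dots> \<le> ?u * (?u / \<eta>) + (s * real p + cmod z) * (?u\<^sup>2 / \<eta>\<^sup>2)"
    using r r2 s_pos by (intro add_mono mult_left_mono) auto
  finally have "?y\<^sup>2 \<le> (1 / s) * (?u * (?u / \<eta>) + (s * real p + cmod z) * (?u\<^sup>2 / \<eta>\<^sup>2))"
    using s_pos by (simp add: field_simps)
  also have "\<dots> = (1 / s) * ((1 / \<eta> + cmod z / \<eta>\<^sup>2) * ?u\<^sup>2) + real p * (?u\<^sup>2 / \<eta>\<^sup>2)"
    using s_pos \<eta>_pos by (simp add: field_simps power2_eq_square)
  also have "\<dots> \<le> real p * ((1 / \<eta> + cmod z / \<eta>\<^sup>2) * ?u\<^sup>2) + real p * (?u\<^sup>2 / \<eta>\<^sup>2)"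
    using \<eta>_pos by (intro add_right_mono mult_right_mono inv_s_le) auto
  also have "\<dots> = K * real p * ?u\<^sup>2"
    by (simp add: K_def field_simps add_divide_distrib)
  finally have "?y\<^sup>2 \<le> K * real p * ?u\<^sup>2" .
  from real_sqrt_le_mono[OF this] show ?thesis
    by (simp add: real_sqrt_mult)
qed

section \<open>Dependence of the resolvent on a single noise entry\<close>

lemma GT_update:
  assumes "a < n" "j < p"
  shows "GT (w((a, j) := t)) q i = GT w q i + (if i = j then of_real (t - w (a, j)) * q a else 0)"
proof -
  have "GT (w((a, j) := t)) q i = (\<Sum>k<n. G w k i * q k + (if k = a \<and> i = j then of_real (t - w (a, j)) * q a else 0))"
    unfolding GT_def by (intro sum.cong refl) (auto simp: G_def algebra_simps)
  also have "\<dots> = GT w q i + (\<Sum>k<n. (if k = a then (if i = j then of_real (t - w (a, j)) * q a else 0) else 0))"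
    unfolding sum.distrib GT_def by (intro arg_cong2[of _ _ _ _ "(+)"] sum.cong refl) auto
  finally show ?thesis using assms by simp
qed

definition f :: "(nat \<Rightarrow> complex) \<Rightarrow> (nat \<Rightarrow> complex) \<Rightarrow> (nat \<times> nat \<Rightarrow> real) \<Rightarrow> complex" where
  "f u v w = dot n u (R w v)"

text \<open>The resolvent identity for a change of one entry of G. Evaluating the u-factors at the
  new point and the v-factors at the old one makes it exact, with no remainder quadratic in
  \<open>t - t0\<close>.\<close>

lemma f_diff:
  fixes w :: "nat \<times> nat \<Rightarrow> real"
  assumes aj: "a < n" "j < p"
  defines "w' \<equiv> \<lambda>t. w((a, j) := t)"
  shows "f u v (w' t) - f u v (w' t0) = of_real (t - t0) *
    (- of_real s * (R (w' t) u a * Y (w' t0) v j + Y (w' t) u j * R (w' t0) v a))"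
proof -
  let ?w = "w' t" and ?o = "w' t0"
  have upd: "?w = ?o((a, j) := t)" "?o = ?w((a, j) := t0)" unfolding w'_def fun_upd_upd by (rule refl)+
  have at: "?o (a, j) = t0" "?w (a, j) = t" by (auto simp: w'_def)
  have 1: "GT ?o (R ?w u) i = Y ?w u i - (if i = j then of_real (t - t0) * R ?w u a else 0)" for i
    using GT_update[OF aj, of ?w t0 "R ?w u" i] by (simp add: at Y_def algebra_simps flip: upd(2))
  have 2: "GT ?w (R ?o v) i = Y ?o v i + (if i = j then of_real (t - t0) * R ?o v a else 0)" for i
    using GT_update[OF aj, of ?o t "R ?o v" i] by (simp add: at Y_def flip: upd(1))
  have d1: "dot p (Y ?o v) (GT ?o (R ?w u)) = dot p (Y ?o v) (Y ?w u) - of_real (t - t0) * (Y ?o v j * R ?w u a)"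
    unfolding dot_def 1 right_diff_distrib sum_subtractf
    using aj by (simp add: if_distrib[of "\<lambda>x. _ * x"] algebra_simps cong: if_cong)
  have d2: "dot p (Y ?w u) (GT ?w (R ?o v)) = dot p (Y ?w u) (Y ?o v) + of_real (t - t0) * (Y ?w u j * R ?o v a)"
    unfolding dot_def 2 distrib_left sum.distrib
    using aj by (simp add: if_distrib[of "\<lambda>x. _ * x"] algebra_simps cong: if_cong)
  \<comment> \<open>The two values are expanded by \<open>dot_resolvent\<close> at opposite points,
    so that both contain the same products of new u-quantities with old v-quantities; these cancel
    in the difference.\<close>
  have "f u v ?w = dot n v (R ?w u)" unfolding f_def by (rule R_sym)
  also have "\<dots> = of_real s * dot p (Y ?o v) (GT ?o (R ?w u)) - (of_real s * of_nat p + z) * dot n (R ?o v) (R ?w u)"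
    by (rule dot_resolvent)
  finally have A: "f u v ?w = \<dots>" .
  have B: "f u v ?o = of_real s * dot p (Y ?w u) (GT ?w (R ?o v)) - (of_real s * of_nat p + z) * dot n (R ?w u) (R ?o v)"
    unfolding f_def by (rule dot_resolvent)
  show ?thesis
    unfolding A B d1 d2 dot_commute[of n "R ?w u" "R ?o v"] dot_commute[of p "Y ?w u" "Y ?o v"]
    by (simp add: algebra_simps)
qed

lemma cmod_R_le: "a < n \<Longrightarrow> cmod (R w v a) \<le> nrm n v / \<eta>"
  using cmod_le_nrm nrm_R_le order_trans by blast

lemma cmod_Y_le: "j < p \<Longrightarrow> cmod (Y w v j) \<le> sqrt (K * real p) * nrm n v"
  using cmod_le_nrm nrm_Y_le order_trans by blast

lemma cmod_f_le: "cmod (f u v w) \<le> nrm n u * nrm n v / \<eta>"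
  unfolding f_def using cmod_dot_le[of n u "R w v"] mult_left_mono[OF nrm_R_le[of w v] nrm_nonneg[of n u]]
  by simp

definition Df :: "(nat \<Rightarrow> complex) \<Rightarrow> (nat \<Rightarrow> complex) \<Rightarrow> (nat \<times> nat \<Rightarrow> real) \<Rightarrow> nat \<times> nat \<Rightarrow> complex" where
  "Df u v w = (\<lambda>(a, j). - of_real s * (R w u a * Y w v j + Y w u j * R w v a))"

text \<open>A Lipschitz bound, from the exact difference formula and the uniform bounds on
  \<open>R\<close> and \<open>Y\<close>. It has to precede \<open>deriv_f\<close>, where the
  difference quotient must already be known to be continuous.\<close>

lemma continuous_f:
  assumes aj: "a < n" "j < p"
  shows "continuous_on UNIV (\<lambda>t. f u v (w((a, j) := t)))"
proof -
  define C where "C = s * (nrm n u / \<eta> * (sqrt (K * real p) * nrm n v) + sqrt (K * real p) * nrm n u * (nrm n v / \<eta>))"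
  have "C \<ge> 0" unfolding C_def using s_pos \<eta>_pos K_pos by (intro mult_nonneg_nonneg add_nonneg_nonneg) auto
  have *: "cmod (f u v (w((a, j) := t)) - f u v (w((a, j) := t'))) \<le> C * \<bar>t - t'\<bar>" for t t'
  proof -
    have "cmod (f u v (w((a, j) := t)) - f u v (w((a, j) := t'))) = \<bar>t - t'\<bar> * (s *
      cmod (R (w((a, j) := t)) u a * Y (w((a, j) := t')) v j + Y (w((a, j) := t)) u j * R (w((a, j) := t')) v a))"
      unfolding f_diff[OF aj] norm_mult using s_pos by (simp del: of_real_diff)
    also have "\<dots> \<le> \<bar>t - t'\<bar> * C"
      unfolding C_def using s_pos \<eta>_pos K_pos aj
      by (intro mult_left_mono order_trans[OF norm_triangle_ineq] add_mono; (unfold norm_mult)?;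
          (intro mult_mono cmod_R_le cmod_Y_le)?) auto
    finally show ?thesis by (simp add: mult.commute)
  qed
  have "C-lipschitz_on UNIV (\<lambda>t. f u v (w((a, j) := t)))"
    using * \<open>C \<ge> 0\<close> by (intro lipschitz_onI) (auto simp: dist_norm)
  then show ?thesis by (rule lipschitz_on_continuous_on)
qed

lemma R_eq_f: "a < n \<Longrightarrow> R w v a = f (std_basis a) v w"
  by (simp add: f_def)

lemma continuous_R:
  assumes "a < n" "j < p" "b < n"
  shows "continuous_on UNIV (\<lambda>t. R (w((a, j) := t)) v b)"
  using continuous_f[OF assms(1,2)] assms(3) by (simp add: R_eq_f)

lemma continuous_G: "continuous_on UNIV (\<lambda>t. G (w((a, j) := t)) k i)"
  unfolding G_def fun_upd_def by (cases "(k, i) = (a, j)") (auto intro!: continuous_intros)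

lemma continuous_Y:
  assumes "a < n" "j < p"
  shows "continuous_on UNIV (\<lambda>t. Y (w((a, j) := t)) v i)"
  unfolding Y_def GT_def using assms
  by (auto intro!: continuous_on_sum continuous_on_mult continuous_R continuous_G)

lemma deriv_f:
  assumes aj: "a < n" "j < p"
  shows "((\<lambda>t. f u v (w((a, j) := t))) has_vector_derivative Df u v (w((a, j) := t)) (a, j)) (at t)"
proof -
  define D where "D t' = - of_real s * (R (w((a, j) := t')) u a * Y (w((a, j) := t)) v j
     + Y (w((a, j) := t')) u j * R (w((a, j) := t)) v a)" for t'
  have "((\<lambda>t. f u v (w((a, j) := t))) has_vector_derivative D t) (at t)"
  proof (rule has_vector_derivative_difference_quotient)
    have "continuous_on UNIV D"
      unfolding D_def using aj by (auto intro!: continuous_intros continuous_R continuous_Y)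
    then show "isCont D t" by (simp add: continuous_on_eq_continuous_at)
  qed (simp add: f_diff[OF aj] D_def)
  then show ?thesis by (simp add: D_def Df_def)
qed

text \<open>Both terms of the gradient are outer products, so their norms over all n p entries
  factorise. With \<open>s_p\<close> the gradient has norm of order 1 / sqrt n.\<close>

lemma L2_set_Df_le:
  "L2_set (\<lambda>i. cmod (Df u v w i)) ({..<n} \<times> {..<p}) \<le> 2 * sqrt K / (\<eta> * sqrt (real n)) * (nrm n u * nrm n v)"
proof -
  let ?A = "{..<n} \<times> {..<p}"
  have "L2_set (\<lambda>i. cmod (Df u v w i)) ?A =
      s * L2_set (\<lambda>i. cmod ((\<lambda>(a, j). R w u a * Y w v j) i + (\<lambda>(a, j). R w v a * Y w u j) i)) ?A"
    unfolding Df_def using s_pos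
    by (subst L2_set_right_distrib) (auto intro!: L2_set_cong simp: norm_mult mult.commute)
  also have "\<dots> \<le> s * (L2_set (\<lambda>i. cmod ((\<lambda>(a, j). R w u a * Y w v j) i)) ?A
     + L2_set (\<lambda>i. cmod ((\<lambda>(a, j). R w v a * Y w u j) i)) ?A)"
    using s_pos by (intro mult_left_mono L2_set_cmod_add_le) auto
  also have "\<dots> = s * (nrm n (R w u) * nrm p (Y w v) + nrm n (R w v) * nrm p (Y w u))"
    by (simp add: case_prod_beta' L2_set_prod[unfolded case_prod_beta'])
  also have "\<dots> \<le> s * (nrm n u / \<eta> * (sqrt (K * real p) * nrm n v) + nrm n v / \<eta> * (sqrt (K * real p) * nrm n u))"
    using s_pos \<eta>_pos by (intro mult_left_mono add_mono mult_mono nrm_R_le nrm_Y_le) auto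
  also have "\<dots> = 2 * (s * sqrt (real p)) * sqrt K / \<eta> * (nrm n u * nrm n v)"
    by (simp add: real_sqrt_mult field_simps)
  finally show ?thesis unfolding s_p by (simp add: field_simps)
qed

end

text \<open>An absorption inequality: x will be the modulus of \<open>Phi\<close>, b a bound for
  \<open>E1\<close> plus \<open>kappa\<close>, and c x^4 a bound for \<open>E2\<close>. Only half of
  x^6 appears on the right, so it can be moved to the left after integration. The constants 1024 =
  4^5 and 16 = 4^2 come from the threshold 4 in the case splits.\<close>

lemma young_sixth:
  fixes x b c :: real
  assumes "x \<ge> 0" "b \<ge> 0" "c \<ge> 0"
  shows "x ^ 5 * b + c * x ^ 4 \<le> x ^ 6 / 2 + 1024 * b ^ 6 + 16 * c ^ 3"
proof -
  have "x ^ 5 * b \<le> x ^ 6 / 4 + 1024 * b ^ 6"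
  proof (cases "4 * b \<le> x")
    case True
    have "x ^ 5 * b \<le> x ^ 5 * (x / 4)" using True assms by (intro mult_left_mono) auto
    also have "\<dots> = x ^ 6 / 4" by (simp add: power_numeral_reduce)
    also have "\<dots> \<le> x ^ 6 / 4 + 1024 * b ^ 6" using assms by simp
    finally show ?thesis .
  next
    case False
    have "x ^ 5 * b \<le> (4 * b) ^ 5 * b" using False assms by (intro mult_right_mono power_mono) auto
    also have "\<dots> = 1024 * b ^ 6" by (simp add: power_numeral_reduce)
    also have "\<dots> \<le> x ^ 6 / 4 + 1024 * b ^ 6" using assms by simp
    finally show ?thesis .
  qed
  moreover have "c * x ^ 4 \<le> x ^ 6 / 4 + 16 * c ^ 3"
  proof (cases "4 * c \<le> x ^ 2")
    case True
    have "c * x ^ 4 \<le> (x ^ 2 / 4) * x ^ 4" using True assms by (intro mult_right_mono) auto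
    also have "\<dots> = x ^ 6 / 4" by (simp add: power_numeral_reduce)
    also have "\<dots> \<le> x ^ 6 / 4 + 16 * c ^ 3" using assms by simp
    finally show ?thesis .
  next
    case False
    have "c * x ^ 4 = c * (x ^ 2) ^ 2" by (simp flip: power_mult)
    also have "\<dots> \<le> c * (4 * c) ^ 2" using False assms by (intro mult_left_mono power_mono) auto
    also have "\<dots> = 16 * c ^ 3" by (simp add: power_numeral_reduce)
    also have "\<dots> \<le> x ^ 6 / 4 + 16 * c ^ 3" using assms by simp
    finally show ?thesis .
  qed
  ultimately show ?thesis by simp
qed

text \<open>Jensen's inequality for t^k with equal weights.\<close>

lemma power_sum_le:
  fixes f :: "'a \<Rightarrow> real"
  assumes "finite A" "\<And>i. i \<in> A \<Longrightarrow> 0 \<le> f i" "A \<noteq> {}"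
  shows "(\<Sum>i\<in>A. f i) ^ k \<le> real (card A) ^ (k - 1) * (\<Sum>i\<in>A. f i ^ k)"
proof -
  have "((\<Sum>i\<in>A. (1 / real (card A)) *\<^sub>R f i)) ^ k \<le> (\<Sum>i\<in>A. (1 / real (card A)) * f i ^ k)"
  proof (rule convex_on_sum[where C = "{0..}" and f = "\<lambda>x. x ^ k"])
    show "convex_on {0..} (\<lambda>x::real. x ^ k)"
      by (cases "even k") (auto intro: convex_power_odd convex_on_subset[OF convex_power_even])
  qed (use assms in \<open>auto simp: card_gt_0_iff\<close>)
  then have "(\<Sum>i\<in>A. f i) ^ k / real (card A) ^ k \<le> (\<Sum>i\<in>A. f i ^ k) / real (card A)"
    by (simp add: sum_divide_distrib[symmetric] power_divide)
  moreover have "card A > 0" using assms by (simp add: card_gt_0_iff)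
  ultimately show ?thesis
    by (cases k) (auto simp: field_simps)
qed

lemma add_power6_le: "0 \<le> a \<Longrightarrow> 0 \<le> b \<Longrightarrow> (a + b) ^ 6 \<le> 32 * (a ^ 6 + b ^ 6)" for a b :: real
  using power_sum_le[of "{False, True}" "\<lambda>i. if i then a else b" 6] by (simp add: ac_simps)

text \<open>Serves integrability only, so the bound may depend on n and p in any way. The
  quantitative estimates are stated separately.\<close>

definition bdd_fun :: "('a \<Rightarrow> complex) \<Rightarrow> bool" where
  "bdd_fun h \<longleftrightarrow> (\<exists>C. \<forall>w. cmod (h w) \<le> C)"

lemma bdd_funI: "(\<And>w. cmod (h w) \<le> C) \<Longrightarrow> bdd_fun h"
  by (auto simp: bdd_fun_def)

lemma bdd_funE:
  assumes "bdd_fun h"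
  obtains C where "C \<ge> 0" "\<And>w. cmod (h w) \<le> C"
  using assms unfolding bdd_fun_def by (meson norm_ge_zero order_trans)

lemma bdd_fun_const: "bdd_fun (\<lambda>_. c)"
  by (rule bdd_funI) (rule order_refl)

lemma bdd_fun_add: "bdd_fun g \<Longrightarrow> bdd_fun h \<Longrightarrow> bdd_fun (\<lambda>w. g w + h w)"
  unfolding bdd_fun_def by (meson norm_triangle_le add_mono)

lemma bdd_fun_mult: "bdd_fun g \<Longrightarrow> bdd_fun h \<Longrightarrow> bdd_fun (\<lambda>w. g w * h w)"
proof -
  assume "bdd_fun g" "bdd_fun h"
  then obtain C D where "C \<ge> 0" "\<And>w. cmod (g w) \<le> C" "\<And>w. cmod (h w) \<le> D"
    by (auto elim!: bdd_funE)
  then show ?thesis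
    by (intro bdd_funI[of _ "C * D"]) (auto simp: norm_mult intro!: mult_mono)
qed

lemma bdd_fun_uminus: "bdd_fun g \<Longrightarrow> bdd_fun (\<lambda>w. - g w)"
  by (simp add: bdd_fun_def)

lemma bdd_fun_diff: "bdd_fun g \<Longrightarrow> bdd_fun h \<Longrightarrow> bdd_fun (\<lambda>w. g w - h w)"
  using bdd_fun_add[of g "\<lambda>w. - h w"] bdd_fun_uminus[of h] by simp

lemma bdd_fun_divide: "bdd_fun g \<Longrightarrow> bdd_fun (\<lambda>w. g w / c)"
  using bdd_fun_mult[of g "\<lambda>_. 1 / c"] bdd_fun_const[of "1 / c"] by simp

lemma bdd_fun_cnj: "bdd_fun g \<Longrightarrow> bdd_fun (\<lambda>w. cnj (g w))"
  by (simp add: bdd_fun_def)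

lemma bdd_fun_sum: "finite A \<Longrightarrow> (\<And>i. i \<in> A \<Longrightarrow> bdd_fun (g i)) \<Longrightarrow> bdd_fun (\<lambda>w. \<Sum>i\<in>A. g i w)"
  by (induction A rule: finite_induct) (auto intro: bdd_fun_const bdd_fun_add)

lemma bdd_fun_power: "bdd_fun g \<Longrightarrow> bdd_fun (\<lambda>w. g w ^ k)"
  by (induction k) (auto intro: bdd_fun_const bdd_fun_mult)

lemmas bdd_fun_intros = bdd_fun_const bdd_fun_add bdd_fun_mult bdd_fun_uminus bdd_fun_diff
  bdd_fun_divide bdd_fun_cnj bdd_fun_sum bdd_fun_power

lemma borel_measurable_cnj: "h \<in> borel_measurable M \<Longrightarrow> (\<lambda>w. cnj (h w)) \<in> borel_measurable M"
  by (rule borel_measurable_continuous_on[of cnj]) (auto intro!: continuous_intros)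

text \<open>\<open>CP\<close> bounds the trace of the spike s G0 G0^T, which is the squared
  Frobenius norm of the signal divided by \<sigma>_N. Apart from the norms of the test vectors, the
  later moment constants depend only on z and \<open>CP\<close>.\<close>

locale gram_resolvent_gauss = gram_resolvent +
  fixes CP :: real
  assumes Q_meas: "\<And>a b. a < n \<Longrightarrow> b < n \<Longrightarrow>
      (\<lambda>w. Q w a b) \<in> borel_measurable (Pi\<^sub>M ({..<n} \<times> {..<p}) (\<lambda>_. gauss))"
    and CP: "s * (\<Sum>j<p. \<Sum>k<n. (G0 k j)\<^sup>2) \<le> CP"
begin

abbreviation "I \<equiv> {..<n} \<times> {..<p}"
abbreviation "\<mu> \<equiv> Pi\<^sub>M I (\<lambda>_. gauss)"

sublocale P: prob_space \<mu>
  by (intro prob_space_PiM prob_space_gauss)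

lemma CP_nonneg: "CP \<ge> 0"
  by (rule order_trans[OF _ CP]) (use s_pos in \<open>auto intro!: mult_nonneg_nonneg sum_nonneg\<close>)

definition x :: "(nat \<Rightarrow> complex) \<Rightarrow> nat \<Rightarrow> complex" where
  "x u j = (\<Sum>k<n. of_real (G0 k j) * u k)"

definition Lam :: "(nat \<Rightarrow> complex) \<Rightarrow> nat \<Rightarrow> complex" where
  "Lam u a = of_real s * (\<Sum>j<p. of_real (G0 a j) * x u j)"

definition m :: "(nat \<times> nat \<Rightarrow> real) \<Rightarrow> complex" where
  "m w = (\<Sum>k<n. Q w k k) / of_nat n"

definition Dm :: "(nat \<times> nat \<Rightarrow> real) \<Rightarrow> nat \<times> nat \<Rightarrow> complex" where
  "Dm w i = (\<Sum>k<n. Df (std_basis k) (std_basis k) w i) / of_nat n"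

definition Phi :: "(nat \<Rightarrow> complex) \<Rightarrow> (nat \<Rightarrow> complex) \<Rightarrow> (nat \<times> nat \<Rightarrow> real) \<Rightarrow> complex" where
  "Phi u v w = (z + m w) * f u v w + dot n u v - f (Lam u) v w"

definition DPhi :: "(nat \<Rightarrow> complex) \<Rightarrow> (nat \<Rightarrow> complex) \<Rightarrow> (nat \<times> nat \<Rightarrow> real) \<Rightarrow> nat \<times> nat \<Rightarrow> complex" where
  "DPhi u v w i = (z + m w) * Df u v w i + Dm w i * f u v w - Df (Lam u) v w i"

text \<open>A polynomial in \<open>Phi\<close> and its conjugate, so that its derivative along a
  real variable follows from the product rule, while \<open>Phi * g\<close> is the sixth power of
  the modulus.\<close>

definition g :: "(nat \<Rightarrow> complex) \<Rightarrow> (nat \<Rightarrow> complex) \<Rightarrow> (nat \<times> nat \<Rightarrow> real) \<Rightarrow> complex" where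
  "g u v w = Phi u v w ^ 2 * cnj (Phi u v w) ^ 3"

definition Dg :: "(nat \<Rightarrow> complex) \<Rightarrow> (nat \<Rightarrow> complex) \<Rightarrow> (nat \<times> nat \<Rightarrow> real) \<Rightarrow> nat \<times> nat \<Rightarrow> complex" where
  "Dg u v w i = 2 * Phi u v w * DPhi u v w i * cnj (Phi u v w) ^ 3
     + 3 * Phi u v w ^ 2 * cnj (Phi u v w) ^ 2 * cnj (DPhi u v w i)"

text \<open>For i = (a, j), the derivative of coordinate j of G^T Q v in the entry (a, j): the
  explicit factor G contributes (Q v)_a, the sum is the contribution through Q.\<close>

definition DY :: "(nat \<Rightarrow> complex) \<Rightarrow> (nat \<times> nat \<Rightarrow> real) \<Rightarrow> nat \<times> nat \<Rightarrow> complex" where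
  "DY v w i = R w v (fst i) + (\<Sum>k<n. G w k (snd i) * Df (std_basis k) v w i)"

text \<open>The cross term s u^T G0 W^T Q v between signal and noise. It is not integrated by parts
  but bounded directly.\<close>

definition kappa :: "(nat \<Rightarrow> complex) \<Rightarrow> (nat \<Rightarrow> complex) \<Rightarrow> (nat \<times> nat \<Rightarrow> real) \<Rightarrow> complex" where
  "kappa u v w = of_real s * (\<Sum>k<n. (\<Sum>j<p. x u j * of_real (w (k, j))) * R w v k)"

lemma R_std_basis: "k < n \<Longrightarrow> R w (std_basis k) a = Q w a k"
  by (simp add: R_def std_basis_def if_distrib[of "\<lambda>x. _ * x"] cong: if_cong)

lemma m_eq: "m w = (\<Sum>k<n. f (std_basis k) (std_basis k) w) / of_nat n"
  by (simp add: m_def f_def R_std_basis)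

lemma nrm_x_le: "s * (nrm p (x u))\<^sup>2 \<le> CP * (nrm n u)\<^sup>2"
proof -
  have "(nrm p (x u))\<^sup>2 = (\<Sum>j<p. (cmod (x u j))\<^sup>2)" by (rule nrm_power2)
  also have "\<dots> \<le> (\<Sum>j<p. (\<Sum>k<n. (G0 k j)\<^sup>2) * (nrm n u)\<^sup>2)"
  proof (intro sum_mono)
    fix j
    have "cmod (x u j) \<le> nrm n (\<lambda>k. of_real (G0 k j)) * nrm n u"
      using cmod_dot_le[of n "\<lambda>k. of_real (G0 k j)" u] by (simp add: x_def dot_def)
    then have "(cmod (x u j))\<^sup>2 \<le> (nrm n (\<lambda>k. of_real (G0 k j)) * nrm n u)\<^sup>2"
      by (intro power_mono) auto
    then show "(cmod (x u j))\<^sup>2 \<le> (\<Sum>k<n. (G0 k j)\<^sup>2) * (nrm n u)\<^sup>2"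
      by (simp add: power_mult_distrib nrm_power2[of n "\<lambda>k. of_real (G0 k j)"])
  qed
  finally have "s * (nrm p (x u))\<^sup>2 \<le> s * (\<Sum>j<p. (\<Sum>k<n. (G0 k j)\<^sup>2) * (nrm n u)\<^sup>2)"
    using s_pos by (intro mult_left_mono) auto
  also have "\<dots> = s * (\<Sum>j<p. \<Sum>k<n. (G0 k j)\<^sup>2) * (nrm n u)\<^sup>2"
    by (simp add: sum_distrib_right)
  also have "\<dots> \<le> CP * (nrm n u)\<^sup>2"
    by (intro mult_right_mono CP) auto
  finally show ?thesis .
qed

lemma dot_Lam: "dot n (Lam u) v = of_real s * dot p (x u) (x v)"
proof -
  have "dot n (Lam u) v = of_real s * (\<Sum>a<n. \<Sum>j<p. of_real (G0 a j) * x u j * v a)"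
    by (simp add: dot_def Lam_def sum_distrib_left sum_distrib_right mult_ac)
  also have "(\<Sum>a<n. \<Sum>j<p. of_real (G0 a j) * x u j * v a) = (\<Sum>j<p. \<Sum>a<n. of_real (G0 a j) * x u j * v a)"
    by (rule sum.swap)
  also have "\<dots> = dot p (x u) (x v)"
    by (simp add: dot_def x_def[of v] sum_distrib_left mult_ac)
  finally show ?thesis .
qed

text \<open>Pair \<open>Lam u\<close> with its own conjugate: by \<open>dot_Lam\<close> this is a
  product of two vectors controlled by \<open>nrm_x_le\<close>, one carrying the norm of u and the
  other that of \<open>Lam u\<close>, which then cancels.\<close>

lemma nrm_Lam_le: "nrm n (Lam u) \<le> CP * nrm n u"
proof -
  let ?l = "nrm n (Lam u)" and ?c = "\<lambda>a. cnj (Lam u a)"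
  have "?l\<^sup>2 = cmod (dot n (Lam u) ?c)"
    by (simp add: dot_cnj norm_power)
  also have "\<dots> \<le> s * (nrm p (x u) * nrm p (x ?c))"
    unfolding dot_Lam norm_mult using s_pos cmod_dot_le[of p "x u" "x ?c"] by simp
  finally have "(?l\<^sup>2)\<^sup>2 \<le> (s * (nrm p (x u) * nrm p (x ?c)))\<^sup>2"
    by (intro power_mono) auto
  also have "\<dots> = (s * (nrm p (x u))\<^sup>2) * (s * (nrm p (x ?c))\<^sup>2)"
    by (simp add: power2_eq_square mult_ac)
  also have "\<dots> \<le> (CP * (nrm n u)\<^sup>2) * (CP * (nrm n ?c)\<^sup>2)"
    using s_pos CP_nonneg by (intro mult_mono nrm_x_le) auto
  also have "\<dots> = (CP * nrm n u * ?l)\<^sup>2"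
    by (simp add: power2_eq_square mult_ac)
  finally have "?l\<^sup>2 \<le> CP * nrm n u * ?l"
    by (rule power2_le_imp_le) (use CP_nonneg in auto)
  then have "?l * ?l \<le> CP * nrm n u * ?l" by (simp add: power2_eq_square)
  then show ?thesis
    using CP_nonneg nrm_nonneg[of n "Lam u"]
    by (cases "?l = 0") (auto simp: mult_le_cancel_right)
qed

lemma cmod_m_le: "cmod (m w) \<le> 1 / \<eta>"
proof -
  have "cmod (\<Sum>k<n. f (std_basis k) (std_basis k) w) \<le> (\<Sum>k<n. 1 / \<eta>)"
  proof (rule order_trans[OF norm_sum sum_mono])
    fix k assume "k \<in> {..<n}"
    then show "cmod (f (std_basis k) (std_basis k) w) \<le> 1 / \<eta>"
      using cmod_f_le[of "std_basis k" "std_basis k" w] by simp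
  qed
  then show ?thesis
    using n_pos by (simp add: m_eq norm_divide field_simps)
qed

lemma continuous_m:
  assumes "a < n" "j < p"
  shows "continuous_on UNIV (\<lambda>t. m (w((a, j) := t)))"
  unfolding m_eq using assms n_pos by (auto intro!: continuous_intros continuous_f)

lemma continuous_Df:
  assumes "a < n" "j < p"
  shows "continuous_on UNIV (\<lambda>t. Df u v (w((a, j) := t)) (a, j))"
  unfolding Df_def using assms by (auto intro!: continuous_intros continuous_R continuous_Y)

lemma continuous_Phi:
  assumes "a < n" "j < p"
  shows "continuous_on UNIV (\<lambda>t. Phi u v (w((a, j) := t)))"
  unfolding Phi_def using assms by (auto intro!: continuous_intros continuous_f continuous_m)

lemma continuous_DPhi:
  assumes "a < n" "j < p"
  shows "continuous_on UNIV (\<lambda>t. DPhi u v (w((a, j) := t)) (a, j))"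
  unfolding DPhi_def Dm_def using assms n_pos
  by (auto intro!: continuous_intros continuous_f continuous_m continuous_Df)

lemma deriv_m:
  assumes "a < n" "j < p"
  shows "((\<lambda>t. m (w((a, j) := t))) has_vector_derivative Dm (w((a, j) := t)) (a, j)) (at t)"
  unfolding m_eq Dm_def divide_inverse
  by (intro has_vector_derivative_mult_left has_vector_derivative_sum deriv_f assms)

lemma deriv_Phi:
  assumes "a < n" "j < p"
  shows "((\<lambda>t. Phi u v (w((a, j) := t))) has_vector_derivative DPhi u v (w((a, j) := t)) (a, j)) (at t)"
proof -
  have "((\<lambda>t. (z + m (w((a, j) := t))) * f u v (w((a, j) := t)) + dot n u v - f (Lam u) v (w((a, j) := t)))
    has_vector_derivative (((z + m (w((a, j) := t))) * Df u v (w((a, j) := t)) (a, j) +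
      (0 + Dm (w((a, j) := t)) (a, j)) * f u v (w((a, j) := t))) + 0 - Df (Lam u) v (w((a, j) := t)) (a, j))) (at t)"
    by (intro has_vector_derivative_diff has_vector_derivative_add has_vector_derivative_mult
        has_vector_derivative_const deriv_m deriv_f assms)
  then show ?thesis by (simp add: Phi_def DPhi_def)
qed

lemma deriv_g:
  assumes "a < n" "j < p"
  shows "((\<lambda>t. g u v (w((a, j) := t))) has_vector_derivative Dg u v (w((a, j) := t)) (a, j)) (at t)"
proof -
  let ?P = "\<lambda>t. Phi u v (w((a, j) := t))" and ?D = "DPhi u v (w((a, j) := t)) (a, j)"
  note d = deriv_Phi[OF assms, of u v w t]
  have c: "((\<lambda>t. cnj (?P t)) has_vector_derivative cnj ?D) (at t)"
    using bounded_linear.has_vector_derivative[OF bounded_linear_cnj d] .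
  have "((\<lambda>t. (?P t * ?P t) * (cnj (?P t) * (cnj (?P t) * cnj (?P t)))) has_vector_derivative
    ((?P t * ?P t) * (cnj (?P t) * (cnj (?P t) * cnj ?D + cnj ?D * cnj (?P t)) + cnj ?D * (cnj (?P t) * cnj (?P t)))
     + (?P t * ?D + ?D * ?P t) * (cnj (?P t) * (cnj (?P t) * cnj (?P t))))) (at t)"
    by (intro has_vector_derivative_mult d c)
  then show ?thesis
    by (simp add: g_def Dg_def power2_eq_square power3_eq_cube algebra_simps)
qed

lemma deriv_Y:
  assumes "a < n" "j < p"
  shows "((\<lambda>t. Y (w((a, j) := t)) v j) has_vector_derivative DY v (w((a, j) := t)) (a, j)) (at t)"
proof -
  have G: "((\<lambda>t. G (w((a, j) := t)) k j) has_vector_derivative (if k = a then 1 else 0)) (at t)" for k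
  proof (cases "k = a")
    case True
    have "((\<lambda>t. complex_of_real (G0 k j) + complex_of_real t) has_vector_derivative 0 + 1) (at t)"
      by (intro has_vector_derivative_add has_vector_derivative_const)
         (auto simp: has_vector_derivative_def scaleR_conv_of_real[abs_def] intro!: derivative_eq_intros)
    then show ?thesis using True by (simp add: G_def)
  qed (simp add: G_def)
  have "((\<lambda>t. \<Sum>k<n. G (w((a, j) := t)) k j * f (std_basis k) v (w((a, j) := t))) has_vector_derivative
     (\<Sum>k<n. G (w((a, j) := t)) k j * Df (std_basis k) v (w((a, j) := t)) (a, j)
       + (if k = a then 1 else 0) * f (std_basis k) v (w((a, j) := t)))) (at t)"
    by (intro has_vector_derivative_sum has_vector_derivative_mult G deriv_f assms)
  moreover have "(\<Sum>k<n. G (w((a, j) := t)) k j * Df (std_basis k) v (w((a, j) := t)) (a, j)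
       + (if k = a then 1 else 0) * f (std_basis k) v (w((a, j) := t))) = DY v (w((a, j) := t)) (a, j)"
    using assms by (simp add: DY_def sum.distrib if_distrib[of "\<lambda>x. x * _"] R_eq_f cong: if_cong)
  moreover have "(\<lambda>t. Y (w((a, j) := t)) v j) = (\<lambda>t. \<Sum>k<n. G (w((a, j) := t)) k j * f (std_basis k) v (w((a, j) := t)))"
    by (simp add: Y_def GT_def R_eq_f)
  ultimately show ?thesis by simp
qed

section \<open>Boundedness, measurability and integrability of the ingredients\<close>

lemma bdd_R: "a < n \<Longrightarrow> bdd_fun (\<lambda>w. R w v a)"
  by (rule bdd_funI) (rule cmod_R_le)

lemma bdd_Y: "j < p \<Longrightarrow> bdd_fun (\<lambda>w. Y w v j)"
  by (rule bdd_funI) (rule cmod_Y_le)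

lemma bdd_f: "bdd_fun (f u v)"
  by (rule bdd_funI) (rule cmod_f_le)

lemma bdd_m: "bdd_fun m"
  by (rule bdd_funI) (rule cmod_m_le)

lemma bdd_Df: "i \<in> I \<Longrightarrow> bdd_fun (\<lambda>w. Df u v w i)"
  unfolding Df_def by (auto intro!: bdd_fun_intros bdd_R bdd_Y)

lemma bdd_Phi: "bdd_fun (Phi u v)"
  unfolding Phi_def[abs_def] by (intro bdd_fun_intros bdd_f bdd_m)

lemma bdd_DPhi: "i \<in> I \<Longrightarrow> bdd_fun (\<lambda>w. DPhi u v w i)"
  unfolding DPhi_def Dm_def by (intro bdd_fun_intros bdd_f bdd_m bdd_Df) auto

lemma bdd_g: "bdd_fun (g u v)"
  unfolding g_def[abs_def] by (intro bdd_fun_intros bdd_Phi)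

lemma bdd_Dg: "i \<in> I \<Longrightarrow> bdd_fun (\<lambda>w. Dg u v w i)"
  unfolding Dg_def by (intro bdd_fun_intros bdd_Phi bdd_DPhi)

lemma meas_component: "i \<in> I \<Longrightarrow> (\<lambda>w. w i) \<in> borel_measurable \<mu>"
  using measurable_component_singleton[of i I "\<lambda>_. gauss"]
  by (simp add: measurable_cong_sets[OF refl sets_gauss])

lemma meas_G: "a < n \<Longrightarrow> j < p \<Longrightarrow> (\<lambda>w. G w a j) \<in> borel_measurable \<mu>"
  unfolding G_def 
  using meas_component[of "(a, j)"] by (auto intro!: borel_measurable_add)

lemma meas_R: "a < n \<Longrightarrow> (\<lambda>w. R w v a) \<in> borel_measurable \<mu>"
  unfolding R_def by (intro borel_measurable_sum borel_measurable_times Q_meas) auto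

lemma meas_Y: "j < p \<Longrightarrow> (\<lambda>w. Y w v j) \<in> borel_measurable \<mu>"
  unfolding Y_def GT_def by (intro borel_measurable_sum borel_measurable_times meas_R meas_G) auto

lemma meas_f: "f u v \<in> borel_measurable \<mu>"
  unfolding f_def[abs_def] dot_def by (intro borel_measurable_sum borel_measurable_times meas_R) auto

lemma meas_m: "m \<in> borel_measurable \<mu>"
  unfolding m_def[abs_def] by (intro borel_measurable_divide borel_measurable_sum Q_meas) auto

lemma meas_Df: "i \<in> I \<Longrightarrow> (\<lambda>w. Df u v w i) \<in> borel_measurable \<mu>"
  unfolding Df_def by (auto intro!: borel_measurable_add borel_measurable_times meas_R meas_Y)

lemma meas_Phi [measurable]: "Phi u v \<in> borel_measurable \<mu>"
  unfolding Phi_def[abs_def] by (intro borel_measurable_add borel_measurable_diff borel_measurable_times meas_f meas_m) auto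

lemma meas_DPhi: "i \<in> I \<Longrightarrow> (\<lambda>w. DPhi u v w i) \<in> borel_measurable \<mu>"
  unfolding DPhi_def Dm_def
  by (intro borel_measurable_add borel_measurable_diff borel_measurable_times borel_measurable_divide
      borel_measurable_sum meas_f meas_m meas_Df) auto

lemma meas_g: "g u v \<in> borel_measurable \<mu>"
  unfolding g_def[abs_def] by (intro borel_measurable_times borel_measurable_power borel_measurable_cnj meas_Phi)

lemma meas_Dg: "i \<in> I \<Longrightarrow> (\<lambda>w. Dg u v w i) \<in> borel_measurable \<mu>"
  unfolding Dg_def
  by (intro borel_measurable_add borel_measurable_times borel_measurable_power borel_measurable_cnj meas_Phi meas_DPhi) auto

lemma meas_DY: "i \<in> I \<Longrightarrow> (\<lambda>w. DY v w i) \<in> borel_measurable \<mu>"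
  unfolding DY_def
  by (intro borel_measurable_add borel_measurable_sum borel_measurable_times meas_R meas_G meas_Df) auto

lemma integrable_bdd: "bdd_fun h \<Longrightarrow> h \<in> borel_measurable \<mu> \<Longrightarrow> integrable \<mu> h"
  by (elim bdd_funE, rule P.integrable_const_bound) auto

text \<open>Entries of G stand alone in \<open>DY\<close>, without a resolvent to balance them. This
  is why \<open>gauss_ibp\<close> allows derivatives of linear growth.\<close>

lemma DY_linear_growth:
  assumes i: "i \<in> I"
  obtains A B where "A \<ge> 0" "B \<ge> 0" "\<And>w. cmod (DY v w i) \<le> A + B * (\<Sum>k\<in>I. \<bar>w k\<bar>)"
proof -
  obtain a j where aj: "i = (a, j)" "a < n" "j < p" using i by auto
  have "\<exists>C. 0 \<le> C \<and> (\<forall>w. cmod (Df (std_basis k) v w i) \<le> C)" for k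
    using bdd_Df[OF i, of "std_basis k" v] by (rule bdd_funE) blast
  then have "\<exists>C. \<forall>k. 0 \<le> C k \<and> (\<forall>w. cmod (Df (std_basis k) v w i) \<le> C k)"
    by (intro choice allI)
  then obtain C where C: "\<And>k. 0 \<le> C k" "\<And>k w. cmod (Df (std_basis k) v w i) \<le> C k"
    by blast
  define B where "B = (\<Sum>k<n. C k)"
  have B: "B \<ge> 0" "\<And>k. k < n \<Longrightarrow> C k \<le> B"
    unfolding B_def using C by (auto intro!: sum_nonneg member_le_sum)
  define A where "A = nrm n v / \<eta> + (\<Sum>k<n. \<bar>G0 k j\<bar> * B)"
  have "A \<ge> 0" unfolding A_def using \<eta>_pos B by (auto intro!: add_nonneg_nonneg sum_nonneg)
  moreover have "cmod (DY v w i) \<le> A + B * (\<Sum>k\<in>I. \<bar>w k\<bar>)" for w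
  proof -
    have "cmod (DY v w i) \<le> cmod (R w v a) + (\<Sum>k<n. cmod (G w k j * Df (std_basis k) v w i))"
      unfolding DY_def using aj by (auto intro!: order_trans[OF norm_triangle_ineq] norm_sum)
    also have "\<dots> \<le> nrm n v / \<eta> + (\<Sum>k<n. (\<bar>G0 k j\<bar> + \<bar>w (k, j)\<bar>) * B)"
    proof (intro add_mono sum_mono cmod_R_le aj)
      fix k assume "k \<in> {..<n}"
      then have "cmod (Df (std_basis k) v w i) \<le> B"
        using C(2)[of k w] B(2)[of k] by force
      moreover have "cmod (G w k j) \<le> \<bar>G0 k j\<bar> + \<bar>w (k, j)\<bar>"
        unfolding G_def norm_of_real by (rule abs_triangle_ineq)
      ultimately show "cmod (G w k j * Df (std_basis k) v w i) \<le> (\<bar>G0 k j\<bar> + \<bar>w (k, j)\<bar>) * B"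
        unfolding norm_mult by (intro mult_mono) auto
    qed
    also have "\<dots> = A + B * (\<Sum>k<n. \<bar>w (k, j)\<bar>)"
      by (simp add: A_def sum.distrib distrib_left distrib_right sum_distrib_left mult.commute)
    also have "(\<Sum>k<n. \<bar>w (k, j)\<bar>) = (\<Sum>i\<in>(\<lambda>k. (k, j)) ` {..<n}. \<bar>w i\<bar>)"
      by (subst sum.reindex) (auto simp: inj_on_def)
    also have "\<dots> \<le> (\<Sum>k\<in>I. \<bar>w k\<bar>)"
      using aj by (intro sum_mono2) auto
    finally show ?thesis using B by (simp add: mult_left_mono)
  qed
  ultimately show ?thesis using that B by blast
qed

text \<open>The entry (a, j) is paired with coordinate j of \<open>Y\<close> in the same column, as
  in the product of W with G^T Q v.\<close>

lemma ibp_Yg: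
  assumes i: "i \<in> I"
  shows "(\<integral>w. w i *\<^sub>R (Y w v (snd i) * g u v w) \<partial>\<mu>) = (\<integral>w. DY v w i * g u v w + Y w v (snd i) * Dg u v w i \<partial>\<mu>)"
    and "integrable \<mu> (\<lambda>w. w i *\<^sub>R (Y w v (snd i) * g u v w))"
    and "integrable \<mu> (\<lambda>w. DY v w i * g u v w + Y w v (snd i) * Dg u v w i)"
proof -
  obtain a j where aj: "i = (a, j)" "a < n" "j < p" using i by auto
  obtain A B where AB: "A \<ge> 0" "B \<ge> 0" "\<And>w. cmod (DY v w i) \<le> A + B * (\<Sum>k\<in>I. \<bar>w k\<bar>)"
    by (rule DY_linear_growth[OF i, of v]) blast
  obtain C1 where C1: "C1 \<ge> 0" "\<And>w. cmod (g u v w) \<le> C1" using bdd_g by (rule bdd_funE) blast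
  have "bdd_fun (\<lambda>w. Y w v j * Dg u v w i)" using aj i by (intro bdd_fun_intros bdd_Y bdd_Dg)
  then obtain C2 where C2: "C2 \<ge> 0" "\<And>w. cmod (Y w v j * Dg u v w i) \<le> C2" by (rule bdd_funE) blast
  have "bdd_fun (\<lambda>w. Y w v j * g u v w)" using aj by (intro bdd_fun_intros bdd_Y bdd_g)
  then obtain C3 where C3: "\<And>w. cmod (Y w v j * g u v w) \<le> C3" by (rule bdd_funE) blast
  have b: "cmod (DY v w i * g u v w + Y w v j * Dg u v w i) \<le> (A * C1 + C2) + B * C1 * (\<Sum>k\<in>I. \<bar>w k\<bar>)" for w
  proof -
    have "cmod (DY v w i * g u v w + Y w v j * Dg u v w i) \<le> cmod (DY v w i) * cmod (g u v w) + cmod (Y w v j * Dg u v w i)"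
      using norm_triangle_ineq norm_mult by metis
    also have "\<dots> \<le> (A + B * (\<Sum>k\<in>I. \<bar>w k\<bar>)) * C1 + C2"
      using AB C1 C2 by (intro add_mono mult_mono) (auto intro!: add_nonneg_nonneg mult_nonneg_nonneg sum_nonneg)
    finally show ?thesis by (simp add: algebra_simps)
  qed
  have d: "((\<lambda>t. Y (w(i := t)) v j * g u v (w(i := t))) has_vector_derivative
      DY v (w(i := t)) i * g u v (w(i := t)) + Y (w(i := t)) v j * Dg u v (w(i := t)) i) (at t)" for w t
    using has_vector_derivative_mult[OF deriv_Y[OF aj(2,3)] deriv_g[OF aj(2,3)]] aj(1) by (simp add: add.commute)
  have c: "continuous_on UNIV (\<lambda>t. DY v (w(i := t)) i * g u v (w(i := t)) + Y (w(i := t)) v j * Dg u v (w(i := t)) i)" for w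
    unfolding DY_def Dg_def g_def aj(1) fst_conv snd_conv using aj(2,3)
    by (intro continuous_intros continuous_R continuous_G continuous_Df continuous_Phi continuous_DPhi continuous_Y)
  have m1: "(\<lambda>w. Y w v j * g u v w) \<in> borel_measurable \<mu>"
    using aj by (intro borel_measurable_times meas_Y meas_g)
  have m2: "(\<lambda>w. DY v w i * g u v w + Y w v j * Dg u v w i) \<in> borel_measurable \<mu>"
    using aj i by (intro borel_measurable_add borel_measurable_times meas_Y meas_g meas_DY meas_Dg)
  have fin: "finite I" by simp
  note ibp = gauss_ibp[OF fin i m1 m2 d c C3 b]
  show "(\<integral>w. w i *\<^sub>R (Y w v (snd i) * g u v w) \<partial>\<mu>) = (\<integral>w. DY v w i * g u v w + Y w v (snd i) * Dg u v w i \<partial>\<mu>)"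
    "integrable \<mu> (\<lambda>w. w i *\<^sub>R (Y w v (snd i) * g u v w))"
    "integrable \<mu> (\<lambda>w. DY v w i * g u v w + Y w v (snd i) * Dg u v w i)"
    using ibp unfolding aj(1) snd_conv by blast+
qed

end

section \<open>The approximate resolvent equation and its error terms\<close>

context gram_resolvent_gauss
begin

text \<open>Substitute W = G - G0. The G part is evaluated by the resolvent equation. In the G0
  part, splitting G^T into G0^T + W^T yields the spike term and \<open>kappa\<close>.\<close>

lemma noise_identity:
  "of_real s * (\<Sum>a<n. \<Sum>j<p. u a * (of_real (w (a, j)) * Y w v j)) =
     Phi u v w - m w * f u v w + of_real s * of_nat p * f u v w - kappa u v w"
proof -
  have GY: "of_real s * (\<Sum>j<p. G w a j * Y w v j) = v a + (of_real s * of_nat p + z) * R w v a" if "a < n" for a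
    using R_eq[OF that, of w v] by (simp add: algebra_simps)
  have "of_real s * (\<Sum>a<n. \<Sum>j<p. u a * (G w a j * Y w v j)) = (\<Sum>a<n. u a * (of_real s * (\<Sum>j<p. G w a j * Y w v j)))"
    by (simp add: sum_distrib_left mult_ac)
  also have "\<dots> = (\<Sum>a<n. u a * (v a + (of_real s * of_nat p + z) * R w v a))"
    by (intro sum.cong refl) (simp add: GY)
  also have "\<dots> = dot n u v + (of_real s * of_nat p + z) * f u v w"
    by (simp add: dot_def f_def sum.distrib sum_distrib_left algebra_simps)
  finally have 1: "of_real s * (\<Sum>a<n. \<Sum>j<p. u a * (G w a j * Y w v j)) = dot n u v + (of_real s * of_nat p + z) * f u v w" .
  have "(\<Sum>a<n. \<Sum>j<p. u a * (of_real (G0 a j) * Y w v j)) = (\<Sum>j<p. \<Sum>a<n. u a * (of_real (G0 a j) * Y w v j))"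
    by (rule sum.swap)
  also have "\<dots> = (\<Sum>j<p. x u j * Y w v j)"
    by (simp add: x_def sum_distrib_left mult_ac)
  also have "\<dots> = (\<Sum>j<p. x u j * (x (R w v) j + (\<Sum>k<n. of_real (w (k, j)) * R w v k)))"
    by (simp add: Y_def GT_def G_def x_def[of "R w v"] sum.distrib distrib_right)
  also have "\<dots> = dot p (x u) (x (R w v)) + (\<Sum>j<p. \<Sum>k<n. x u j * (of_real (w (k, j)) * R w v k))"
    by (simp add: dot_def distrib_left sum.distrib sum_distrib_left)
  also have "(\<Sum>j<p. \<Sum>k<n. x u j * (of_real (w (k, j)) * R w v k)) = (\<Sum>k<n. \<Sum>j<p. x u j * (of_real (w (k, j)) * R w v k))"
    by (rule sum.swap)
  also have "\<dots> = (\<Sum>k<n. (\<Sum>j<p. x u j * of_real (w (k, j))) * R w v k)"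
    by (simp add: sum_distrib_right mult.assoc)
  finally have 2: "of_real s * (\<Sum>a<n. \<Sum>j<p. u a * (of_real (G0 a j) * Y w v j)) = f (Lam u) v w + kappa u v w"
    by (simp add: kappa_def f_def dot_Lam distrib_left)
  have "of_real s * (\<Sum>a<n. \<Sum>j<p. u a * (of_real (w (a, j)) * Y w v j)) =
    of_real s * (\<Sum>a<n. \<Sum>j<p. u a * (G w a j * Y w v j)) - of_real s * (\<Sum>a<n. \<Sum>j<p. u a * (of_real (G0 a j) * Y w v j))"
    by (simp add: G_def algebra_simps sum.distrib)
  then show ?thesis
    unfolding 1 2 by (simp add: Phi_def algebra_simps)
qed

lemma Y_std_basis_sum: "(\<Sum>a<n. u a * Y w (std_basis a) j) = Y w u j"
proof -
  have "(\<Sum>a<n. u a * Y w (std_basis a) j) = (\<Sum>a<n. \<Sum>k<n. u a * (G w k j * Q w k a))"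
    by (simp add: Y_def GT_def R_std_basis sum_distrib_left)
  also have "\<dots> = (\<Sum>k<n. \<Sum>a<n. u a * (G w k j * Q w k a))" by (rule sum.swap)
  also have "\<dots> = Y w u j"
    by (simp add: Y_def GT_def R_def sum_distrib_left mult_ac)
  finally show ?thesis .
qed

text \<open>Differentiating G^T explicitly gives p Q. Differentiating Q gives one term of rank-one
  type and one with the trace of G^T Q G, which the resolvent equation expresses through
  \<open>m\<close>.\<close>

lemma divergence_identity:
  "(\<Sum>a<n. \<Sum>j<p. u a * DY v w (a, j)) = of_nat p * f u v w - of_real s * dot p (Y w u) (Y w v)
     - (of_nat n + (of_real s * of_nat p + z) * of_nat n * m w) * f u v w"
proof -
  \<comment> \<open>The diagonal entries of G^T Q G; their sum is the trace of G G^T Q.\<close>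
  define th where "th j = (\<Sum>k<n. G w k j * Y w (std_basis k) j)" for j
  have sym: "(\<Sum>k<n. G w k j * R w (std_basis k) a) = Y w (std_basis a) j" if a: "a < n" for a j
  proof -
    have "R w (std_basis k) a = R w (std_basis a) k" if "k < n" for k
      using R_sym[of "std_basis a" w "std_basis k"] a that by simp
    then show ?thesis by (simp add: Y_def GT_def)
  qed
  have DY: "DY v w (a, j) = R w v a - of_real s * (Y w (std_basis a) j * Y w v j) - of_real s * (th j * R w v a)"
    if a: "a < n" for a j
  proof -
    have "DY v w (a, j) = R w v a - of_real s * ((\<Sum>k<n. G w k j * R w (std_basis k) a) * Y w v j)
        - of_real s * (th j * R w v a)"
      by (simp add: DY_def Df_def th_def sum_distrib_left sum_distrib_right sum.distrib sum_negf sum_subtractf algebra_simps)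
    then show ?thesis by (simp add: sym[OF a])
  qed
  have "of_real s * (\<Sum>j<p. th j) = (\<Sum>k<n. of_real s * (\<Sum>j<p. G w k j * Y w (std_basis k) j))"
    unfolding th_def by (subst sum.swap) (simp add: sum_distrib_left)
  also have "\<dots> = (\<Sum>k<n. 1 + (of_real s * of_nat p + z) * Q w k k)"
  proof (intro sum.cong refl)
    fix k assume "k \<in> {..<n}"
    then show "of_real s * (\<Sum>j<p. G w k j * Y w (std_basis k) j) = 1 + (of_real s * of_nat p + z) * Q w k k"
      using R_eq[of k w "std_basis k"] by (simp add: R_std_basis std_basis_def algebra_simps)
  qed
  also have "\<dots> = of_nat n + (of_real s * of_nat p + z) * of_nat n * m w"
    using n_pos by (simp add: sum.distrib m_def flip: sum_distrib_left)
  finally have th: "of_real s * (\<Sum>j<p. th j) = \<dots>" .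
  have "(\<Sum>a<n. \<Sum>j<p. u a * DY v w (a, j)) =
    (\<Sum>a<n. \<Sum>j<p. u a * R w v a - of_real s * (u a * Y w (std_basis a) j * Y w v j) - (u a * R w v a) * (of_real s * th j))"
    by (intro sum.cong refl) (simp add: DY algebra_simps)
  also have "\<dots> = of_nat p * (\<Sum>a<n. u a * R w v a) - of_real s * (\<Sum>a<n. \<Sum>j<p. u a * Y w (std_basis a) j * Y w v j)
      - (\<Sum>a<n. \<Sum>j<p. (u a * R w v a) * (of_real s * th j))"
    by (simp add: sum_subtractf sum_distrib_left)
  also have "(\<Sum>a<n. \<Sum>j<p. (u a * R w v a) * (of_real s * th j)) = (of_real s * (\<Sum>j<p. th j)) * f u v w"
    by (simp add: f_def dot_def sum_product sum_distrib_left mult_ac flip: sum_distrib_right)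
  also have "(\<Sum>a<n. \<Sum>j<p. u a * Y w (std_basis a) j * Y w v j) = (\<Sum>j<p. \<Sum>a<n. u a * Y w (std_basis a) j * Y w v j)"
    by (rule sum.swap)
  also have "\<dots> = dot p (Y w u) (Y w v)"
    by (simp add: dot_def flip: sum_distrib_right Y_std_basis_sum[of u w])
  finally show ?thesis unfolding th by (simp add: f_def dot_def)
qed

text \<open>What remains of s times the divergence after the leading terms cancel. Its first part is
  of order 1 / n, because s^2 p = 1 / n and \<open>Y\<close> has norm of order sqrt p; its second
  part is of order s n = sqrt (n / p).\<close>

definition E1 :: "(nat \<Rightarrow> complex) \<Rightarrow> (nat \<Rightarrow> complex) \<Rightarrow> (nat \<times> nat \<Rightarrow> real) \<Rightarrow> complex" where
  "E1 u v w = - (of_real s)\<^sup>2 * dot p (Y w u) (Y w v) - of_real s * of_nat n * (1 + z * m w) * f u v w"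

text \<open>Collects the terms in which the derivative falls on the test function
  \<open>g\<close>.\<close>

definition E2 :: "(nat \<Rightarrow> complex) \<Rightarrow> (nat \<Rightarrow> complex) \<Rightarrow> (nat \<times> nat \<Rightarrow> real) \<Rightarrow> complex" where
  "E2 u v w = of_real s * (\<Sum>a<n. \<Sum>j<p. u a * (Y w v j * Dg u v w (a, j)))"

text \<open>The product \<open>Phi * g\<close> is split into \<open>h\<close>, where a noise entry
  stands outside and Stein's identity applies, and a remainder \<open>r\<close> that is left as it
  is. Replacing \<open>h\<close> by its divergence \<open>h'\<close> makes the large terms of
  \<open>r\<close> disappear.\<close>

lemma ibp_Phi:
  shows "integrable \<mu> (\<lambda>w. (E1 u v w + kappa u v w) * g u v w + E2 u v w)"
    and "(\<integral>w. Phi u v w * g u v w \<partial>\<mu>) = (\<integral>w. (E1 u v w + kappa u v w) * g u v w + E2 u v w \<partial>\<mu>)"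
proof -
  define h where "h w = of_real s * (\<Sum>a<n. \<Sum>j<p. u a * (w (a, j) *\<^sub>R (Y w v j * g u v w)))" for w
  define h' where "h' w = of_real s * (\<Sum>a<n. \<Sum>j<p. u a * (DY v w (a, j) * g u v w + Y w v j * Dg u v w (a, j)))" for w
  define r where "r w = (m w * f u v w - of_real s * of_nat p * f u v w + kappa u v w) * g u v w" for w
  have I: "integrable \<mu> (\<lambda>w. w (a, j) *\<^sub>R (Y w v j * g u v w))"
    "integrable \<mu> (\<lambda>w. DY v w (a, j) * g u v w + Y w v j * Dg u v w (a, j))"
    "(\<integral>w. w (a, j) *\<^sub>R (Y w v j * g u v w) \<partial>\<mu>) = (\<integral>w. DY v w (a, j) * g u v w + Y w v j * Dg u v w (a, j) \<partial>\<mu>)"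
    if "a < n" "j < p" for a j
    using ibp_Yg[of "(a, j)" v u] that by auto
  have Ih: "integrable \<mu> h"
    unfolding h_def by (intro integrable_mult_right Bochner_Integration.integrable_sum I) auto
  have Ih': "integrable \<mu> h'"
    unfolding h'_def by (intro integrable_mult_right Bochner_Integration.integrable_sum I) auto
  have lin: "(\<integral>w. of_real s * (\<Sum>a<n. \<Sum>j<p. u a * F a j w) \<partial>\<mu>) = of_real s * (\<Sum>a<n. \<Sum>j<p. u a * (\<integral>w. F a j w \<partial>\<mu>))"
    if "\<And>a j. a < n \<Longrightarrow> j < p \<Longrightarrow> integrable \<mu> (F a j)" for F :: "nat \<Rightarrow> nat \<Rightarrow> (nat \<times> nat \<Rightarrow> real) \<Rightarrow> complex"
  proof -
    have "(\<integral>w. (\<Sum>a<n. \<Sum>j<p. u a * F a j w) \<partial>\<mu>) = (\<Sum>a<n. \<integral>w. (\<Sum>j<p. u a * F a j w) \<partial>\<mu>)"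
      by (intro Bochner_Integration.integral_sum Bochner_Integration.integrable_sum integrable_mult_right that) auto
    also have "\<dots> = (\<Sum>a<n. \<Sum>j<p. \<integral>w. u a * F a j w \<partial>\<mu>)"
      by (intro sum.cong refl Bochner_Integration.integral_sum integrable_mult_right that) auto
    finally show ?thesis by simp
  qed
  have hh': "(\<integral>w. h w \<partial>\<mu>) = (\<integral>w. h' w \<partial>\<mu>)"
  proof -
    have "(\<integral>w. h w \<partial>\<mu>) = of_real s * (\<Sum>a<n. \<Sum>j<p. u a * (\<integral>w. w (a, j) *\<^sub>R (Y w v j * g u v w) \<partial>\<mu>))"
      unfolding h_def by (rule lin) (rule I(1))
    also have "\<dots> = of_real s * (\<Sum>a<n. \<Sum>j<p. u a * (\<integral>w. DY v w (a, j) * g u v w + Y w v j * Dg u v w (a, j) \<partial>\<mu>))"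
      by (simp add: I(3))
    also have "\<dots> = (\<integral>w. h' w \<partial>\<mu>)"
      unfolding h'_def by (rule lin[symmetric]) (rule I(2))
    finally show ?thesis .
  qed
  have IPg: "integrable \<mu> (\<lambda>w. Phi u v w * g u v w)"
    by (intro integrable_bdd bdd_fun_intros bdd_Phi bdd_g borel_measurable_times meas_Phi meas_g)
  have 1: "Phi u v w * g u v w = h w + r w" for w
  proof -
    have "h w = (of_real s * (\<Sum>a<n. \<Sum>j<p. u a * (of_real (w (a, j)) * Y w v j))) * g u v w"
      by (simp add: h_def sum_distrib_right sum_distrib_left scaleR_conv_of_real mult_ac)
    also have "\<dots> = (Phi u v w - m w * f u v w + of_real s * of_nat p * f u v w - kappa u v w) * g u v w"
      by (simp only: noise_identity)
    finally show ?thesis by (simp add: r_def algebra_simps)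
  qed
  have Ir: "integrable \<mu> r"
    using Bochner_Integration.integrable_diff[OF IPg Ih] by (simp add: 1)
  have 2: "h' w + r w = (E1 u v w + kappa u v w) * g u v w + E2 u v w" for w
  proof -
    \<comment> \<open>The normalisation of s: it makes the term \<open>m * f\<close> from the trace
      in the divergence cancel exactly against the one in \<open>r\<close>, as s p f cancels through
      the centring.\<close>
    have c: "(of_real s)\<^sup>2 * of_nat n * of_nat p = (1 :: complex)"
      using arg_cong[OF s2_eq, of complex_of_real] by simp
    have "h' w = of_real s * (\<Sum>a<n. \<Sum>j<p. u a * DY v w (a, j)) * g u v w + E2 u v w"
      by (simp add: h'_def E2_def sum_distrib_right sum_distrib_left sum.distrib algebra_simps)
    then have "h' w + r w = (of_real s * (of_nat p * f u v w - of_real s * dot p (Y w u) (Y w v)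
     - (of_nat n + (of_real s * of_nat p + z) * of_nat n * m w) * f u v w)
       + (m w * f u v w - of_real s * of_nat p * f u v w + kappa u v w)) * g u v w + E2 u v w"
      unfolding divergence_identity r_def by (simp add: algebra_simps)
    also have "of_real s * (of_nat p * f u v w - of_real s * dot p (Y w u) (Y w v)
     - (of_nat n + (of_real s * of_nat p + z) * of_nat n * m w) * f u v w)
       + (m w * f u v w - of_real s * of_nat p * f u v w + kappa u v w) =
      E1 u v w + kappa u v w + (1 - (of_real s)\<^sup>2 * of_nat n * of_nat p) * (m w * f u v w)"
      by (simp add: E1_def algebra_simps power2_eq_square)
    finally show ?thesis by (simp add: c)
  qed
  show "integrable \<mu> (\<lambda>w. (E1 u v w + kappa u v w) * g u v w + E2 u v w)"
    using Bochner_Integration.integrable_add[OF Ih' Ir] by (simp add: 2)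
  show "(\<integral>w. Phi u v w * g u v w \<partial>\<mu>) = (\<integral>w. (E1 u v w + kappa u v w) * g u v w + E2 u v w \<partial>\<mu>)"
    using Ih Ih' Ir by (simp add: 1 hh' flip: 2)
qed

lemma cmod_E1_le:
  "cmod (E1 u v w) \<le> (K / real n + s * real n * ((1 + cmod z / \<eta>) / \<eta>)) * (nrm n u * nrm n v)"
proof -
  have "cmod (dot p (Y w u) (Y w v)) \<le> nrm p (Y w u) * nrm p (Y w v)" by (rule cmod_dot_le)
  also have "\<dots> \<le> (sqrt (K * real p) * nrm n u) * (sqrt (K * real p) * nrm n v)"
    using K_pos by (intro mult_mono nrm_Y_le) auto
  also have "\<dots> = K * real p * (nrm n u * nrm n v)"
    using K_pos by simp
  finally have "s\<^sup>2 * cmod (dot p (Y w u) (Y w v)) \<le> s\<^sup>2 * (K * real p * (nrm n u * nrm n v))"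
    by (intro mult_left_mono) auto
  also have "\<dots> = (s\<^sup>2 * real n * real p) * (K / real n * (nrm n u * nrm n v))"
    using n_pos by simp
  finally have 1: "s\<^sup>2 * cmod (dot p (Y w u) (Y w v)) \<le> K / real n * (nrm n u * nrm n v)"
    unfolding s2_eq by simp
  have "cmod (1 + z * m w) \<le> 1 + cmod z / \<eta>"
    using norm_triangle_ineq[of 1 "z * m w"] mult_left_mono[OF cmod_m_le[of w] norm_ge_zero[of z]]
    by (simp add: norm_mult)
  then have 2: "cmod (1 + z * m w) * cmod (f u v w) \<le> (1 + cmod z / \<eta>) * (nrm n u * nrm n v / \<eta>)"
    using \<eta>_pos by (intro mult_mono cmod_f_le) auto
  have "cmod (E1 u v w) \<le> s\<^sup>2 * cmod (dot p (Y w u) (Y w v)) + s * real n * (cmod (1 + z * m w) * cmod (f u v w))"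
    unfolding E1_def using s_pos
    by (intro order_trans[OF norm_triangle_ineq4]) (simp add: norm_mult norm_power mult.assoc)
  also have "\<dots> \<le> K / real n * (nrm n u * nrm n v) + s * real n * ((1 + cmod z / \<eta>) * (nrm n u * nrm n v / \<eta>))"
    using 1 2 s_pos by (intro add_mono mult_left_mono) auto
  finally show ?thesis by (simp add: algebra_simps)
qed

text \<open>In the factor, |z| + 1 / \<eta> comes from \<open>z + m\<close>, a second 1 / \<eta>
  from differentiating \<open>m\<close>, and \<open>CP\<close> from the spike. The n gradients
  averaged in \<open>Dm\<close> each have the size allowed by \<open>L2_set_Df_le\<close>, so their
  average does too.\<close>

lemma L2_set_DPhi_le:
  "L2_set (\<lambda>i. cmod (DPhi u v w i)) I \<le>
    2 * sqrt K / (\<eta> * sqrt (real n)) * ((cmod z + 2 / \<eta> + CP) * (nrm n u * nrm n v))"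
proof -
  define D where "D = 2 * sqrt K / (\<eta> * sqrt (real n))"
  have D: "D \<ge> 0" unfolding D_def using K_pos \<eta>_pos by auto
  let ?L = "\<lambda>h. L2_set (\<lambda>i. cmod (h i)) I" and ?uv = "nrm n u * nrm n v"
  have zm: "cmod (z + m w) \<le> cmod z + 1 / \<eta>"
    using norm_triangle_ineq[of z "m w"] cmod_m_le[of w] by linarith
  have 1: "?L (\<lambda>i. (z + m w) * Df u v w i) \<le> (cmod z + 1 / \<eta>) * (D * ?uv)"
    unfolding L2_set_cmod_mult D_def using zm L2_set_Df_le[of u v w] \<eta>_pos
    by (intro mult_mono) auto
  have "?L (\<lambda>i. \<Sum>k<n. Df (std_basis k) (std_basis k) w i) \<le> (\<Sum>k<n. ?L (Df (std_basis k) (std_basis k) w))"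
    by (rule L2_set_cmod_sum_le) auto
  also have "\<dots> \<le> (\<Sum>k<n. D)"
  proof (intro sum_mono)
    fix k assume "k \<in> {..<n}"
    then show "?L (Df (std_basis k) (std_basis k) w) \<le> D"
      using L2_set_Df_le[of "std_basis k" "std_basis k" w] by (simp add: D_def)
  qed
  finally have "?L (\<lambda>i. \<Sum>k<n. Df (std_basis k) (std_basis k) w i) \<le> real n * D" by simp
  moreover have "?L (\<lambda>i. Dm w i * f u v w) =
      cmod (f u v w / of_nat n) * ?L (\<lambda>i. \<Sum>k<n. Df (std_basis k) (std_basis k) w i)"
    unfolding L2_set_cmod_mult[symmetric] Dm_def by (simp add: mult.commute)
  ultimately have "?L (\<lambda>i. Dm w i * f u v w) \<le> cmod (f u v w / of_nat n) * (real n * D)"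
    by (simp add: mult_left_mono)
  also have "\<dots> = cmod (f u v w) * D" using n_pos by (simp add: norm_divide)
  also have "\<dots> \<le> (?uv / \<eta>) * D" using D by (intro mult_right_mono cmod_f_le)
  finally have 2: "?L (\<lambda>i. Dm w i * f u v w) \<le> (?uv / \<eta>) * D" .
  have "?L (\<lambda>i. - Df (Lam u) v w i) \<le> D * (nrm n (Lam u) * nrm n v)"
    using L2_set_Df_le[of "Lam u" v w] by (simp add: D_def)
  also have "\<dots> \<le> D * (CP * nrm n u * nrm n v)"
    using D by (intro mult_left_mono mult_right_mono nrm_Lam_le) auto
  finally have 3: "?L (\<lambda>i. - Df (Lam u) v w i) \<le> D * (CP * nrm n u * nrm n v)" .
  have "?L (DPhi u v w) \<le> ?L (\<lambda>i. (z + m w) * Df u v w i) + ?L (\<lambda>i. Dm w i * f u v w) + ?L (\<lambda>i. - Df (Lam u) v w i)"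
    using L2_set_cmod_add_le[of "\<lambda>i. (z + m w) * Df u v w i + Dm w i * f u v w" "\<lambda>i. - Df (Lam u) v w i" I]
      L2_set_cmod_add_le[of "\<lambda>i. (z + m w) * Df u v w i" "\<lambda>i. Dm w i * f u v w" I]
    unfolding DPhi_def by simp
  also have "\<dots> \<le> (cmod z + 1 / \<eta>) * (D * ?uv) + (?uv / \<eta>) * D + D * (CP * nrm n u * nrm n v)"
    using 1 2 3 by linarith
  finally show ?thesis unfolding D_def[symmetric] by (simp add: algebra_simps)
qed

lemma cmod_Dg_le: "cmod (Dg u v w i) \<le> 5 * cmod (Phi u v w) ^ 4 * cmod (DPhi u v w i)"
proof -
  have "cmod (Dg u v w i) \<le> cmod (2 * Phi u v w * DPhi u v w i * cnj (Phi u v w) ^ 3)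
    + cmod (3 * Phi u v w ^ 2 * cnj (Phi u v w) ^ 2 * cnj (DPhi u v w i))"
    unfolding Dg_def by (rule norm_triangle_ineq)
  also have "\<dots> = 5 * cmod (Phi u v w) ^ 4 * cmod (DPhi u v w i)"
    by (simp add: norm_mult norm_power power_numeral_reduce)
  finally show ?thesis .
qed

text \<open>Cauchy-Schwarz over all entries at once: the outer product of u and \<open>Y\<close> has
  norm of order sqrt p, the gradient of \<open>Phi\<close> of order 1 / sqrt n, and s sqrt p / sqrt
  n = 1 / n. Summing absolute values entry by entry would lose this gain.\<close>

lemma cmod_E2_le:
  "cmod (E2 u v w) \<le>
    10 * K / \<eta> * (cmod z + 2 / \<eta> + CP) / real n * (nrm n u * nrm n v)\<^sup>2 * cmod (Phi u v w) ^ 4"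
proof -
  let ?uv = "nrm n u * nrm n v" and ?P = "cmod (Phi u v w) ^ 4"
  let ?L = "\<lambda>h. L2_set (\<lambda>i. cmod (h i)) I"
  define q where "q = cmod z + 2 / \<eta> + CP"
  have "(\<Sum>a<n. \<Sum>j<p. u a * (Y w v j * Dg u v w (a, j))) = (\<Sum>i\<in>I. (u (fst i) * Y w v (snd i)) * Dg u v w i)"
    by (simp add: sum.cartesian_product case_prod_beta mult.assoc)
  then have "cmod (E2 u v w) = s * cmod (\<Sum>i\<in>I. (u (fst i) * Y w v (snd i)) * Dg u v w i)"
    unfolding E2_def using s_pos by (simp add: norm_mult)
  also have "\<dots> \<le> s * (?L (\<lambda>i. u (fst i) * Y w v (snd i)) * ?L (Dg u v w))"
    using s_pos by (intro mult_left_mono cmod_sum_mult_le_L2_set) auto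
  also have "?L (\<lambda>i. u (fst i) * Y w v (snd i)) = nrm n u * nrm p (Y w v)"
    using L2_set_prod[of u "Y w v" n p] by (simp add: case_prod_beta')
  also have "s * (nrm n u * nrm p (Y w v) * ?L (Dg u v w)) \<le>
     s * (nrm n u * (sqrt (K * real p) * nrm n v) *
       (5 * ?P * (2 * sqrt K / (\<eta> * sqrt (real n)) * (q * ?uv))))"
  proof (intro mult_left_mono mult_mono nrm_Y_le)
    have "?L (Dg u v w) \<le> L2_set (\<lambda>i. 5 * ?P * cmod (DPhi u v w i)) I"
      by (intro L2_set_mono cmod_Dg_le) auto
    also have "\<dots> = 5 * ?P * ?L (DPhi u v w)"
      by (simp add: L2_set_right_distrib)
    also have "\<dots> \<le> 5 * ?P * (2 * sqrt K / (\<eta> * sqrt (real n)) * (q * ?uv))"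
      unfolding q_def by (intro mult_left_mono L2_set_DPhi_le) auto
    finally show "?L (Dg u v w) \<le> 5 * ?P * (2 * sqrt K / (\<eta> * sqrt (real n)) * (q * ?uv))" .
  qed (use s_pos K_pos in auto)
  also have "s * (nrm n u * (sqrt (K * real p) * nrm n v) *
       (5 * ?P * (2 * sqrt K / (\<eta> * sqrt (real n)) * (q * ?uv)))) = (s * sqrt (real p)) * (1 / sqrt (real n)) * (sqrt K)\<^sup>2 * (10 / \<eta> * q * ?uv\<^sup>2 * ?P)"
    by (simp add: real_sqrt_mult power2_eq_square field_simps)
  also have "\<dots> = 10 * K / \<eta> * q / real n * ?uv\<^sup>2 * ?P"
    unfolding s_p using K_pos n_pos by (simp add: field_simps)
  finally show ?thesis unfolding q_def .
qed

text \<open>Real and imaginary parts are separated to obtain real Gaussian linear forms; the 4 = 2^2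
  is the cost of this in a third power, by \<open>power_sum_le\<close>.\<close>

definition kap6 :: "(nat \<Rightarrow> complex) \<Rightarrow> (nat \<times> nat \<Rightarrow> real) \<Rightarrow> real" where
  "kap6 u w = (\<Sum>k<n. 4 * ((\<Sum>j<p. Re (x u j) * w (k, j)) ^ 6 + (\<Sum>j<p. Im (x u j) * w (k, j)) ^ 6))"

text \<open>Q depends on the noise, so \<open>kappa\<close> is not Gaussian. Cauchy-Schwarz replaces
  Q v by its sure bound and leaves the norm of W G0^T u, whose n coordinates \<open>L k\<close> are
  linear forms in the noise. The factor n^2 is Jensen's for the third power of their squared
  norm.\<close>

lemma kappa_le: "cmod (kappa u v w) ^ 6 \<le> (s * nrm n v / \<eta>) ^ 6 * (real n)\<^sup>2 * kap6 u w"
proof -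
  define L where "L k = (\<Sum>j<p. x u j * of_real (w (k, j)))" for k
  have "cmod (kappa u v w) \<le> s * (nrm n L * nrm n (R w v))"
    using s_pos cmod_dot_le[of n L "R w v"] by (simp add: kappa_def L_def dot_def norm_mult)
  also have "\<dots> \<le> s * (nrm n L * (nrm n v / \<eta>))"
    using s_pos by (intro mult_left_mono nrm_R_le) auto
  finally have "cmod (kappa u v w) ^ 6 \<le> (s * (nrm n L * (nrm n v / \<eta>))) ^ 6"
    by (intro power_mono) auto
  also have "\<dots> = (s * nrm n v / \<eta>) ^ 6 * ((nrm n L)\<^sup>2) ^ 3"
    by (simp add: power_mult_distrib power_divide flip: power_mult)
  also have "((nrm n L)\<^sup>2) ^ 3 \<le> (real n)\<^sup>2 * (\<Sum>k<n. ((cmod (L k))\<^sup>2) ^ 3)"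
    unfolding nrm_power2 using power_sum_le[of "{..<n}" "\<lambda>k. (cmod (L k))\<^sup>2" 3] n_pos by auto
  also have "(\<Sum>k<n. ((cmod (L k))\<^sup>2) ^ 3) \<le> kap6 u w"
    unfolding kap6_def
  proof (intro sum_mono)
    fix k
    have e: "Re (L k) = (\<Sum>j<p. Re (x u j) * w (k, j))" "Im (L k) = (\<Sum>j<p. Im (x u j) * w (k, j))"
      by (auto simp: L_def)
    have "((cmod (L k))\<^sup>2) ^ 3 = ((Re (L k))\<^sup>2 + (Im (L k))\<^sup>2) ^ 3"
      by (simp add: cmod_power2)
    also have "\<dots> \<le> 4 * (((Re (L k))\<^sup>2) ^ 3 + ((Im (L k))\<^sup>2) ^ 3)"
      using power_sum_le[of "{False, True}" "\<lambda>i. if i then (Re (L k))\<^sup>2 else (Im (L k))\<^sup>2" 3] by (simp add: ac_simps)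
    finally show "((cmod (L k))\<^sup>2) ^ 3 \<le> 4 * ((\<Sum>j<p. Re (x u j) * w (k, j)) ^ 6 + (\<Sum>j<p. Im (x u j) * w (k, j)) ^ 6)"
      by (simp add: e flip: power_mult)
  qed
  finally show ?thesis
    by (simp add: mult_left_mono mult.assoc)
qed

lemma kap6_moment:
  shows "integrable \<mu> (kap6 u)" and "(\<integral>w. kap6 u w \<partial>\<mu>) \<le> 60 * real n * (nrm p (x u)) ^ 6"
proof -
  have lin: "integrable \<mu> (\<lambda>w. (\<Sum>j<p. y j * w (k, j)) ^ 6)"
    "(\<integral>w. (\<Sum>j<p. y j * w (k, j)) ^ 6 \<partial>\<mu>) = 15 * (\<Sum>j<p. (y j)\<^sup>2) ^ 3" if k: "k < n" for k and y :: "nat \<Rightarrow> real"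
  proof -
    have inj: "inj_on (\<lambda>j. (k, j)) {..<p}" by (auto simp: inj_on_def)
    have *: "finite I" "(\<lambda>j. (k, j)) ` {..<p} \<subseteq> I" using k by auto
    show "integrable \<mu> (\<lambda>w. (\<Sum>j<p. y j * w (k, j)) ^ 6)"
      "(\<integral>w. (\<Sum>j<p. y j * w (k, j)) ^ 6 \<partial>\<mu>) = 15 * (\<Sum>j<p. (y j)\<^sup>2) ^ 3"
      using gauss_linear_form_sixth_moment[OF *, of "\<lambda>i. y (snd i)"] by (simp_all add: sum.reindex[OF inj])
  qed
  show "integrable \<mu> (kap6 u)"
    unfolding kap6_def[abs_def]
    by (intro Bochner_Integration.integrable_sum integrable_mult_right Bochner_Integration.integrable_add lin) auto
  have "(\<integral>w. kap6 u w \<partial>\<mu>) = (\<Sum>k<n. 4 * (15 * (\<Sum>j<p. (Re (x u j))\<^sup>2) ^ 3 + 15 * (\<Sum>j<p. (Im (x u j))\<^sup>2) ^ 3))"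
    unfolding kap6_def by (subst Bochner_Integration.integral_sum) (auto simp: lin)
  also have "\<dots> = 60 * real n * ((\<Sum>j<p. (Re (x u j))\<^sup>2) ^ 3 + (\<Sum>j<p. (Im (x u j))\<^sup>2) ^ 3)"
    by (simp add: algebra_simps)
  also have "\<dots> \<le> 60 * real n * (nrm p (x u)) ^ 6"
  proof (intro mult_left_mono)
    have sup: "a ^ 3 + b ^ 3 \<le> (a + b) ^ 3" if "a \<ge> 0" "b \<ge> 0" for a b :: real
      using that by (simp add: power3_eq_cube algebra_simps)
    have "(\<Sum>j<p. (Re (x u j))\<^sup>2) ^ 3 + (\<Sum>j<p. (Im (x u j))\<^sup>2) ^ 3 \<le>
       ((\<Sum>j<p. (Re (x u j))\<^sup>2) + (\<Sum>j<p. (Im (x u j))\<^sup>2)) ^ 3"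
      by (intro sup sum_nonneg) auto
    also have "\<dots> = ((nrm p (x u))\<^sup>2) ^ 3"
      by (simp add: nrm_power2 cmod_power2 sum.distrib)
    finally show "(\<Sum>j<p. (Re (x u j))\<^sup>2) ^ 3 + (\<Sum>j<p. (Im (x u j))\<^sup>2) ^ 3 \<le> (nrm p (x u)) ^ 6"
      by (simp flip: power_mult)
  qed auto
  finally show "(\<integral>w. kap6 u w \<partial>\<mu>) \<le> 60 * real n * (nrm p (x u)) ^ 6" .
qed

end

section \<open>Sixth moments\<close>

context gram_resolvent_gauss
begin

text \<open>The coefficients are those produced in \<open>Phi_sixth_moment\<close>: 65536 = 2 * 1024
  * 32, with 1024 from \<open>young_sixth\<close>, 32 from \<open>add_power6_le\<close>, and 2 from
  absorbing half of the left side; likewise 32 = 2 * 16.\<close>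

definition CPhi :: "real \<Rightarrow> real \<Rightarrow> real" where
  "CPhi U V = 65536 * (((K + (1 + cmod z / \<eta>) / \<eta>) * (U * V)) ^ 6 + 60 * (V / \<eta>) ^ 6 * CP ^ 3 * U ^ 6)
     + 32 * (10 * K / \<eta> * (cmod z + 2 / \<eta> + CP) * (U * V)\<^sup>2) ^ 3"

definition Cm :: real where
  "Cm = 32 / \<eta> ^ 6 * (CPhi 1 1 + (CP / \<eta>) ^ 6)"

definition Cf :: "real \<Rightarrow> real \<Rightarrow> real" where
  "Cf A B = 32 * (CPhi (A / \<eta>) B + Cm * (A / \<eta> * B / \<eta>) ^ 6)"

lemma integrable_cmod_power: "bdd_fun h \<Longrightarrow> h \<in> borel_measurable \<mu> \<Longrightarrow> integrable \<mu> (\<lambda>w. cmod (h w) ^ k)"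
  using integrable_norm[OF integrable_bdd[of "\<lambda>w. h w ^ k"]]
  by (auto simp: norm_power intro!: bdd_fun_power borel_measurable_power)

lemma Phi_sixth_moment:
  assumes U: "nrm n u \<le> U" and V: "nrm n v \<le> V"
    and \<delta>: "1 / real n \<le> \<delta>" "s * real n \<le> \<delta>" "\<delta> \<le> 1"
  shows "(\<integral>w. cmod (Phi u v w) ^ 6 \<partial>\<mu>) \<le> CPhi U V * \<delta> ^ 3"
proof -
  have \<delta>0: "\<delta> \<ge> 0" using \<delta>(1) by (meson divide_nonneg_nonneg of_nat_0_le_iff order_trans zero_le_one)
  have UV: "U \<ge> 0" "V \<ge> 0" using U V nrm_nonneg order_trans by blast+
  note pos = \<eta>_pos K_pos s_pos CP_nonneg n_pos UV \<delta>0
  define c1 where "c1 = (K + (1 + cmod z / \<eta>) / \<eta>) * (U * V) * \<delta>"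
  define c2 where "c2 = 10 * K / \<eta> * (cmod z + 2 / \<eta> + CP) * (U * V)\<^sup>2 * \<delta>"
  have c1: "c1 \<ge> 0" and c2: "c2 \<ge> 0" using pos by (auto simp: c1_def c2_def)
  have E1: "cmod (E1 u v w) \<le> c1" for w
  proof -
    have "K / real n + s * real n * ((1 + cmod z / \<eta>) / \<eta>) \<le> K * \<delta> + \<delta> * ((1 + cmod z / \<eta>) / \<eta>)"
      using \<delta> pos mult_left_mono[OF \<delta>(1), of K] by (intro add_mono mult_right_mono) auto
    also have "\<dots> = (K + (1 + cmod z / \<eta>) / \<eta>) * \<delta>" by (simp add: algebra_simps)
    finally have "(K / real n + s * real n * ((1 + cmod z / \<eta>) / \<eta>)) * (nrm n u * nrm n v) \<le>
       ((K + (1 + cmod z / \<eta>) / \<eta>) * \<delta>) * (U * V)"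
      using U V pos by (intro mult_mono) auto
    then show ?thesis using cmod_E1_le[of u v w] by (simp add: c1_def mult_ac)
  qed
  have E2: "cmod (E2 u v w) \<le> c2 * cmod (Phi u v w) ^ 4" for w
  proof -
    have "10 * K / \<eta> * (cmod z + 2 / \<eta> + CP) / real n * (nrm n u * nrm n v)\<^sup>2 =
        10 * K / \<eta> * (cmod z + 2 / \<eta> + CP) * ((nrm n u * nrm n v)\<^sup>2 * (1 / real n))"
      by simp
    also have "\<dots> \<le> 10 * K / \<eta> * (cmod z + 2 / \<eta> + CP) * ((U * V)\<^sup>2 * \<delta>)"
      using pos U V \<delta> by (intro mult_left_mono mult_mono power_mono) auto
    finally have "10 * K / \<eta> * (cmod z + 2 / \<eta> + CP) / real n * (nrm n u * nrm n v)\<^sup>2 \<le> c2"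
      by (simp add: c2_def mult.assoc)
    then show ?thesis
      using cmod_E2_le[of u v w] by (meson mult_right_mono order_trans norm_ge_zero zero_le_power)
  qed
  define kc where "kc = (s * V / \<eta>) ^ 6 * (real n)\<^sup>2"
  have kc: "kc \<ge> 0" using pos by (simp add: kc_def)
  have kap6_nonneg: "kap6 u w \<ge> 0" for w unfolding kap6_def by (intro sum_nonneg) auto
  have kap: "cmod (kappa u v w) ^ 6 \<le> kc * kap6 u w" for w
  proof -
    have "(s * nrm n v / \<eta>) ^ 6 \<le> (s * V / \<eta>) ^ 6"
      using pos V by (intro power_mono divide_right_mono mult_left_mono) auto
    then have "(s * nrm n v / \<eta>) ^ 6 * (real n)\<^sup>2 * kap6 u w \<le> kc * kap6 u w"
      unfolding kc_def using kap6_nonneg by (intro mult_right_mono) auto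
    then show ?thesis using kappa_le[of u v w] by linarith
  qed
  \<comment> \<open>Half of the quantity being estimated stands in this bound. Its integral is
    finite because \<open>Phi\<close> is bounded, so it may be subtracted after integration.\<close>
  let ?B = "\<lambda>w. cmod (Phi u v w) ^ 6 / 2 + 32768 * (c1 ^ 6 + kc * kap6 u w) + 16 * c2 ^ 3"
  have pw: "cmod ((E1 u v w + kappa u v w) * g u v w + E2 u v w) \<le> ?B w" for w
  proof -
    let ?P = "cmod (Phi u v w)" and ?k = "cmod (kappa u v w)"
    have g: "cmod (g u v w) = ?P ^ 5"
      by (simp add: g_def norm_mult norm_power flip: power_add)
    have "cmod ((E1 u v w + kappa u v w) * g u v w + E2 u v w) \<le>
        (cmod (E1 u v w) + ?k) * ?P ^ 5 + cmod (E2 u v w)"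
      by (intro order_trans[OF norm_triangle_ineq] add_mono order_refl)
        (simp add: norm_mult g mult_right_mono norm_triangle_ineq)
    also have "\<dots> \<le> (c1 + ?k) * ?P ^ 5 + c2 * ?P ^ 4"
      using E1[of w] E2[of w] by (intro add_mono mult_right_mono) auto
    also have "\<dots> \<le> ?P ^ 6 / 2 + 1024 * (c1 + ?k) ^ 6 + 16 * c2 ^ 3"
      using young_sixth[of ?P "c1 + ?k" c2] c1 c2 by (simp add: mult.commute)
    finally have 1: "cmod ((E1 u v w + kappa u v w) * g u v w + E2 u v w) \<le>
        ?P ^ 6 / 2 + 1024 * (c1 + ?k) ^ 6 + 16 * c2 ^ 3" .
    have 2: "(c1 + ?k) ^ 6 \<le> 32 * (c1 ^ 6 + ?k ^ 6)"
      using c1 by (intro add_power6_le) auto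
    have "X \<le> a + 1024 * b + c \<Longrightarrow> b \<le> 32 * (d + e) \<Longrightarrow> e \<le> h \<Longrightarrow> X \<le> a + 32768 * (d + h) + c"
      for X a b c d e h :: real
    proof -
      assume a: "X \<le> a + 1024 * b + c" "b \<le> 32 * (d + e)" "e \<le> h"
      have "1024 * b \<le> 32768 * (d + e)" using mult_left_mono[OF a(2), of 1024] by simp
      also have "\<dots> \<le> 32768 * (d + h)" using a(3) by simp
      finally show ?thesis using a(1) by simp
    qed
    from this[OF 1 2 kap[of w]] show ?thesis .
  qed
  have IP: "integrable \<mu> (\<lambda>w. cmod (Phi u v w) ^ 6)"
    by (intro integrable_cmod_power bdd_Phi meas_Phi)
  have IB: "integrable \<mu> ?B"
    using IP kap6_moment(1)[of u]
    by (intro Bochner_Integration.integrable_add integrable_mult_right P.integrable_const integrable_divide)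
  have PP: "Phi u v w * g u v w = of_real (cmod (Phi u v w) ^ 6)" for w
  proof -
    have "Phi u v w * g u v w = (Phi u v w * cnj (Phi u v w)) ^ 3"
      by (simp add: g_def power_mult_distrib power_numeral_reduce)
    also have "\<dots> = of_real (((cmod (Phi u v w))\<^sup>2) ^ 3)"
      by (simp only: complex_norm_square[symmetric] of_real_power)
    finally show ?thesis by (simp flip: power_mult)
  qed
  have "(\<integral>w. cmod (Phi u v w) ^ 6 \<partial>\<mu>) = Re (\<integral>w. Phi u v w * g u v w \<partial>\<mu>)"
    by (simp only: PP integral_complex_of_real Re_complex_of_real)
  also have "\<dots> = Re (\<integral>w. (E1 u v w + kappa u v w) * g u v w + E2 u v w \<partial>\<mu>)"
    by (simp only: ibp_Phi(2))
  also have "\<dots> \<le> cmod (\<integral>w. (E1 u v w + kappa u v w) * g u v w + E2 u v w \<partial>\<mu>)"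
    by (rule complex_Re_le_cmod)
  also have "\<dots> \<le> (\<integral>w. ?B w \<partial>\<mu>)"
    by (intro order_trans[OF Bochner_Integration.integral_norm_bound] Bochner_Integration.integral_mono
        integrable_norm ibp_Phi(1) IB pw)
  also have "\<dots> = (\<integral>w. cmod (Phi u v w) ^ 6 \<partial>\<mu>) / 2 + 32768 * (c1 ^ 6 + kc * (\<integral>w. kap6 u w \<partial>\<mu>)) + 16 * c2 ^ 3"
    using IP kap6_moment(1)[of u] by (simp add: P.prob_space)
  finally have "(\<integral>w. cmod (Phi u v w) ^ 6 \<partial>\<mu>) \<le> 65536 * (c1 ^ 6 + kc * (\<integral>w. kap6 u w \<partial>\<mu>)) + 32 * c2 ^ 3"
    by simp
  also have "\<dots> \<le> CPhi U V * \<delta> ^ 3"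
  proof -
    have d6: "\<delta> ^ 6 \<le> \<delta> ^ 3" using \<delta>0 \<delta>(3) by (intro power_decreasing) auto
    have a: "c1 ^ 6 \<le> ((K + (1 + cmod z / \<eta>) / \<eta>) * (U * V)) ^ 6 * \<delta> ^ 3"
      unfolding c1_def power_mult_distrib[of _ \<delta>] using pos d6 by (intro mult_left_mono) auto
    have b: "c2 ^ 3 = (10 * K / \<eta> * (cmod z + 2 / \<eta> + CP) * (U * V)\<^sup>2) ^ 3 * \<delta> ^ 3"
      unfolding c2_def by (rule power_mult_distrib)
    have "kc * (\<integral>w. kap6 u w \<partial>\<mu>) \<le> kc * (60 * real n * (nrm p (x u)) ^ 6)"
      using kc by (intro mult_left_mono kap6_moment)
    \<comment> \<open>The powers regroup as s^6 n^3 |x|^6 = (s n)^3 (s |x|^2)^3. Here s n is the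
      small quantity and the other factor is bounded by the spike; this cube is what fixes the rate
      \<delta>^3.\<close>
    also have "\<dots> = 60 * (V / \<eta>) ^ 6 * (s * real n) ^ 3 * (s * (nrm p (x u))\<^sup>2) ^ 3"
      by (simp add: kc_def power_mult_distrib power_divide power_numeral_reduce mult_ac)
    also have "\<dots> \<le> 60 * (V / \<eta>) ^ 6 * \<delta> ^ 3 * (CP * U\<^sup>2) ^ 3"
    proof -
      have "CP * (nrm n u)\<^sup>2 \<le> CP * U\<^sup>2"
        using pos U by (intro mult_left_mono power_mono) auto
      then have "s * (nrm p (x u))\<^sup>2 \<le> CP * U\<^sup>2" using nrm_x_le[of u] by linarith
      then have x3: "(s * (nrm p (x u))\<^sup>2) ^ 3 \<le> (CP * U\<^sup>2) ^ 3"
        using pos by (intro power_mono) auto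
      have n3: "(s * real n) ^ 3 \<le> \<delta> ^ 3" using \<delta>(2) pos by (intro power_mono) auto
      show ?thesis
        by (rule mult_mono[OF mult_left_mono[OF n3] x3]) (use pos in auto)
    qed
    also have "\<dots> = 60 * (V / \<eta>) ^ 6 * CP ^ 3 * U ^ 6 * \<delta> ^ 3"
      by (simp add: power_mult_distrib flip: power_mult)
    finally have c: "kc * (\<integral>w. kap6 u w \<partial>\<mu>) \<le> 60 * (V / \<eta>) ^ 6 * CP ^ 3 * U ^ 6 * \<delta> ^ 3" .
    show ?thesis
      unfolding CPhi_def b using a c by (simp add: algebra_simps)
  qed
  finally show ?thesis .
qed

text \<open>Holds for each diagonal entry: by \<open>R_norm_identity\<close> its imaginary part is
  Im z times a squared norm.\<close>

lemma Im_m_sign: "Im z * Im (m w) \<ge> 0"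
proof -
  have "Im z * Im (Q w k k) \<ge> 0" if k: "k < n" for k
  proof -
    have "dot n (std_basis k) (\<lambda>a. cnj (R w (std_basis k) a)) = cnj (Q w k k)"
      using k by (simp add: R_std_basis)
    then have "- Im (Q w k k) = - Im z * (nrm n (R w (std_basis k)))\<^sup>2"
      using arg_cong[OF R_norm_identity[of "std_basis k" w], of Im] by simp
    then have "Im z * Im (Q w k k) = (Im z)\<^sup>2 * (nrm n (R w (std_basis k)))\<^sup>2"
      by (simp add: power2_eq_square)
    then show ?thesis by simp
  qed
  then have "(\<Sum>k<n. Im z * Im (Q w k k)) \<ge> 0" by (intro sum_nonneg) auto
  then show ?thesis
    by (simp add: m_def sum_distrib_left flip: sum_divide_distrib)
qed

text \<open>The trace of \<Lambda> Q is s times the sum, over the columns of G0, of quadratic forms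
  in Q, hence at most the trace of \<Lambda> over \<eta>. Since the trace of \<Lambda> is bounded,
  and not merely its norm, the spike is invisible in \<open>m\<close> up to order 1 / n.\<close>

lemma trace_Lam_le: "cmod (\<Sum>k<n. f (Lam (std_basis k)) (std_basis k) w) \<le> CP / \<eta>"
proof -
  let ?c = "\<lambda>j k. complex_of_real (G0 k j)"
  have xe: "x (std_basis k) j = ?c j k" if "k < n" for k j
    using that by (simp add: x_def std_basis_def if_distrib[of "\<lambda>x. _ * x"] cong: if_cong)
  have "(\<Sum>k<n. f (Lam (std_basis k)) (std_basis k) w) =
      of_real s * (\<Sum>k<n. \<Sum>j<p. ?c j k * (\<Sum>l<n. ?c j l * Q w l k))"
    by (simp only: f_def dot_Lam) (simp add: dot_def xe sum_distrib_left x_def[of "R w _"] R_std_basis)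
  also have "(\<Sum>k<n. \<Sum>j<p. ?c j k * (\<Sum>l<n. ?c j l * Q w l k)) = (\<Sum>j<p. \<Sum>k<n. \<Sum>l<n. ?c j k * (?c j l * Q w l k))"
    by (subst sum.swap) (simp add: sum_distrib_left)
  also have "\<dots> = (\<Sum>j<p. f (?c j) (?c j) w)"
  proof (intro sum.cong refl)
    fix j
    show "(\<Sum>k<n. \<Sum>l<n. ?c j k * (?c j l * Q w l k)) = f (?c j) (?c j) w"
      unfolding f_def dot_def R_def sum_distrib_left by (subst sum.swap) (simp add: mult_ac)
  qed
  finally have "cmod (\<Sum>k<n. f (Lam (std_basis k)) (std_basis k) w) = s * cmod (\<Sum>j<p. f (?c j) (?c j) w)"
    using s_pos by (simp add: norm_mult)
  also have "\<dots> \<le> s * (\<Sum>j<p. (nrm n (?c j))\<^sup>2 / \<eta>)"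
    using s_pos cmod_f_le[of "?c _" "?c _" w]
    by (intro mult_left_mono order_trans[OF norm_sum] sum_mono) (auto simp: power2_eq_square)
  also have "\<dots> = (s * (\<Sum>j<p. \<Sum>k<n. (G0 k j)\<^sup>2)) / \<eta>"
    by (simp add: nrm_power2 flip: sum_divide_distrib)
  also have "\<dots> \<le> CP / \<eta>" using CP \<eta>_pos by (intro divide_right_mono) auto
  finally show ?thesis .
qed

lemma avg_Phi:
  "(\<Sum>k<n. Phi (std_basis k) (std_basis k) w) / of_nat n + (\<Sum>k<n. f (Lam (std_basis k)) (std_basis k) w) / of_nat n
     = (m w)\<^sup>2 + z * m w + 1"
proof -
  have "(\<Sum>k<n. Phi (std_basis k) (std_basis k) w) =
     (z + m w) * (of_nat n * m w) + of_nat n - (\<Sum>k<n. f (Lam (std_basis k)) (std_basis k) w)"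
    using n_pos by (simp add: Phi_def sum.distrib sum_subtractf m_eq std_basis_def flip: sum_distrib_left)
  then show ?thesis
    using n_pos by (simp add: field_simps power2_eq_square)
qed

section \<open>Comparison with the semicircle limit and with the deterministic equivalent\<close>

context
  fixes mz :: complex
  assumes mz: "mz\<^sup>2 + z * mz + 1 = 0" "Im z * Im mz > 0"
begin

lemma m_stability: "\<eta> * cmod (m w - mz) \<le> cmod ((m w)\<^sup>2 + z * m w + 1)"
proof -
  have "(m w - mz) * (m w + mz + z) = (m w)\<^sup>2 + z * m w + 1 - (mz\<^sup>2 + z * mz + 1)"
    by (simp add: power2_eq_square algebra_simps)
  then have e: "(m w - mz) * (m w + mz + z) = (m w)\<^sup>2 + z * m w + 1" by (simp add: mz)
  \<comment> \<open>None of the three imaginary parts has the sign opposite to Im z, so nothing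
    cancels.\<close>
  have "\<eta> \<le> \<bar>Im (m w + mz + z)\<bar>"
    using Im_m_sign[of w] mz(2) unfolding \<eta>_def zero_less_mult_iff zero_le_mult_iff by auto
  also have "\<dots> \<le> cmod (m w + mz + z)" by (rule abs_Im_le_cmod)
  finally have "\<eta> * cmod (m w - mz) \<le> cmod (m w + mz + z) * cmod (m w - mz)"
    by (rule mult_right_mono) simp
  then show ?thesis
    unfolding e[symmetric] norm_mult by (simp only: mult.commute)
qed

text \<open>By \<open>avg_Phi\<close> the defect in the quadratic equation is an average of
  \<open>Phi\<close> over basis vectors, treated by Jensen and \<open>Phi_sixth_moment\<close> with
  unit bounds, plus a spike trace that is surely of order 1 / n.\<close>

lemma m_sixth_moment:
  assumes \<delta>: "1 / real n \<le> \<delta>" "s * real n \<le> \<delta>" "\<delta> \<le> 1"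
  shows "(\<integral>w. cmod (m w - mz) ^ 6 \<partial>\<mu>) \<le> Cm * \<delta> ^ 3"
proof -
  have \<delta>0: "\<delta> \<ge> 0" using \<delta>(1) by (meson divide_nonneg_nonneg of_nat_0_le_iff order_trans zero_le_one)
  let ?P = "\<lambda>k w. cmod (Phi (std_basis k) (std_basis k) w)"
  let ?B = "\<lambda>w. 32 / \<eta> ^ 6 * ((\<Sum>k<n. ?P k w ^ 6) / real n + (CP / \<eta> * \<delta>) ^ 6)"
  have pw: "cmod (m w - mz) ^ 6 \<le> ?B w" for w
  proof -
    have "cmod ((\<Sum>k<n. Phi (std_basis k) (std_basis k) w) / of_nat n) \<le> (\<Sum>k<n. ?P k w) / real n"
      by (auto simp: norm_divide intro!: divide_right_mono norm_sum)
    moreover have "cmod ((\<Sum>k<n. f (Lam (std_basis k)) (std_basis k) w) / of_nat n) \<le> CP / \<eta> * \<delta>"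
    proof -
      have "cmod ((\<Sum>k<n. f (Lam (std_basis k)) (std_basis k) w) / of_nat n) =
         cmod (\<Sum>k<n. f (Lam (std_basis k)) (std_basis k) w) * (1 / real n)" by (simp add: norm_divide)
      also have "\<dots> \<le> CP / \<eta> * \<delta>"
        using \<delta> CP_nonneg \<eta>_pos by (intro mult_mono trace_Lam_le) auto
      finally show ?thesis .
    qed
    ultimately have "\<eta> * cmod (m w - mz) \<le> (\<Sum>k<n. ?P k w) / real n + CP / \<eta> * \<delta>"
      using m_stability[of w] unfolding avg_Phi[symmetric]
      by (meson add_mono norm_triangle_ineq order_trans)
    then have "(\<eta> * cmod (m w - mz)) ^ 6 \<le> ((\<Sum>k<n. ?P k w) / real n + CP / \<eta> * \<delta>) ^ 6"
      using \<eta>_pos by (intro power_mono) auto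
    also have "\<dots> \<le> 32 * (((\<Sum>k<n. ?P k w) / real n) ^ 6 + (CP / \<eta> * \<delta>) ^ 6)"
      using CP_nonneg \<eta>_pos \<delta>0 by (intro add_power6_le divide_nonneg_nonneg sum_nonneg) auto
    also have "((\<Sum>k<n. ?P k w) / real n) ^ 6 \<le> (\<Sum>k<n. ?P k w ^ 6) / real n"
    proof -
      define S where "S = (\<Sum>k<n. ?P k w ^ 6)"
      have "(\<Sum>k<n. ?P k w) ^ 6 \<le> real n ^ 5 * S"
        using power_sum_le[of "{..<n}" "\<lambda>k. ?P k w" 6] n_pos by (auto simp: S_def)
      then have "((\<Sum>k<n. ?P k w) / real n) ^ 6 \<le> real n ^ 5 * S / real n ^ 6"
        unfolding power_divide by (intro divide_right_mono) auto
      also have "\<dots> = S / real n" using n_pos by (simp add: power_numeral_reduce)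
      finally show ?thesis by (simp add: S_def)
    qed
    finally have "\<eta> ^ 6 * cmod (m w - mz) ^ 6 \<le> 32 * ((\<Sum>k<n. ?P k w ^ 6) / real n + (CP / \<eta> * \<delta>) ^ 6)"
      by (simp add: power_mult_distrib)
    then show ?thesis using \<eta>_pos by (simp add: field_simps)
  qed
  have IP: "integrable \<mu> (\<lambda>w. ?P k w ^ 6)" for k
    by (intro integrable_cmod_power bdd_Phi meas_Phi)
  have IB: "integrable \<mu> ?B"
    using IP by (intro integrable_mult_right Bochner_Integration.integrable_add integrable_divide
        Bochner_Integration.integrable_sum P.integrable_const)
  have "(\<integral>w. cmod (m w - mz) ^ 6 \<partial>\<mu>) \<le> (\<integral>w. ?B w \<partial>\<mu>)"
    by (intro Bochner_Integration.integral_mono IB pw integrable_cmod_power bdd_fun_intros bdd_m borel_measurable_diff meas_m) auto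
  also have "\<dots> = 32 / \<eta> ^ 6 * ((\<Sum>k<n. \<integral>w. ?P k w ^ 6 \<partial>\<mu>) / real n + (CP / \<eta> * \<delta>) ^ 6)"
    using IP by (simp add: P.prob_space Bochner_Integration.integral_sum)
  also have "\<dots> \<le> 32 / \<eta> ^ 6 * (CPhi 1 1 * \<delta> ^ 3 + (CP / \<eta>) ^ 6 * \<delta> ^ 3)"
  proof (intro mult_left_mono add_mono)
    have "(\<Sum>k<n. \<integral>w. ?P k w ^ 6 \<partial>\<mu>) \<le> (\<Sum>k<n. CPhi 1 1 * \<delta> ^ 3)"
      using \<delta> by (intro sum_mono Phi_sixth_moment) auto
    then show "(\<Sum>k<n. \<integral>w. ?P k w ^ 6 \<partial>\<mu>) / real n \<le> CPhi 1 1 * \<delta> ^ 3"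
      using n_pos by (simp add: field_simps)
    have "\<delta> ^ 6 \<le> \<delta> ^ 3" using \<delta>0 \<delta>(3) by (intro power_decreasing) auto
    then show "(CP / \<eta> * \<delta>) ^ 6 \<le> (CP / \<eta>) ^ 6 * \<delta> ^ 3"
      unfolding power_mult_distrib[of _ \<delta>] using CP_nonneg \<eta>_pos by (intro mult_left_mono) auto
  qed (use \<eta>_pos in auto)
  also have "\<dots> = Cm * \<delta> ^ 3"
    unfolding Cm_def by (simp only: distrib_right mult.assoc)
  finally show ?thesis .
qed

text \<open>Here q is the inverse of \<Lambda> - z - mz applied to a. Pairing the equation with the
  conjugate of q leaves a real \<Lambda> term, so the imaginary part bounds q; Im z and Im mz have
  equal signs and add up.\<close>

lemma nrm_spike_inverse_le:
  assumes q: "\<And>k. k < n \<Longrightarrow> Lam q k - (z + mz) * q k = a k"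
  shows "nrm n q \<le> nrm n a / \<eta>"
proof -
  have "dot n a (\<lambda>k. cnj (q k)) = (\<Sum>k<n. (Lam q k - (z + mz) * q k) * cnj (q k))"
    unfolding dot_def by (intro sum.cong refl) (simp add: q)
  also have "\<dots> = dot n (Lam q) (\<lambda>k. cnj (q k)) - (z + mz) * dot n q (\<lambda>k. cnj (q k))"
    by (simp add: dot_def sum_subtractf sum_distrib_left algebra_simps)
  also have "dot n (Lam q) (\<lambda>k. cnj (q k)) = of_real s * of_real ((nrm p (x q))\<^sup>2)"
  proof -
    have "x (\<lambda>k. cnj (q k)) = (\<lambda>j. cnj (x q j))" by (simp add: x_def fun_eq_iff)
    then show ?thesis by (simp only: dot_Lam dot_cnj)
  qed
  finally have "Im (dot n a (\<lambda>k. cnj (q k))) = - (Im (z + mz) * (nrm n q)\<^sup>2)"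
    unfolding dot_cnj by simp
  then have "\<bar>Im (z + mz)\<bar> * (nrm n q)\<^sup>2 \<le> nrm n a * nrm n q"
    using abs_Im_le_cmod[of "dot n a (\<lambda>k. cnj (q k))"] cmod_dot_le[of n a "\<lambda>k. cnj (q k)"]
    by (simp add: abs_mult)
  moreover have "\<eta> \<le> \<bar>Im (z + mz)\<bar>"
    using mz(2) unfolding \<eta>_def zero_less_mult_iff by auto
  ultimately have "\<eta> * (nrm n q)\<^sup>2 \<le> nrm n a * nrm n q"
    by (meson mult_right_mono order_trans zero_le_power2)
  then have "(\<eta> * nrm n q) * nrm n q \<le> nrm n a * nrm n q"
    by (simp add: power2_eq_square mult_ac)
  then have "\<eta> * nrm n q \<le> nrm n a \<or> nrm n q = 0"
    using nrm_nonneg[of n q] by (metis mult_le_cancel_right_pos order_le_less)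
  then show ?thesis using \<eta>_pos by (auto simp: field_simps)
qed

lemma f_sixth_moment:
  assumes q: "\<And>k. k < n \<Longrightarrow> Lam q k - (z + mz) * q k = a k"
    and A: "nrm n a \<le> A" and B: "nrm n b \<le> B"
    and \<delta>: "1 / real n \<le> \<delta>" "s * real n \<le> \<delta>" "\<delta> \<le> 1"
  shows "(\<integral>w. cmod (f a b w - dot n q b) ^ 6 \<partial>\<mu>) \<le> Cf A B * \<delta> ^ 3"
proof -
  have AB: "A \<ge> 0" "B \<ge> 0" using A B nrm_nonneg order_trans by blast+
  have q': "nrm n q \<le> A / \<eta>"
    using nrm_spike_inverse_le[OF q] A \<eta>_pos by (meson divide_right_mono order_trans less_imp_le)
  have fa: "f a b w = f (Lam q) b w - (z + mz) * f q b w" for w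
  proof -
    have "f a b w = (\<Sum>k<n. (Lam q k - (z + mz) * q k) * R w b k)"
      unfolding f_def dot_def by (intro sum.cong refl) (simp add: q)
    then show ?thesis by (simp add: f_def dot_def sum_subtractf sum_distrib_left algebra_simps)
  qed
  define c where "c = A / \<eta> * B / \<eta>"
  have c: "c \<ge> 0" using AB \<eta>_pos by (simp add: c_def)
  let ?B = "\<lambda>w. 32 * (cmod (Phi q b w) ^ 6 + c ^ 6 * cmod (m w - mz) ^ 6)"
  have pw: "cmod (f a b w - dot n q b) ^ 6 \<le> ?B w" for w
  proof -
    \<comment> \<open>An exact identity: a is expressed through q, and the random \<open>m\<close>
      inside \<open>Phi\<close> is compared with its limit. Both terms on the right have controlled
      sixth moments.\<close>
    have "f a b w - dot n q b = (m w - mz) * f q b w - Phi q b w"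
      unfolding fa Phi_def by (simp add: algebra_simps)
    then have "cmod (f a b w - dot n q b) \<le> cmod ((m w - mz) * f q b w) + cmod (Phi q b w)"
      using norm_triangle_ineq4 by metis
    also have "cmod ((m w - mz) * f q b w) \<le> cmod (m w - mz) * c"
    proof -
      have "cmod (f q b w) \<le> nrm n q * nrm n b / \<eta>" by (rule cmod_f_le)
      also have "\<dots> \<le> c"
        unfolding c_def using q' B AB \<eta>_pos by (intro divide_right_mono mult_mono) auto
      finally show ?thesis by (simp add: norm_mult mult_left_mono)
    qed
    finally have "cmod (f a b w - dot n q b) ^ 6 \<le> (cmod (m w - mz) * c + cmod (Phi q b w)) ^ 6"
      by (intro power_mono) auto
    also have "\<dots> \<le> 32 * ((cmod (m w - mz) * c) ^ 6 + cmod (Phi q b w) ^ 6)"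
      using c by (intro add_power6_le) auto
    finally show ?thesis by (simp add: power_mult_distrib mult_ac add_ac)
  qed
  have I1: "integrable \<mu> (\<lambda>w. cmod (Phi q b w) ^ 6)"
    by (intro integrable_cmod_power bdd_Phi meas_Phi)
  have I2: "integrable \<mu> (\<lambda>w. cmod (m w - mz) ^ 6)"
    by (intro integrable_cmod_power bdd_fun_intros bdd_m borel_measurable_diff meas_m) auto
  have "(\<integral>w. cmod (f a b w - dot n q b) ^ 6 \<partial>\<mu>) \<le> (\<integral>w. ?B w \<partial>\<mu>)"
    by (intro Bochner_Integration.integral_mono pw integrable_cmod_power bdd_fun_intros bdd_f borel_measurable_diff meas_f
        integrable_mult_right Bochner_Integration.integrable_add I1 I2) auto
  also have "\<dots> = 32 * ((\<integral>w. cmod (Phi q b w) ^ 6 \<partial>\<mu>) + c ^ 6 * (\<integral>w. cmod (m w - mz) ^ 6 \<partial>\<mu>))"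
    using I1 I2 by simp
  also have "\<dots> \<le> 32 * (CPhi (A / \<eta>) B * \<delta> ^ 3 + c ^ 6 * (Cm * \<delta> ^ 3))"
    using c by (intro mult_left_mono add_mono Phi_sixth_moment[OF q' B \<delta>] m_sixth_moment[OF \<delta>]) auto
  finally show ?thesis by (simp add: Cf_def c_def algebra_simps)
qed

context
  fixes Qb :: "nat \<Rightarrow> nat \<Rightarrow> complex" and \<delta> :: real
  assumes Qb: "\<And>a b. a < n \<Longrightarrow> b < n \<Longrightarrow>
      (\<Sum>c<n. Qb a c * (of_real (s * (\<Sum>j<p. G0 c j * G0 b j)) - (if c = b then z + mz else 0))) =
      (if a = b then 1 else 0)"
    and \<delta>: "1 / real n \<le> \<delta>" "s * real n \<le> \<delta>" "\<delta> \<le> 1"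
begin

definition bil :: "(nat \<Rightarrow> complex) \<Rightarrow> (nat \<Rightarrow> complex) \<Rightarrow> (nat \<times> nat \<Rightarrow> real) \<Rightarrow> complex" where
  "bil a b w = (\<Sum>i<n. \<Sum>k<n. a i * (Q w i k - Qb i k) * b k)"

lemma bil_eq: "bil a b w = f a b w - dot n (\<lambda>k. \<Sum>i<n. a i * Qb i k) b"
proof -
  have "(\<Sum>i<n. \<Sum>k<n. a i * Qb i k * b k) = (\<Sum>k<n. \<Sum>i<n. a i * Qb i k * b k)"
    by (rule sum.swap)
  then show ?thesis
    by (simp add: bil_def f_def dot_def R_def sum_distrib_left sum_distrib_right sum_subtractf algebra_simps)
qed

lemma bdd_bil: "bdd_fun (bil a b)"
  unfolding bil_eq[abs_def] by (intro bdd_fun_intros bdd_f)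

lemma meas_bil: "bil a b \<in> borel_measurable \<mu>"
  unfolding bil_eq[abs_def] by (intro borel_measurable_diff meas_f) auto

lemma bil_sixth_moment:
  assumes A: "nrm n a \<le> A" and B: "nrm n b \<le> B"
  shows "(\<integral>w. cmod (bil a b w) ^ 6 \<partial>\<mu>) \<le> Cf A B * \<delta> ^ 3"
proof -
  \<comment> \<open>The transpose of \<open>Qb\<close> applied to a. The left-inverse property of
    \<open>Qb\<close> turns into the equation for q because \<Lambda> is symmetric.\<close>
  define q where "q k = (\<Sum>i<n. a i * Qb i k)" for k
  have q: "Lam q k - (z + mz) * q k = a k" if k: "k < n" for k
  proof -
    have "Lam q k = (\<Sum>j<p. \<Sum>c<n. of_real (s * (G0 c j * G0 k j)) * q c)"
      by (simp add: Lam_def x_def sum_distrib_left mult_ac)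
    also have "\<dots> = (\<Sum>c<n. q c * of_real (s * (\<Sum>j<p. G0 c j * G0 k j)))"
      by (subst sum.swap) (simp add: sum_distrib_left mult_ac)
    finally have "Lam q k - (z + mz) * q k =
        (\<Sum>c<n. q c * (of_real (s * (\<Sum>j<p. G0 c j * G0 k j)) - (if c = k then z + mz else 0)))"
      using k by (simp add: right_diff_distrib sum_subtractf if_distrib[of "\<lambda>x. _ * x"] mult.commute cong: if_cong)
    also have "\<dots> = (\<Sum>c<n. \<Sum>i<n. a i * (Qb i c * (of_real (s * (\<Sum>j<p. G0 c j * G0 k j)) - (if c = k then z + mz else 0))))"
      by (simp add: q_def sum_distrib_right mult.assoc)
    also have "\<dots> = (\<Sum>i<n. a i * (\<Sum>c<n. Qb i c * (of_real (s * (\<Sum>j<p. G0 c j * G0 k j)) - (if c = k then z + mz else 0))))"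
      by (subst sum.swap) (simp only: sum_distrib_left)
    also have "\<dots> = (\<Sum>i<n. a i * (if i = k then 1 else 0))"
      by (intro sum.cong refl arg_cong2[of _ _ _ _ "(*)"] Qb) (use k in auto)
    also have "\<dots> = a k" using k by (simp add: if_distrib[of "\<lambda>x. _ * x"] cong: if_cong)
    finally show ?thesis .
  qed
  show ?thesis
    unfolding bil_eq using f_sixth_moment[OF q A B \<delta>] by (simp add: q_def[abs_def])
qed

text \<open>The trace of A (Q - Qb) is the sum of the bilinear forms of row k of A with the basis
  vector k. Jensen reduces it to those forms, so only the norms of the rows matter.\<close>

lemma trace_sixth_moment:
  assumes A: "\<And>k. k < n \<Longrightarrow> nrm n (A k) \<le> CA"
  shows "(\<integral>w. cmod ((\<Sum>k<n. bil (A k) (std_basis k) w) / of_nat n) ^ 6 \<partial>\<mu>) \<le> Cf CA 1 * \<delta> ^ 3"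
proof -
  let ?P = "\<lambda>k w. cmod (bil (A k) (std_basis k) w)"
  have pw: "cmod ((\<Sum>k<n. bil (A k) (std_basis k) w) / of_nat n) ^ 6 \<le> (\<Sum>k<n. ?P k w ^ 6) / real n" for w
  proof -
    define S where "S = (\<Sum>k<n. ?P k w ^ 6)"
    have "cmod ((\<Sum>k<n. bil (A k) (std_basis k) w) / of_nat n) \<le> (\<Sum>k<n. ?P k w) / real n"
      by (auto simp: norm_divide intro!: divide_right_mono norm_sum)
    then have "cmod ((\<Sum>k<n. bil (A k) (std_basis k) w) / of_nat n) ^ 6 \<le> ((\<Sum>k<n. ?P k w) / real n) ^ 6"
      by (intro power_mono) auto
    also have "\<dots> \<le> real n ^ 5 * S / real n ^ 6"
      unfolding power_divide S_def using power_sum_le[of "{..<n}" "\<lambda>k. ?P k w" 6] n_pos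
      by (intro divide_right_mono) auto
    also have "\<dots> = S / real n" using n_pos by (simp add: power_numeral_reduce)
    finally show ?thesis by (simp add: S_def)
  qed
  have I: "integrable \<mu> (\<lambda>w. ?P k w ^ 6)" for k
    by (intro integrable_cmod_power bdd_bil meas_bil)
  have "(\<integral>w. cmod ((\<Sum>k<n. bil (A k) (std_basis k) w) / of_nat n) ^ 6 \<partial>\<mu>) \<le> (\<integral>w. (\<Sum>k<n. ?P k w ^ 6) / real n \<partial>\<mu>)"
    by (intro Bochner_Integration.integral_mono pw integrable_cmod_power bdd_fun_intros bdd_bil
        borel_measurable_divide borel_measurable_sum meas_bil integrable_divide Bochner_Integration.integrable_sum I) auto
  also have "\<dots> = (\<Sum>k<n. \<integral>w. ?P k w ^ 6 \<partial>\<mu>) / real n"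
    using I by (simp add: Bochner_Integration.integral_sum)
  also have "\<dots> \<le> (\<Sum>k<n. Cf CA 1 * \<delta> ^ 3) / real n"
    by (intro divide_right_mono sum_mono bil_sixth_moment A) auto
  also have "\<dots> = Cf CA 1 * \<delta> ^ 3" using n_pos by simp
  finally show ?thesis .
qed

end

end

end

section \<open>Matrix inverses and almost sure convergence\<close>

lemma minv_inverts:
  fixes A :: "'a :: field mat"
  assumes A: "A \<in> carrier_mat n n" and det: "det A \<noteq> 0"
  shows "minv A \<in> carrier_mat n n" "A * minv A = 1\<^sub>m n" "minv A * A = 1\<^sub>m n"
proof -
  have "A \<in> Units (ring_mat TYPE('a) n ())"
    by (rule det_non_zero_imp_unit[OF A det])
  then obtain B where "mat_inverse A = Some B"
    using mat_inverse(1)[OF A, where b = "()"] by (cases "mat_inverse A") auto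
  then show "minv A \<in> carrier_mat n n" "A * minv A = 1\<^sub>m n" "minv A * A = 1\<^sub>m n"
    using mat_inverse(2)[OF A] by (auto simp: minv_def)
qed

text \<open>Cramer's rule, for the sake of measurability: the entries become quotients of
  polynomials in the entries of A.\<close>

lemma minv_entry:
  fixes A :: "'a :: field mat"
  assumes A: "A \<in> carrier_mat n n" and det: "det A \<noteq> 0" and ij: "i < n" "j < n"
  shows "minv A $$ (i, j) = cofactor A j i / det A"
proof -
  note inv = minv_inverts[OF A det] and adj = adj_mat[OF A]
  have "adj_mat A = minv A * A * adj_mat A" using inv adj(1) by simp
  also have "\<dots> = minv A * (A * adj_mat A)" by (rule assoc_mult_mat[OF inv(1) A adj(1)])
  also have "\<dots> = minv A * (det A \<cdot>\<^sub>m 1\<^sub>m n)" by (simp only: adj(2))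
  also have "\<dots> = det A \<cdot>\<^sub>m minv A"
    using inv(1) by (metis mult_smult_distrib one_carrier_mat right_mult_one_mat)
  finally have "adj_mat A $$ (i, j) = det A * minv A $$ (i, j)"
    using inv(1) ij by simp
  then show ?thesis using A ij det by (simp add: adj_mat_def)
qed

text \<open>Common shape of the two inverted matrices: the centred Gram matrix with shift -z, and
  the spike with shift -(z + m).\<close>

definition shift_mat :: "nat \<Rightarrow> (nat \<Rightarrow> nat \<Rightarrow> real) \<Rightarrow> complex \<Rightarrow> complex mat" where
  "shift_mat n A c = mat n n (\<lambda>(a, b). complex_of_real (A a b) + (if a = b then c else 0))"

lemma shift_mat_carrier [simp]: "shift_mat n A c \<in> carrier_mat n n"
  by (simp add: shift_mat_def)

text \<open>For a kernel vector v the quadratic form of the real symmetric A is real, so the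
  imaginary part of the paired equation leaves Im c times the squared norm of v.\<close>

lemma shift_mat_det:
  assumes sym: "\<And>a b. a < n \<Longrightarrow> b < n \<Longrightarrow> A a b = A b a" and c: "Im c \<noteq> 0"
  shows "det (shift_mat n A c) \<noteq> 0"
proof
  assume "det (shift_mat n A c) = 0"
  then obtain v where v: "v \<in> carrier_vec n" "v \<noteq> 0\<^sub>v n" "shift_mat n A c *\<^sub>v v = 0\<^sub>v n"
    using det_0_iff_vec_prod_zero_field[OF shift_mat_carrier] by blast
  define S where "S = (\<Sum>a<n. \<Sum>b<n. cnj (v $ a) * (of_real (A a b) * v $ b))"
  have row: "(\<Sum>b<n. of_real (A a b) * v $ b) + c * v $ a = 0" if a: "a < n" for a
  proof -
    have "0 = (shift_mat n A c *\<^sub>v v) $ a" using v a by simp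
    also have "\<dots> = (\<Sum>b<n. (of_real (A a b) + (if a = b then c else 0)) * v $ b)"
      using v(1) a by (simp add: shift_mat_def scalar_prod_def atLeast0LessThan)
    also have "\<dots> = (\<Sum>b<n. of_real (A a b) * v $ b) + c * v $ a"
      using a by (simp add: distrib_right sum.distrib if_distrib[of "\<lambda>x. x * _"] cong: if_cong)
    finally show ?thesis by simp
  qed
  have "0 = (\<Sum>a<n. cnj (v $ a) * ((\<Sum>b<n. of_real (A a b) * v $ b) + c * v $ a))"
    using row by simp
  also have "\<dots> = S + c * (\<Sum>a<n. v $ a * cnj (v $ a))"
    by (simp add: S_def distrib_left sum.distrib sum_distrib_left mult_ac)
  also have "(\<Sum>a<n. v $ a * cnj (v $ a)) = of_real (\<Sum>a<n. (cmod (v $ a))\<^sup>2)"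
    by (simp add: complex_norm_square del: of_real_power)
  finally have e: "S + c * of_real (\<Sum>a<n. (cmod (v $ a))\<^sup>2) = 0" by simp
  have "cnj S = (\<Sum>a<n. \<Sum>b<n. cnj (v $ b) * (of_real (A b a) * v $ a))"
    by (simp add: S_def sym mult_ac)
  also have "\<dots> = S" unfolding S_def by (rule sum.swap)
  finally have "Im (cnj S) = Im S" by simp
  then have "Im S = 0" by simp
  then have "Im c * (\<Sum>a<n. (cmod (v $ a))\<^sup>2) = 0"
    using arg_cong[OF e, of Im] by simp
  then have "(\<Sum>a<n. (cmod (v $ a))\<^sup>2) = 0" using c by simp
  then have "\<forall>a<n. v $ a = 0" by (subst (asm) sum_nonneg_eq_0_iff) auto
  then have "v = 0\<^sub>v n" using v(1) by (intro eq_vecI) auto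
  then show False using v(2) by simp
qed

lemma shift_mat_mult_minv:
  assumes sym: "\<And>a b. a < n \<Longrightarrow> b < n \<Longrightarrow> A a b = A b a" and c: "Im c \<noteq> 0" and ab: "a < n" "b < n"
  shows "(\<Sum>k<n. of_real (A a k) * minv (shift_mat n A c) $$ (k, b)) + c * minv (shift_mat n A c) $$ (a, b)
      = (if a = b then 1 else 0)"
proof -
  have det: "det (shift_mat n A c) \<noteq> 0" by (rule shift_mat_det) (use sym c in auto)
  note inv = minv_inverts[OF shift_mat_carrier det]
  have "(shift_mat n A c * minv (shift_mat n A c)) $$ (a, b) =
      (\<Sum>k<n. (of_real (A a k) + (if a = k then c else 0)) * minv (shift_mat n A c) $$ (k, b))"
    using inv(1) ab by (subst index_mult_mat) (auto simp: scalar_prod_def atLeast0LessThan shift_mat_def intro!: sum.cong)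
  also have "\<dots> = (\<Sum>k<n. of_real (A a k) * minv (shift_mat n A c) $$ (k, b)) + c * minv (shift_mat n A c) $$ (a, b)"
    using ab by (simp add: distrib_right sum.distrib if_distrib[of "\<lambda>x. x * _"] cong: if_cong)
  finally show ?thesis unfolding inv(2) using ab by simp
qed

lemma minv_mult_shift_mat:
  assumes sym: "\<And>a b. a < n \<Longrightarrow> b < n \<Longrightarrow> A a b = A b a" and c: "Im c \<noteq> 0" and ab: "a < n" "b < n"
  shows "(\<Sum>k<n. minv (shift_mat n A c) $$ (a, k) * (of_real (A k b) + (if k = b then c else 0)))
      = (if a = b then 1 else 0)"
proof -
  have det: "det (shift_mat n A c) \<noteq> 0" by (rule shift_mat_det) (use sym c in auto)
  note inv = minv_inverts[OF shift_mat_carrier det]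
  have "(minv (shift_mat n A c) * shift_mat n A c) $$ (a, b) =
      (\<Sum>k<n. minv (shift_mat n A c) $$ (a, k) * (of_real (A k b) + (if k = b then c else 0)))"
    using inv(1) ab by (subst index_mult_mat) (auto simp: scalar_prod_def atLeast0LessThan shift_mat_def intro!: sum.cong)
  then show ?thesis unfolding inv(3) using ab by simp
qed

section \<open>Measurability, and transfer of moments to the probability space\<close>

lemma borel_measurable_det:
  fixes A :: "'b \<Rightarrow> complex mat"
  assumes A: "\<And>w. A w \<in> carrier_mat n n"
    and meas: "\<And>i j. i < n \<Longrightarrow> j < n \<Longrightarrow> (\<lambda>w. A w $$ (i, j)) \<in> borel_measurable N"
  shows "(\<lambda>w. det (A w)) \<in> borel_measurable N"
  unfolding det_def'[OF A]
proof (intro borel_measurable_sum borel_measurable_times borel_measurable_prod borel_measurable_const)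
  fix p i assume "p \<in> {p. p permutes {0..<n}}" "i \<in> {0..<n}"
  then show "(\<lambda>w. A w $$ (i, p i)) \<in> borel_measurable N"
    using permutes_in_image[of p "{0..<n}" i] by (intro meas) auto
qed

lemma borel_measurable_minv_entry:
  fixes A :: "'b \<Rightarrow> complex mat"
  assumes A: "\<And>w. A w \<in> carrier_mat n n" "\<And>w. det (A w) \<noteq> 0"
    and meas: "\<And>i j. i < n \<Longrightarrow> j < n \<Longrightarrow> (\<lambda>w. A w $$ (i, j)) \<in> borel_measurable N"
    and ij: "i < n" "j < n"
  shows "(\<lambda>w. minv (A w) $$ (i, j)) \<in> borel_measurable N"
proof -
  have "(\<lambda>w. det (mat_delete (A w) j i)) \<in> borel_measurable N"
  proof (rule borel_measurable_det[where n = "n - 1"])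
    show "mat_delete (A w) j i \<in> carrier_mat (n - 1) (n - 1)" for w
      using A(1)[of w] by (auto simp: mat_delete_def)
    fix k l assume "k < n - 1" "l < n - 1"
    then have "(\<lambda>w. mat_delete (A w) j i $$ (k, l)) =
        (\<lambda>w. A w $$ (if k < j then k else Suc k, if l < i then l else Suc l))"
      using carrier_matD[OF A(1)] by (simp add: mat_delete_def fun_eq_iff)
    then show "(\<lambda>w. mat_delete (A w) j i $$ (k, l)) \<in> borel_measurable N"
      using \<open>k < n - 1\<close> \<open>l < n - 1\<close> meas by simp
  qed
  moreover have "(\<lambda>w. det (A w)) \<in> borel_measurable N"
    by (rule borel_measurable_det[OF A(1) meas])
  ultimately show ?thesis
    unfolding minv_entry[OF A ij] cofactor_def
    by (intro borel_measurable_divide borel_measurable_times borel_measurable_const)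
qed

text \<open>For one fixed N the noise has the product law, so integrals computed on the product
  space carry over. The restriction to I is there because the product space consists of extensional
  functions.\<close>

lemma (in prob_space) gauss_vector_law:
  assumes I: "finite I" "I \<noteq> {}" and ind: "indep_vars (\<lambda>_. borel) X I"
    and dist: "\<And>i. i \<in> I \<Longrightarrow> distributed M lborel (X i) std_normal_density"
    and h [measurable]: "h \<in> borel_measurable (Pi\<^sub>M I (\<lambda>_. gauss))"
  shows "(\<lambda>\<omega>. h (\<lambda>i\<in>I. X i \<omega>)) \<in> borel_measurable M"
    and "(\<integral>\<^sup>+\<omega>. ennreal (h (\<lambda>i\<in>I. X i \<omega>)) \<partial>M) = (\<integral>\<^sup>+w. ennreal (h w) \<partial>Pi\<^sub>M I (\<lambda>_. gauss))"
proof -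
  have X [measurable]: "X i \<in> borel_measurable M" if "i \<in> I" for i
    using ind that by (simp add: indep_vars_def)
  have law: "distr M borel (X i) = gauss" if "i \<in> I" for i
  proof -
    have "distr M borel (X i) = distr M lborel (X i)" by (rule distr_cong) auto
    then show ?thesis
      using distributed_distr_eq_density[OF dist[OF that]] by (simp add: gauss_def)
  qed
  have "distr M (Pi\<^sub>M I (\<lambda>_. borel)) (\<lambda>\<omega>. \<lambda>i\<in>I. X i \<omega>) = Pi\<^sub>M I (\<lambda>i. distr M borel (X i))"
    using indep_vars_iff_distr_eq_PiM'[of I X "\<lambda>_. borel"] I X ind by auto
  also have "\<dots> = Pi\<^sub>M I (\<lambda>_. gauss)" by (intro PiM_cong law refl)
  finally have D: "distr M (Pi\<^sub>M I (\<lambda>_. borel)) (\<lambda>\<omega>. \<lambda>i\<in>I. X i \<omega>) = Pi\<^sub>M I (\<lambda>_. gauss)" .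
  have S: "sets (Pi\<^sub>M I (\<lambda>_. gauss)) = sets (Pi\<^sub>M I (\<lambda>_. borel))"
    by (intro sets_PiM_cong) auto
  have XM: "(\<lambda>\<omega>. \<lambda>i\<in>I. X i \<omega>) \<in> measurable M (Pi\<^sub>M I (\<lambda>_. borel))"
    by (intro measurable_restrict X)
  have h': "h \<in> borel_measurable (Pi\<^sub>M I (\<lambda>_. borel))"
    using h by (simp add: measurable_cong_sets[OF S refl])
  show "(\<lambda>\<omega>. h (\<lambda>i\<in>I. X i \<omega>)) \<in> borel_measurable M"
    using measurable_compose[OF XM h'] .
  show "(\<integral>\<^sup>+\<omega>. ennreal (h (\<lambda>i\<in>I. X i \<omega>)) \<partial>M) = (\<integral>\<^sup>+w. ennreal (h w) \<partial>Pi\<^sub>M I (\<lambda>_. gauss))"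
    unfolding D[symmetric] using XM h' by (subst nn_integral_distr) auto
qed

text \<open>The expected sum of the sixth powers is finite, so the sum is almost surely finite and
  its terms tend to 0. No joint law across different N enters.\<close>

lemma AE_tendsto_0_of_summable_moments:
  fixes h :: "nat \<Rightarrow> 'a \<Rightarrow> complex"
  assumes meas: "\<And>N. N \<ge> N0 \<Longrightarrow> (\<lambda>\<omega>. cmod (h N \<omega>) ^ 6) \<in> borel_measurable M"
    and bound: "\<And>N. N \<ge> N0 \<Longrightarrow> (\<integral>\<^sup>+\<omega>. ennreal (cmod (h N \<omega>) ^ 6) \<partial>M) \<le> ennreal (b N)"
    and b: "summable b" "\<And>N. b N \<ge> 0"
  shows "AE \<omega> in M. (\<lambda>N. h N \<omega>) \<longlonglongrightarrow> 0"
proof -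
  let ?h = "\<lambda>N \<omega>. cmod (h (N + N0) \<omega>) ^ 6"
  have "(\<integral>\<^sup>+\<omega>. (\<Sum>N. ennreal (?h N \<omega>)) \<partial>M) = (\<Sum>N. \<integral>\<^sup>+\<omega>. ennreal (?h N \<omega>) \<partial>M)"
    using meas by (intro nn_integral_suminf) auto
  also have "\<dots> \<le> (\<Sum>N. ennreal (b (N + N0)))"
    using bound by (intro suminf_le) auto
  also have "\<dots> < \<infinity>"
    using b summable_ignore_initial_segment[OF b(1), of N0] by (subst suminf_ennreal2) auto
  finally have "(\<integral>\<^sup>+\<omega>. (\<Sum>N. ennreal (?h N \<omega>)) \<partial>M) \<noteq> \<infinity>" by simp
  moreover have "(\<lambda>\<omega>. \<Sum>N. ennreal (?h N \<omega>)) \<in> borel_measurable M"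
    using meas by (intro borel_measurable_suminf_order measurable_compose[OF _ measurable_ennreal]) auto
  ultimately have "AE \<omega> in M. (\<Sum>N. ennreal (?h N \<omega>)) \<noteq> \<infinity>"
    by (intro nn_integral_PInf_AE) auto
  then show ?thesis
  proof eventually_elim
    case (elim \<omega>)
    then have "summable (\<lambda>N. ?h N \<omega>)"
      by (intro summable_suminf_not_top) auto
    then have "(\<lambda>N. ?h N \<omega>) \<longlonglongrightarrow> 0" by (rule summable_LIMSEQ_zero)
    then have "(\<lambda>N. root 6 (?h N \<omega>)) \<longlonglongrightarrow> root 6 0" by (rule tendsto_real_root)
    then have "(\<lambda>N. cmod (h (N + N0) \<omega>)) \<longlonglongrightarrow> 0"
      by (simp add: real_root_power_cancel)
    then have "(\<lambda>N. h (N + N0) \<omega>) \<longlonglongrightarrow> 0" by (rule tendsto_norm_zero_cancel)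
    then show ?case by (rule LIMSEQ_offset)
  qed
qed

text \<open>The two roots have product 1 and sum -z. Since one is the inverse of the other, their
  imaginary parts have opposite signs; they cannot both vanish, because they add up to -Im z. Hence
  exactly one has the sign of Im z.\<close>

lemma semicircle_root_exists:
  assumes "Im z \<noteq> 0"
  shows "\<exists>m. m\<^sup>2 + z * m + 1 = 0 \<and> Im z * Im m > 0"
proof -
  define r where "r = (- z + csqrt (z\<^sup>2 - 4)) / 2"
  have "(csqrt (z\<^sup>2 - 4))\<^sup>2 = z\<^sup>2 - 4" by simp
  moreover have "4 * (r\<^sup>2 + z * r + 1) = (csqrt (z\<^sup>2 - 4))\<^sup>2 - z\<^sup>2 + 4"
    by (simp add: r_def power2_eq_square field_simps)
  ultimately have "4 * (r\<^sup>2 + z * r + 1) = 0" by (simp only:) simp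
  then have r: "r\<^sup>2 + z * r + 1 = 0" by (metis mult_eq_0_iff zero_neq_numeral)
  then have r0: "r \<noteq> 0" by auto
  have "(- z - r) * r = 1 - (r\<^sup>2 + z * r + 1)" by (simp add: power2_eq_square algebra_simps)
  then have "(- z - r) * r = 1" unfolding r by simp
  then have rr: "1 / r = - z - r" using r0 by (simp only: divide_eq_eq if_True) simp
  define r' where "r' = - z - r"
  have r': "r'\<^sup>2 + z * r' + 1 = 0" using r by (simp add: r'_def power2_eq_square algebra_simps)
  have Im1: "Im r' = - Im r / (cmod r)\<^sup>2"
    unfolding r'_def rr[symmetric] by (simp add: Im_divide cmod_power2)
  have "Im z = - Im r - Im r'" by (simp add: r'_def)
  then have Imr: "Im r \<noteq> 0" using assms Im1 by auto
  have pos: "(cmod r)\<^sup>2 > 0" using r0 by simp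
  have "Im z * Im r > 0 \<or> Im z * Im r' > 0"
  proof (cases "Im z * Im r > 0")
    case False
    then have "Im z * Im r < 0" using assms Imr by (metis mult_eq_0_iff not_less_iff_gr_or_eq)
    then have "Im z * Im r' > 0"
      unfolding Im1 using pos by (simp add: divide_less_0_iff)
    then show ?thesis ..
  qed simp
  then show ?thesis using r r' by blast
qed

definition gram_mat :: "nat \<Rightarrow> nat \<Rightarrow> real \<Rightarrow> complex \<Rightarrow> (nat \<Rightarrow> nat \<Rightarrow> real) \<Rightarrow> complex mat" where
  "gram_mat n p s z G =
     shift_mat n (\<lambda>a b. s * ((\<Sum>j<p. G a j * G b j) - (if a = b then real p else 0))) (- z)"

lemma gram_mat_cong:
  assumes "\<And>a j. a < n \<Longrightarrow> j < p \<Longrightarrow> G a j = G' a j"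
  shows "gram_mat n p s z G = gram_mat n p s z G'"
  unfolding gram_mat_def shift_mat_def
  by (rule eq_matI) (auto simp: assms intro!: sum.cong)

lemma gram_resolvent_gauss_minv:
  assumes "0 < n" "n \<le> p" "s = 1 / sqrt (real n * real p)" "Im z \<noteq> 0"
    and "s * (\<Sum>j<p. \<Sum>k<n. (G0 k j)\<^sup>2) \<le> CP"
  shows "gram_resolvent_gauss n p s z G0
     (\<lambda>w a b. minv (gram_mat n p s z (\<lambda>a j. G0 a j + w (a, j))) $$ (a, b)) CP"
proof (unfold_locales)
  fix w :: "nat \<times> nat \<Rightarrow> real" and a b :: nat
  assume ab: "a < n" "b < n"
  let ?G = "\<lambda>a j. G0 a j + w (a, j)"
  let ?q = "\<lambda>a b. minv (gram_mat n p s z ?G) $$ (a, b)"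
  have "(\<Sum>k<n. of_real (s * ((\<Sum>j<p. ?G a j * ?G k j) - (if a = k then real p else 0))) * ?q k b) + (- z) * ?q a b
      = (if a = b then 1 else 0)"
    unfolding gram_mat_def by (rule shift_mat_mult_minv) (use ab assms in \<open>auto simp: mult.commute\<close>)
  moreover have "(\<Sum>k<n. of_real (s * ((\<Sum>j<p. ?G a j * ?G k j) - (if a = k then real p else 0))) * ?q k b) =
      of_real s * ((\<Sum>k<n. \<Sum>j<p. of_real (?G a j) * (of_real (?G k j) * ?q k b)) - of_nat p * ?q a b)"
  proof -
    have "of_real (s * ((\<Sum>j<p. ?G a j * ?G k j) - (if a = k then real p else 0))) * ?q k b =
      of_real s * (\<Sum>j<p. of_real (?G a j) * (of_real (?G k j) * ?q k b))
       - (if a = k then of_real s * (of_nat p * ?q k b) else 0)" for k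
      by (simp add: sum_distrib_left sum_distrib_right algebra_simps)
    then show ?thesis
      using ab by (simp only: sum_subtractf sum_distrib_left[symmetric]) (simp add: right_diff_distrib)
  qed
  moreover have "(\<Sum>k<n. \<Sum>j<p. of_real (?G a j) * (of_real (?G k j) * ?q k b)) =
      (\<Sum>j<p. of_real (?G a j) * (\<Sum>k<n. of_real (?G k j) * ?q k b))"
    unfolding sum_distrib_left by (rule sum.swap)
  ultimately show "of_real s * ((\<Sum>j<p. of_real (?G a j) * (\<Sum>k<n. of_real (?G k j) * ?q k b)) - of_nat p * ?q a b)
      - z * ?q a b = (if a = b then 1 else 0)"
    by simp
next
  fix a b assume ab: "a < n" "b < n"
  have comp: "(\<lambda>w. w (a, j)) \<in> borel_measurable (Pi\<^sub>M ({..<n} \<times> {..<p}) (\<lambda>_. gauss))" if "a < n" "j < p" for a j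
    using measurable_component_singleton[of "(a, j)" "{..<n} \<times> {..<p}" "\<lambda>_. gauss"] that
    by (simp add: measurable_cong_sets[OF refl sets_gauss])
  show "(\<lambda>w. minv (gram_mat n p s z (\<lambda>a j. G0 a j + w (a, j))) $$ (a, b))
      \<in> borel_measurable (Pi\<^sub>M ({..<n} \<times> {..<p}) (\<lambda>_. gauss))"
  proof (rule borel_measurable_minv_entry[OF _ _ _ ab])
    show "det (gram_mat n p s z (\<lambda>a j. G0 a j + w (a, j))) \<noteq> 0" for w
      unfolding gram_mat_def by (rule shift_mat_det) (use assms in \<open>auto simp: mult.commute\<close>)
    fix i j assume ij: "i < n" "j < n"
    then have "(\<lambda>w. gram_mat n p s z (\<lambda>a j. G0 a j + w (a, j)) $$ (i, j)) =
      (\<lambda>w. of_real (s * ((\<Sum>k<p. (G0 i k + w (i, k)) * (G0 j k + w (j, k))) - (if i = j then real p else 0)))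
         + (if i = j then - z else 0))"
      by (simp add: gram_mat_def shift_mat_def fun_eq_iff)
    also have "\<dots> \<in> borel_measurable (Pi\<^sub>M ({..<n} \<times> {..<p}) (\<lambda>_. gauss))"
      using ij by (intro borel_measurable_add borel_measurable_const measurable_compose[OF _ borel_measurable_of_real]
        borel_measurable_times borel_measurable_diff borel_measurable_sum comp) auto
    finally show "(\<lambda>w. gram_mat n p s z (\<lambda>a j. G0 a j + w (a, j)) $$ (i, j))
      \<in> borel_measurable (Pi\<^sub>M ({..<n} \<times> {..<p}) (\<lambda>_. gauss))" .
  qed (simp add: gram_mat_def)
qed (use assms in auto)

lemma (in prob_space) sixth_moment_transfer:
  assumes I: "finite I" "I \<noteq> {}" and ind: "indep_vars (\<lambda>_. borel) X I"
    and dist: "\<And>i. i \<in> I \<Longrightarrow> distributed M lborel (X i) std_normal_density"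
    and h: "h \<in> borel_measurable (Pi\<^sub>M I (\<lambda>_. gauss))"
    and int: "integrable (Pi\<^sub>M I (\<lambda>_. gauss)) (\<lambda>w. cmod (h w) ^ 6)"
    and bound: "(\<integral>w. cmod (h w) ^ 6 \<partial>Pi\<^sub>M I (\<lambda>_. gauss)) \<le> b" "b \<le> b'"
    and eq: "\<And>\<omega>. h (\<lambda>i\<in>I. X i \<omega>) = h' \<omega>"
  shows "(\<lambda>\<omega>. cmod (h' \<omega>) ^ 6) \<in> borel_measurable M"
    and "(\<integral>\<^sup>+\<omega>. ennreal (cmod (h' \<omega>) ^ 6) \<partial>M) \<le> ennreal b'"
proof -
  have m: "(\<lambda>w. cmod (h w) ^ 6) \<in> borel_measurable (Pi\<^sub>M I (\<lambda>_. gauss))"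
    using int by (rule borel_measurable_integrable)
  note law = gauss_vector_law[OF I ind dist m, unfolded eq]
  show "(\<lambda>\<omega>. cmod (h' \<omega>) ^ 6) \<in> borel_measurable M" using law(1) by simp
  have "(\<integral>\<^sup>+\<omega>. ennreal (cmod (h' \<omega>) ^ 6) \<partial>M) = ennreal (\<integral>w. cmod (h w) ^ 6 \<partial>Pi\<^sub>M I (\<lambda>_. gauss))"
    using law(2) int by (subst nn_integral_eq_integral[symmetric]) auto
  also have "\<dots> \<le> ennreal b'" using bound by (intro ennreal_leI) linarith
  finally show "(\<integral>\<^sup>+\<omega>. ennreal (cmod (h' \<omega>) ^ 6) \<partial>M) \<le> ennreal b'" .
qed

text \<open>The exponent is 3 / 2 > 1. At N = 0 both sides of the comparison are 0, by division by
  zero and the value of \<open>0 powr\<close>.\<close>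

lemma summable_inverse_sqrt_cube: "summable (\<lambda>N. C * \<bar>D / sqrt (real N)\<bar> ^ 3)"
proof -
  have "\<bar>D / sqrt (real N)\<bar> ^ 3 = \<bar>D\<bar> ^ 3 * real N powr (- 3 / 2)" for N
  proof (cases "N = 0")
    case False
    have "real N powr (- 3 / 2) = 1 / (real N powr (1 / 2)) ^ 3"
      using False by (simp add: powr_powr powr_minus_divide flip: powr_numeral)
    then show ?thesis by (simp add: powr_half_sqrt power_divide abs_divide)
  qed simp
  moreover have "summable (\<lambda>N. real N powr (- 3 / 2))"
    by (simp add: summable_real_powr_iff)
  ultimately show ?thesis by (simp add: summable_mult)
qed

text \<open>The interface to the tensor model: only dimension estimates at rate D / sqrt N, a
  bounded spike and independent Gaussian entries are retained, each from some N1 on.\<close>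

locale gram_resolvent_sequence = prob_space M for M :: "'a measure" +
  fixes nn pp :: "nat \<Rightarrow> nat" and s :: "nat \<Rightarrow> real" and G0 :: "nat \<Rightarrow> nat \<Rightarrow> nat \<Rightarrow> real"
    and X :: "nat \<Rightarrow> nat \<times> nat \<Rightarrow> 'a \<Rightarrow> real" and CP D :: real and z mz :: complex and N1 :: nat
  assumes z: "Im z \<noteq> 0" and mz: "mz\<^sup>2 + z * mz + 1 = 0" "Im z * Im mz > 0"
    and dims: "\<And>N. N \<ge> N1 \<Longrightarrow> 0 < nn N" "\<And>N. N \<ge> N1 \<Longrightarrow> nn N \<le> pp N"
    and \<delta>: "\<And>N. N \<ge> N1 \<Longrightarrow> 1 / real (nn N) \<le> D / sqrt (real N)"
      "\<And>N. N \<ge> N1 \<Longrightarrow> s N * real (nn N) \<le> D / sqrt (real N)"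
      "\<And>N. N \<ge> N1 \<Longrightarrow> D / sqrt (real N) \<le> 1"
    and s: "\<And>N. N \<ge> N1 \<Longrightarrow> s N = 1 / sqrt (real (nn N) * real (pp N))"
    and CP: "\<And>N. N \<ge> N1 \<Longrightarrow> s N * (\<Sum>j<pp N. \<Sum>k<nn N. (G0 N k j)\<^sup>2) \<le> CP"
    and ind: "\<And>N. N \<ge> N1 \<Longrightarrow> indep_vars (\<lambda>_. borel) (X N) ({..<nn N} \<times> {..<pp N})"
    and dist: "\<And>N i. N \<ge> N1 \<Longrightarrow> i \<in> {..<nn N} \<times> {..<pp N} \<Longrightarrow>
        distributed M lborel (X N i) std_normal_density"
begin

definition Qm :: "nat \<Rightarrow> (nat \<times> nat \<Rightarrow> real) \<Rightarrow> nat \<Rightarrow> nat \<Rightarrow> complex" where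
  "Qm N w a b = minv (gram_mat (nn N) (pp N) (s N) z (\<lambda>a j. G0 N a j + w (a, j))) $$ (a, b)"

definition Qb :: "nat \<Rightarrow> nat \<Rightarrow> nat \<Rightarrow> complex" where
  "Qb N a b = minv (shift_mat (nn N) (\<lambda>a b. s N * (\<Sum>j<pp N. G0 N a j * G0 N b j)) (- (z + mz))) $$ (a, b)"

text \<open>The Gram matrix reads only entries with indices in range, so passing to an extensional
  argument changes nothing.\<close>

lemma Qm_restrict: "Qm N (\<lambda>i\<in>{..<nn N} \<times> {..<pp N}. X N i \<omega>) = Qm N (\<lambda>i. X N i \<omega>)"
  unfolding Qm_def fun_eq_iff
  by (intro allI arg_cong[of _ _ "\<lambda>A. minv A $$ _"] gram_mat_cong) auto

lemma Qm_locale: "N \<ge> N1 \<Longrightarrow> gram_resolvent_gauss (nn N) (pp N) (s N) z (G0 N) (Qm N) CP"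
  unfolding Qm_def by (rule gram_resolvent_gauss_minv) (use dims s CP z in auto)

lemma Qb_eq:
  assumes "a < nn N" "b < nn N"
  shows "(\<Sum>c<nn N. Qb N a c * (of_real (s N * (\<Sum>j<pp N. G0 N c j * G0 N b j)) - (if c = b then z + mz else 0))) =
      (if a = b then 1 else 0)"
proof -
  have "Im (- (z + mz)) \<noteq> 0" using mz(2) by (auto simp: zero_less_mult_iff)
  then have 1: "(\<Sum>c<nn N. Qb N a c * (of_real (s N * (\<Sum>j<pp N. G0 N c j * G0 N b j)) + (if c = b then - (z + mz) else 0))) =
      (if a = b then 1 else 0)"
    unfolding Qb_def by (intro minv_mult_shift_mat) (use assms in \<open>auto simp: mult.commute\<close>)
  have e: "x + (if c = b then - (z + mz) else 0) = x - (if c = b then z + mz else 0)" for x and c :: nat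
    by simp
  show ?thesis using 1 by (simp only: e)
qed

lemma index_set: "N \<ge> N1 \<Longrightarrow> finite ({..<nn N} \<times> {..<pp N})" "N \<ge> N1 \<Longrightarrow> {..<nn N} \<times> {..<pp N} \<noteq> {}"
  using dims[of N] by (auto simp: lessThan_empty_iff)

lemma trace_tendsto:
  "AE \<omega> in M. (\<lambda>N. (\<Sum>k<nn N. Qm N (\<lambda>i. X N i \<omega>) k k) / of_nat (nn N)) \<longlonglongrightarrow> mz"
proof -
  \<comment> \<open>The constant exported from the locale depends on z and \<open>CP\<close> only,
    hence is the same for all N. The absolute values give nonnegativity without a sign
    argument.\<close>
  define b where "b N = \<bar>gram_resolvent_gauss.Cm z CP\<bar> * \<bar>D / sqrt (real N)\<bar> ^ 3" for N
  have "AE \<omega> in M. (\<lambda>N. (\<Sum>k<nn N. Qm N (\<lambda>i. X N i \<omega>) k k) / of_nat (nn N) - mz) \<longlonglongrightarrow> 0"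
  proof (rule AE_tendsto_0_of_summable_moments[where ?N0.0 = N1 and b = b])
    fix N assume N: "N1 \<le> N"
    interpret G: gram_resolvent_gauss "nn N" "pp N" "s N" z "G0 N" "Qm N" CP by (rule Qm_locale[OF N])
    have 1: "(\<lambda>w. G.m w - mz) \<in> borel_measurable G.\<mu>" by (intro borel_measurable_diff G.meas_m) auto
    have 2: "integrable G.\<mu> (\<lambda>w. cmod (G.m w - mz) ^ 6)"
      by (intro G.integrable_cmod_power bdd_fun_intros G.bdd_m 1)
    have 3: "(\<integral>w. cmod (G.m w - mz) ^ 6 \<partial>G.\<mu>) \<le> G.Cm * (D / sqrt (real N)) ^ 3"
      using N by (intro G.m_sixth_moment mz \<delta>)
    have 4: "G.Cm * (D / sqrt (real N)) ^ 3 \<le> b N"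
      unfolding b_def by (metis abs_ge_self abs_mult power_abs)
    have 5: "G.m (\<lambda>i\<in>{..<nn N} \<times> {..<pp N}. X N i \<omega>) - mz =
        (\<Sum>k<nn N. Qm N (\<lambda>i. X N i \<omega>) k k) / of_nat (nn N) - mz" for \<omega>
      by (simp add: G.m_def Qm_restrict)
    note T = sixth_moment_transfer[OF index_set[OF N] ind[OF N] dist[OF N] 1 2 3 4 5]
    show "(\<lambda>\<omega>. cmod ((\<Sum>k<nn N. Qm N (\<lambda>i. X N i \<omega>) k k) / of_nat (nn N) - mz) ^ 6) \<in> borel_measurable M"
      "(\<integral>\<^sup>+\<omega>. ennreal (cmod ((\<Sum>k<nn N. Qm N (\<lambda>i. X N i \<omega>) k k) / of_nat (nn N) - mz) ^ 6) \<partial>M) \<le> ennreal (b N)"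
      using T by blast+
  next
    show "b N \<ge> 0" for N by (simp add: b_def)
  qed (unfold b_def, rule summable_inverse_sqrt_cube)
  then show ?thesis by (rule eventually_mono) (simp add: LIM_zero_iff)
qed

lemma weighted_trace_tendsto:
  assumes A: "\<And>N k. N \<ge> N1 \<Longrightarrow> k < nn N \<Longrightarrow> nrm (nn N) (A N k) \<le> CA"
  shows "AE \<omega> in M. (\<lambda>N. (\<Sum>k<nn N. \<Sum>i<nn N. A N k i * (Qm N (\<lambda>i. X N i \<omega>) i k - Qb N i k)) / of_nat (nn N)) \<longlonglongrightarrow> 0"
proof -
  define b where "b N = \<bar>gram_resolvent_gauss.Cf z CP CA 1\<bar> * \<bar>D / sqrt (real N)\<bar> ^ 3" for N
  show ?thesis
  proof (rule AE_tendsto_0_of_summable_moments[where ?N0.0 = N1 and b = b])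
    fix N assume N: "N1 \<le> N"
    interpret G: gram_resolvent_gauss "nn N" "pp N" "s N" z "G0 N" "Qm N" CP by (rule Qm_locale[OF N])
    let ?h = "\<lambda>w. (\<Sum>k<nn N. G.bil (Qb N) (A N k) (std_basis k) w) / of_nat (nn N)"
    have 1: "?h \<in> borel_measurable G.\<mu>"
      using N by (intro borel_measurable_divide borel_measurable_sum G.meas_bil[where mz = mz and \<delta> = "D / sqrt (real N)"]
        mz Qb_eq \<delta>) auto
    have 2: "integrable G.\<mu> (\<lambda>w. cmod (?h w) ^ 6)"
      using N by (intro G.integrable_cmod_power bdd_fun_intros G.bdd_bil[where mz = mz and \<delta> = "D / sqrt (real N)"]
        1 mz Qb_eq \<delta>) auto
    have 3: "(\<integral>w. cmod (?h w) ^ 6 \<partial>G.\<mu>) \<le> G.Cf CA 1 * (D / sqrt (real N)) ^ 3"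
      using N by (intro G.trace_sixth_moment[where mz = mz] mz Qb_eq \<delta> A)
    have 4: "G.Cf CA 1 * (D / sqrt (real N)) ^ 3 \<le> b N"
      unfolding b_def by (metis abs_ge_self abs_mult power_abs)
    have 5: "?h (\<lambda>i\<in>{..<nn N} \<times> {..<pp N}. X N i \<omega>) =
       (\<Sum>k<nn N. \<Sum>i<nn N. A N k i * (Qm N (\<lambda>i. X N i \<omega>) i k - Qb N i k)) / of_nat (nn N)" for \<omega>
    proof -
      have "G.bil (Qb N) (A N k) (std_basis k) w = (\<Sum>i<nn N. A N k i * (Qm N w i k - Qb N i k))" if "k < nn N" for k w
        using that by (simp add: G.bil_def[OF mz Qb_eq \<delta>[OF N]] std_basis_def if_distrib[of "\<lambda>x. _ * x"] cong: if_cong)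
      then show ?thesis by (simp add: Qm_restrict)
    qed
    note T = sixth_moment_transfer[OF index_set[OF N] ind[OF N] dist[OF N] 1 2 3 4 5]
    show "(\<lambda>\<omega>. cmod ((\<Sum>k<nn N. \<Sum>i<nn N. A N k i * (Qm N (\<lambda>i. X N i \<omega>) i k - Qb N i k)) / of_nat (nn N)) ^ 6) \<in> borel_measurable M"
      "(\<integral>\<^sup>+\<omega>. ennreal (cmod ((\<Sum>k<nn N. \<Sum>i<nn N. A N k i * (Qm N (\<lambda>i. X N i \<omega>) i k - Qb N i k)) / of_nat (nn N)) ^ 6) \<partial>M) \<le> ennreal (b N)"
      using T by blast+
  next
    show "b N \<ge> 0" for N by (simp add: b_def)
  qed (unfold b_def, rule summable_inverse_sqrt_cube)
qed

lemma bilinear_tendsto: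
  assumes A: "\<And>N. N \<ge> N1 \<Longrightarrow> nrm (nn N) (u N) \<le> CA" and B: "\<And>N. N \<ge> N1 \<Longrightarrow> nrm (nn N) (v N) \<le> CB"
  shows "AE \<omega> in M. (\<lambda>N. \<Sum>i<nn N. \<Sum>k<nn N. u N i * (Qm N (\<lambda>i. X N i \<omega>) i k - Qb N i k) * v N k) \<longlonglongrightarrow> 0"
proof -
  define b where "b N = \<bar>gram_resolvent_gauss.Cf z CP CA CB\<bar> * \<bar>D / sqrt (real N)\<bar> ^ 3" for N
  show ?thesis
  proof (rule AE_tendsto_0_of_summable_moments[where ?N0.0 = N1 and b = b])
    fix N assume N: "N1 \<le> N"
    interpret G: gram_resolvent_gauss "nn N" "pp N" "s N" z "G0 N" "Qm N" CP by (rule Qm_locale[OF N])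
    let ?h = "G.bil (Qb N) (u N) (v N)"
    have 1: "?h \<in> borel_measurable G.\<mu>"
      using N by (intro G.meas_bil[where mz = mz and \<delta> = "D / sqrt (real N)"] mz Qb_eq \<delta>)
    have 2: "integrable G.\<mu> (\<lambda>w. cmod (?h w) ^ 6)"
      using N by (intro G.integrable_cmod_power G.bdd_bil[where mz = mz and \<delta> = "D / sqrt (real N)"] 1 mz Qb_eq \<delta>)
    have 3: "(\<integral>w. cmod (?h w) ^ 6 \<partial>G.\<mu>) \<le> G.Cf CA CB * (D / sqrt (real N)) ^ 3"
      using N by (intro G.bil_sixth_moment[where mz = mz] mz Qb_eq \<delta> A B)
    have 4: "G.Cf CA CB * (D / sqrt (real N)) ^ 3 \<le> b N"
      unfolding b_def by (metis abs_ge_self abs_mult power_abs)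
    have 5: "?h (\<lambda>i\<in>{..<nn N} \<times> {..<pp N}. X N i \<omega>) =
       (\<Sum>i<nn N. \<Sum>k<nn N. u N i * (Qm N (\<lambda>i. X N i \<omega>) i k - Qb N i k) * v N k)" for \<omega>
      by (simp add: G.bil_def[OF mz Qb_eq \<delta>[OF N]] Qm_restrict)
    note T = sixth_moment_transfer[OF index_set[OF N] ind[OF N] dist[OF N] 1 2 3 4 5]
    show "(\<lambda>\<omega>. cmod (\<Sum>i<nn N. \<Sum>k<nn N. u N i * (Qm N (\<lambda>i. X N i \<omega>) i k - Qb N i k) * v N k) ^ 6) \<in> borel_measurable M"
      "(\<integral>\<^sup>+\<omega>. ennreal (cmod (\<Sum>i<nn N. \<Sum>k<nn N. u N i * (Qm N (\<lambda>i. X N i \<omega>) i k - Qb N i k) * v N k) ^ 6) \<partial>M) \<le> ennreal (b N)"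
      using T by blast+
  next
    show "b N \<ge> 0" for N by (simp add: b_def)
  qed (unfold b_def, rule summable_inverse_sqrt_cube)
qed

end

section \<open>Unfoldings of tensors\<close>

lemma finite_tidx: "finite (tidx d n)"
proof (rule finite_subset)
  show "tidx d n \<subseteq> {i. \<forall>l. (l \<in> {..<d} \<longrightarrow> i l \<in> {..<Suc (\<Sum>l<d. n l)}) \<and> (l \<notin> {..<d} \<longrightarrow> i l = 0)}"
  proof (intro subsetI CollectI allI conjI impI)
    fix i l assume i: "i \<in> tidx d n" and l: "l \<in> {..<d}"
    then have "i l < n l" by (auto simp: tidx_def)
    also have "n l \<le> (\<Sum>l<d. n l)" using l by (intro member_le_sum) auto
    finally show "i l \<in> {..<Suc (\<Sum>l<d. n l)}" by simp
  qed (auto simp: tidx_def)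
qed (intro finite_set_of_finite_funs; simp)

text \<open>Downward induction from d: the digits at positions at least k determine c modulo the
  product of their radices, and each step adds one more significant digit through
  \<open>mod_mult2_eq\<close>. At k = 0 the modulus exceeds every column index.\<close>

lemma mixed_radix_digits_determine:
  fixes n :: "nat \<Rightarrow> nat"
  assumes "k \<le> d"
    and "\<And>l'. k \<le> l' \<Longrightarrow> l' < d \<Longrightarrow> l' \<noteq> l \<Longrightarrow>
      (c div (\<Prod>l''\<in>{l'<..<d} - {l}. n l'')) mod n l' = (c' div (\<Prod>l''\<in>{l'<..<d} - {l}. n l'')) mod n l'"
  shows "c mod (\<Prod>l''\<in>{k..<d} - {l}. n l'') = c' mod (\<Prod>l''\<in>{k..<d} - {l}. n l'')"
  using assms
proof (induction rule: inc_induct)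
  case (step k)
  have IH: "c mod (\<Prod>l''\<in>{Suc k..<d} - {l}. n l'') = c' mod (\<Prod>l''\<in>{Suc k..<d} - {l}. n l'')"
    by (rule step.IH) (use step.prems in auto)
  have iv: "{k..<d} = insert k {Suc k..<d}" using step.hyps by auto
  show ?case
  proof (cases "k = l")
    case True
    then have "{k..<d} - {l} = {Suc k..<d} - {l}" by (auto simp: iv)
    then show ?thesis using IH by simp
  next
    case False
    let ?W = "\<Prod>l''\<in>{Suc k..<d} - {l}. n l''"
    have "{k..<d} - {l} = insert k ({Suc k..<d} - {l})" using False by (auto simp: iv)
    then have W: "(\<Prod>l''\<in>{k..<d} - {l}. n l'') = ?W * n k" by (simp add: mult.commute)
    have "(c div ?W) mod n k = (c' div ?W) mod n k"
      using step.prems[of k] step.hyps False by (simp add: atLeastSucLessThan_greaterThanLessThan)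
    then show ?thesis unfolding W mod_mult2_eq using IH by simp
  qed
qed simp

text \<open>Ensures that distinct entries of the unfolding are distinct entries of the tensor.
  Independence of the unfolded noise and the bound on the Frobenius norm of the unfolded signal rest
  on this.\<close>

lemma unfold_index_inj:
  assumes l: "l < d"
  shows "inj_on (\<lambda>(a, c). unfold_index d n l a c) ({..<n l} \<times> {..<(\<Prod>l'\<in>{..<d} - {l}. n l')})"
proof (rule inj_onI, clarify)
  fix a c a' c'
  assume c: "c < (\<Prod>l'\<in>{..<d} - {l}. n l')" "c' < (\<Prod>l'\<in>{..<d} - {l}. n l')"
    and eq: "unfold_index d n l a c = unfold_index d n l a' c'"
  have "a = a'" using fun_cong[OF eq, of l] by (simp add: unfold_index_def)
  have "c mod (\<Prod>l''\<in>{0..<d} - {l}. n l'') = c' mod (\<Prod>l''\<in>{0..<d} - {l}. n l'')"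
  proof (rule mixed_radix_digits_determine)
    fix l' assume "l' < d" "l' \<noteq> l"
    then show "(c div (\<Prod>l''\<in>{l'<..<d} - {l}. n l'')) mod n l' = (c' div (\<Prod>l''\<in>{l'<..<d} - {l}. n l'')) mod n l'"
      using fun_cong[OF eq, of l'] by (simp add: unfold_index_def)
  qed simp
  then show "a = a' \<and> c = c'" using c \<open>a = a'\<close> by (simp add: atLeast0LessThan)
qed

lemma unfold_index_in_tidx:
  assumes "l < d" "a < n l" "\<And>l'. l' < d \<Longrightarrow> 0 < n l'"
  shows "unfold_index d n l a c \<in> tidx d n"
  using assms by (auto simp: tidx_def unfold_index_def)

text \<open>Rescaling to G = sqrt N T gives the noise unit variance: T T^T and \<mu> both acquire a
  factor 1 / N, which joins 1 / \<sigma> to form s.\<close>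

lemma scaled_gram_eq_gram_mat:
  assumes T: "T \<in> carrier_mat n p" and TG: "\<And>a j. a < n \<Longrightarrow> j < p \<Longrightarrow> T $$ (a, j) = G a j / sqrt N"
    and N: "N > 0" and s: "s = 1 / (\<sigma> * N)" and \<mu>: "\<mu> = real p / N"
  shows "cmat ((1 / \<sigma>) \<cdot>\<^sub>m (T * transpose_mat T - \<mu> \<cdot>\<^sub>m 1\<^sub>m n)) - z \<cdot>\<^sub>m 1\<^sub>m n = gram_mat n p s z G"
proof (rule eq_matI)
  fix a b assume "a < dim_row (gram_mat n p s z G)" "b < dim_col (gram_mat n p s z G)"
  then have ab: "a < n" "b < n" by (auto simp: gram_mat_def shift_mat_def)
  have dims: "dim_row T = n" "dim_col T = p" using T by auto
  have "(T * transpose_mat T) $$ (a, b) = (\<Sum>j<p. T $$ (a, j) * T $$ (b, j))"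
    using ab dims by (simp add: scalar_prod_def atLeast0LessThan)
  also have "\<dots> = (\<Sum>j<p. G a j * G b j) / N"
    using ab N by (simp add: TG sum_divide_distrib)
  finally have TT: "(T * transpose_mat T) $$ (a, b) = (\<Sum>j<p. G a j * G b j) / N" .
  have e: "(1 / \<sigma>) * ((\<Sum>j<p. G a j * G b j) / N - \<mu> * (if a = b then 1 else 0)) =
      s * ((\<Sum>j<p. G a j * G b j) - (if a = b then real p else 0))"
    using N unfolding s \<mu> by (simp add: field_simps)
  have 1: "(cmat ((1 / \<sigma>) \<cdot>\<^sub>m (T * transpose_mat T - \<mu> \<cdot>\<^sub>m 1\<^sub>m n)) - z \<cdot>\<^sub>m 1\<^sub>m n) $$ (a, b) =
      of_real ((1 / \<sigma>) * ((T * transpose_mat T) $$ (a, b) - \<mu> * (if a = b then 1 else 0))) - z * (if a = b then 1 else 0)"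
    using ab dims by (simp add: cmat_def del: index_mult_mat(1))
  have 2: "gram_mat n p s z G $$ (a, b) =
      of_real (s * ((\<Sum>j<p. G a j * G b j) - (if a = b then real p else 0))) + (if a = b then - z else 0)"
    using ab by (simp add: gram_mat_def shift_mat_def)
  show "(cmat ((1 / \<sigma>) \<cdot>\<^sub>m (T * transpose_mat T - \<mu> \<cdot>\<^sub>m 1\<^sub>m n)) - z \<cdot>\<^sub>m 1\<^sub>m n) $$ (a, b) = gram_mat n p s z G $$ (a, b)"
    unfolding 1 2 TT e by simp
qed (use T in \<open>auto simp: cmat_def gram_mat_def shift_mat_def\<close>)

lemma scaled_spike_eq_shift_mat:
  assumes T: "T \<in> carrier_mat n p" and TG: "\<And>a j. a < n \<Longrightarrow> j < p \<Longrightarrow> T $$ (a, j) = G a j / sqrt N"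
    and N: "N > 0" and s: "s = 1 / (\<sigma> * N)"
  shows "cmat ((1 / \<sigma>) \<cdot>\<^sub>m (T * transpose_mat T)) + c \<cdot>\<^sub>m 1\<^sub>m n = shift_mat n (\<lambda>a b. s * (\<Sum>j<p. G a j * G b j)) c"
proof (rule eq_matI)
  fix a b assume "a < dim_row (shift_mat n (\<lambda>a b. s * (\<Sum>j<p. G a j * G b j)) c)"
    "b < dim_col (shift_mat n (\<lambda>a b. s * (\<Sum>j<p. G a j * G b j)) c)"
  then have ab: "a < n" "b < n" by (auto simp: shift_mat_def)
  have dims: "dim_row T = n" "dim_col T = p" using T by auto
  have "(T * transpose_mat T) $$ (a, b) = (\<Sum>j<p. T $$ (a, j) * T $$ (b, j))"
    using ab dims by (simp add: scalar_prod_def atLeast0LessThan)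
  also have "\<dots> = (\<Sum>j<p. G a j * G b j) / N"
    using ab N by (simp add: TG sum_divide_distrib)
  finally have TT: "(T * transpose_mat T) $$ (a, b) = (\<Sum>j<p. G a j * G b j) / N" .
  have e: "(1 / \<sigma>) * ((\<Sum>j<p. G a j * G b j) / N) = s * (\<Sum>j<p. G a j * G b j)"
    unfolding s by simp
  have 1: "(cmat ((1 / \<sigma>) \<cdot>\<^sub>m (T * transpose_mat T)) + c \<cdot>\<^sub>m 1\<^sub>m n) $$ (a, b) =
      of_real ((1 / \<sigma>) * (T * transpose_mat T) $$ (a, b)) + c * (if a = b then 1 else 0)"
    using ab dims by (simp add: cmat_def del: index_mult_mat(1))
  have 2: "shift_mat n (\<lambda>a b. s * (\<Sum>j<p. G a j * G b j)) c $$ (a, b) =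
      of_real (s * (\<Sum>j<p. G a j * G b j)) + (if a = b then c else 0)"
    using ab by (simp add: shift_mat_def)
  show "(cmat ((1 / \<sigma>) \<cdot>\<^sub>m (T * transpose_mat T)) + c \<cdot>\<^sub>m 1\<^sub>m n) $$ (a, b) =
      shift_mat n (\<lambda>a b. s * (\<Sum>j<p. G a j * G b j)) c $$ (a, b)"
    unfolding 1 2 TT e by simp
qed (use T in \<open>auto simp: cmat_def shift_mat_def\<close>)

section \<open>Norms of the test vectors and test matrices\<close>

lemma nrm_cvec: "v \<in> carrier_vec n \<Longrightarrow> nrm n (\<lambda>i. cvec v $ i) = vnorm v"
  by (auto simp: nrm_def vnorm_def L2_set_def cvec_def intro!: sum.cong)

text \<open>The Frobenius bound. It shows that the set in \<open>spec_norm\<close> is bounded above,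
  without which its \<open>Sup\<close> would carry no information.\<close>

lemma vnorm_mult_mat_vec_le:
  assumes A: "A \<in> carrier_mat n n" and v: "v \<in> carrier_vec n"
  shows "vnorm (A *\<^sub>v v) \<le> sqrt (\<Sum>i<n. \<Sum>j<n. (A $$ (i, j))\<^sup>2) * vnorm v"
proof -
  have "(\<Sum>i<n. ((A *\<^sub>v v) $ i)\<^sup>2) \<le> (\<Sum>i<n. (\<Sum>j<n. (A $$ (i, j))\<^sup>2) * (\<Sum>j<n. (v $ j)\<^sup>2))"
  proof (intro sum_mono)
    fix i assume "i \<in> {..<n}"
    then have "(A *\<^sub>v v) $ i = (\<Sum>j<n. A $$ (i, j) * v $ j)"
      using A v by (simp add: scalar_prod_def atLeast0LessThan)
    then show "((A *\<^sub>v v) $ i)\<^sup>2 \<le> (\<Sum>j<n. (A $$ (i, j))\<^sup>2) * (\<Sum>j<n. (v $ j)\<^sup>2)"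
      using Cauchy_Schwarz_ineq_sum[of "\<lambda>j. A $$ (i, j)" "\<lambda>j. v $ j" "{..<n}"] by simp
  qed
  then show ?thesis
    using A v unfolding vnorm_def
    by (simp add: sum_distrib_right[symmetric] flip: real_sqrt_mult)
qed

text \<open>Apply A to the normalised row k: coordinate k of the result is the norm of that row. A
  zero row is treated apart.\<close>

lemma nrm_row_le_spec_norm:
  assumes A: "A \<in> carrier_mat n n" and C: "spec_norm A \<le> C" and k: "k < n"
  shows "nrm n (\<lambda>i. complex_of_real (A $$ (k, i))) \<le> C"
proof -
  let ?S = "{vnorm (A *\<^sub>v v) | v. v \<in> carrier_vec (dim_col A) \<and> vnorm v \<le> 1}"
  have vn: "vnorm v \<ge> 0" for v by (simp add: vnorm_def sum_nonneg)
  have "bdd_above ?S"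
  proof (rule bdd_aboveI)
    fix y assume "y \<in> ?S"
    then obtain v where v: "v \<in> carrier_vec n" "vnorm v \<le> 1" "y = vnorm (A *\<^sub>v v)" using A by auto
    have "y \<le> sqrt (\<Sum>i<n. \<Sum>j<n. (A $$ (i, j))\<^sup>2) * vnorm v"
      unfolding v(3) by (rule vnorm_mult_mat_vec_le[OF A v(1)])
    also have "\<dots> \<le> sqrt (\<Sum>i<n. \<Sum>j<n. (A $$ (i, j))\<^sup>2) * 1"
      by (rule mult_left_mono[OF v(2)]) (simp add: sum_nonneg)
    finally show "y \<le> sqrt (\<Sum>i<n. \<Sum>j<n. (A $$ (i, j))\<^sup>2)" by simp
  qed
  have up: "vnorm (A *\<^sub>v v) \<le> C" if "v \<in> carrier_vec n" "vnorm v \<le> 1" for v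
  proof -
    have "vnorm (A *\<^sub>v v) \<in> ?S" using that A by auto
    then have "vnorm (A *\<^sub>v v) \<le> spec_norm A"
      unfolding spec_norm_def using \<open>bdd_above ?S\<close> by (rule cSup_upper)
    then show ?thesis using C by simp
  qed
  define r where "r = vnorm (row A k)"
  have r_eq: "r = nrm n (\<lambda>i. complex_of_real (A $$ (k, i)))"
    using A k by (auto simp: r_def vnorm_def nrm_def L2_set_def intro!: sum.cong)
  show ?thesis
  proof (cases "r = 0")
    case True
    have "0 \<le> vnorm (A *\<^sub>v 0\<^sub>v n)" by (rule vn)
    also have "\<dots> \<le> C" by (rule up) (auto simp: vnorm_def)
    finally show ?thesis using True r_eq by simp
  next
    case False
    then have r: "r > 0" using vn[of "row A k"] by (simp add: r_def)
    define v where "v = (1 / r) \<cdot>\<^sub>v row A k"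
    have r2: "(\<Sum>i<n. (A $$ (k, i))\<^sup>2) = r\<^sup>2"
      using A k by (simp add: r_def vnorm_def sum_nonneg)
    have v: "v \<in> carrier_vec n" using A by (auto simp: v_def)
    have "(\<Sum>i<n. (v $ i)\<^sup>2) = (\<Sum>i<n. (A $$ (k, i))\<^sup>2) / r\<^sup>2"
      using A k by (simp add: v_def power_divide sum_divide_distrib)
    then have "vnorm v = 1" using v r r2 by (simp add: vnorm_def)
    then have "vnorm (A *\<^sub>v v) \<le> C" using up v by simp
    moreover have "\<bar>(A *\<^sub>v v) $ k\<bar> \<le> vnorm (A *\<^sub>v v)"
      unfolding vnorm_def using A k
      by (intro real_le_rsqrt) (auto intro!: member_le_sum)
    moreover have "(A *\<^sub>v v) $ k = (\<Sum>i<n. (A $$ (k, i))\<^sup>2) / r"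
      using A k by (simp add: v_def scalar_prod_def atLeast0LessThan power2_eq_square sum_divide_distrib)
    ultimately show ?thesis using r r2 r_eq by (simp add: power2_eq_square)
  qed
qed

text \<open>A finite subfamily over J is carried to the image of J, where independence is known;
  injectivity keeps the product of probabilities intact.\<close>

lemma (in prob_space) indep_vars_inj_reindex:
  assumes inj: "inj_on e I" and sub: "e ` I \<subseteq> K" and ind: "indep_vars (\<lambda>_. N) X K"
  shows "indep_vars (\<lambda>_. N) (\<lambda>i. X (e i)) I"
proof -
  have ind': "indep_vars (\<lambda>_. N) X (e ` I)" using ind sub by (rule indep_vars_subset)
  let ?F = "\<lambda>k. {X k -` A \<inter> space M |A. A \<in> sets N}"
  have "indep_sets (\<lambda>i. ?F (e i)) I"
  proof (rule indep_setsI)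
    show "?F (e i) \<subseteq> events" if "i \<in> I" for i
      using ind' that unfolding indep_vars_def2 by (auto intro!: measurable_sets)
    fix A J assume J: "J \<noteq> {}" "J \<subseteq> I" "finite J" and A: "\<forall>j\<in>J. A j \<in> ?F (e j)"
    have injJ: "inj_on e J" using inj J by (rule_tac inj_on_subset)
    define A' where "A' x = A (the_inv_into J e x)" for x
    have A'e: "A' (e j) = A j" if "j \<in> J" for j
      using that injJ by (simp add: A'_def the_inv_into_f_f)
    have "prob (\<Inter>x\<in>e ` J. A' x) = (\<Prod>x\<in>e ` J. prob (A' x))"
    proof (rule indep_setsD)
      show "indep_sets ?F (e ` I)" using ind' unfolding indep_vars_def2 by simp
      show "\<forall>x\<in>e ` J. A' x \<in> ?F x"
      proof
        fix x assume "x \<in> e ` J"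
        then obtain j where "j \<in> J" "x = e j" by auto
        then show "A' x \<in> ?F x" using A A'e by simp
      qed
    qed (use J in auto)
    then show "prob (\<Inter>j\<in>J. A j) = (\<Prod>j\<in>J. prob (A j))"
      by (simp add: prod.reindex[OF injJ] A'e)
  qed
  then show ?thesis
    using ind' unfolding indep_vars_def2 by auto
qed

theorem theorem1:
  fixes M :: "'w measure"
    and d :: nat and c :: "nat \<Rightarrow> real" and r :: "nat \<Rightarrow> nat"
    and n :: "nat \<Rightarrow> nat \<Rightarrow> nat"  \<comment> \<open>n N l = n_l at parameter N\<close>
    and H :: "nat \<Rightarrow> (nat \<Rightarrow> nat) \<Rightarrow> real"
    and X :: "nat \<Rightarrow> nat \<Rightarrow> real mat"  \<comment> \<open>X N l = X^(l), n_l x r_l\<close>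
    and P :: "nat \<Rightarrow> (nat \<Rightarrow> nat) \<Rightarrow> real"
    and Noise :: "nat \<Rightarrow> 'w \<Rightarrow> (nat \<Rightarrow> nat) \<Rightarrow> real"
  assumes M: "prob_space M"
    and d: "d \<ge> 3"
    and c: "\<forall>l<d. c l > 0"
    and dims: "\<exists>N0. \<forall>N\<ge>N0. \<forall>l<d. real (n N l) = c l * real N"
    and r: "\<forall>l<d. r l \<ge> 1"
    and X_dim: "\<forall>N. \<forall>l<d. X N l \<in> carrier_mat (n N l) (r l)"
    and X_orth: "\<forall>N. \<forall>l<d. transpose_mat (X N l) * X N l = 1\<^sub>m (r l)"
    and P_def: "\<forall>N. \<forall>i\<in>tidx d (n N). P N i =
                  (\<Sum>q\<in>tidx d r. H N q * (\<Prod>l<d. X N l $$ (i l, q l)))"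
    and noise_meas: "\<forall>N. \<forall>i\<in>tidx d (n N). (\<lambda>\<omega>. Noise N \<omega> i) \<in> borel_measurable M"
    and noise_indep: "\<forall>N. prob_space.indep_vars M (\<lambda>_. borel) (\<lambda>i \<omega>. Noise N \<omega> i) (tidx d (n N))"
    and noise_gauss: "\<forall>N. \<forall>i\<in>tidx d (n N). distributed M lborel (\<lambda>\<omega>. Noise N \<omega> i) std_normal_density"
    and P_bounded: "\<exists>C. \<forall>\<^sub>F N in sequentially.
          (\<Sum>i\<in>tidx d (n N). (P N i)\<^sup>2) / ((1 / real N) * sqrt (\<Prod>l<d. real (n N l))) \<le> C"
  shows "\<exists>m :: complex \<Rightarrow> complex. \<forall>z. Im z \<noteq> 0 \<longrightarrow>
     m z ^ 2 + z * m z + 1 = 0 \<and> Im z * Im (m z) > 0 \<and>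
     (\<forall>l<d.
       (let \<sigma> = (\<lambda>N. (1 / real N) * sqrt (\<Prod>l'<d. real (n N l')));
            \<mu> = (\<lambda>N. (1 / real N) * (\<Prod>l'\<in>{..<d} - {l}. real (n N l')));
            T = (\<lambda>N \<omega> i. P N i + Noise N \<omega> i / sqrt (real N));
            TT = (\<lambda>N \<omega>. mode_unfold d (n N) l (T N \<omega>) * transpose_mat (mode_unfold d (n N) l (T N \<omega>)));
            PP = (\<lambda>N. mode_unfold d (n N) l (P N) * transpose_mat (mode_unfold d (n N) l (P N)));
            Qt = (\<lambda>N \<omega>. minv (cmat ((1 / \<sigma> N) \<cdot>\<^sub>m (TT N \<omega> - \<mu> N \<cdot>\<^sub>m 1\<^sub>m (n N l)))
                                 - z \<cdot>\<^sub>m 1\<^sub>m (n N l)));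
            Qb = (\<lambda>N. minv (cmat ((1 / \<sigma> N) \<cdot>\<^sub>m PP N) + (1 / m z) \<cdot>\<^sub>m 1\<^sub>m (n N l)))
        in (AE \<omega> in M. (\<lambda>N. mtrace (Qt N \<omega>) / of_nat (n N l)) \<longlonglongrightarrow> m z)
           \<and> det_equiv M (\<lambda>N. n N l) Qt Qb))"
proof -
  interpret prob_space M by (rule M)
  \<comment> \<open>Chosen before any mode is fixed, which is why the limit does not depend on the
    mode.\<close>
  obtain m :: "complex \<Rightarrow> complex" where m: "\<And>z. Im z \<noteq> 0 \<Longrightarrow> (m z)\<^sup>2 + z * m z + 1 = 0 \<and> Im z * Im (m z) > 0"
    using semicircle_root_exists by metis
  obtain N0 where N0: "\<And>N l. N \<ge> N0 \<Longrightarrow> l < d \<Longrightarrow> real (n N l) = c l * real N"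
    using dims by blast
  obtain CP N2 where CP: "\<And>N. N \<ge> N2 \<Longrightarrow>
      (\<Sum>i\<in>tidx d (n N). (P N i)\<^sup>2) / ((1 / real N) * sqrt (\<Prod>l<d. real (n N l))) \<le> CP"
    using P_bounded unfolding eventually_sequentially by blast
  have main: "(let \<sigma> = (\<lambda>N. (1 / real N) * sqrt (\<Prod>l'<d. real (n N l')));
            \<mu> = (\<lambda>N. (1 / real N) * (\<Prod>l'\<in>{..<d} - {l}. real (n N l')));
            T = (\<lambda>N \<omega> i. P N i + Noise N \<omega> i / sqrt (real N));
            TT = (\<lambda>N \<omega>. mode_unfold d (n N) l (T N \<omega>) * transpose_mat (mode_unfold d (n N) l (T N \<omega>)));
            PP = (\<lambda>N. mode_unfold d (n N) l (P N) * transpose_mat (mode_unfold d (n N) l (P N)));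
            Qt = (\<lambda>N \<omega>. minv (cmat ((1 / \<sigma> N) \<cdot>\<^sub>m (TT N \<omega> - \<mu> N \<cdot>\<^sub>m 1\<^sub>m (n N l)))
                                 - z \<cdot>\<^sub>m 1\<^sub>m (n N l)));
            Qb = (\<lambda>N. minv (cmat ((1 / \<sigma> N) \<cdot>\<^sub>m PP N) + (1 / m z) \<cdot>\<^sub>m 1\<^sub>m (n N l)))
        in (AE \<omega> in M. (\<lambda>N. mtrace (Qt N \<omega>) / of_nat (n N l)) \<longlonglongrightarrow> m z)
           \<and> det_equiv M (\<lambda>N. n N l) Qt Qb)"
    if z: "Im z \<noteq> 0" and l: "l < d" for z l
  proof -
    define \<sigma> where "\<sigma> N = (1 / real N) * sqrt (\<Prod>l'<d. real (n N l'))" for N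
    define \<mu> where "\<mu> N = (1 / real N) * (\<Prod>l'\<in>{..<d} - {l}. real (n N l'))" for N
    define Tm where "Tm N \<omega> = mode_unfold d (n N) l (\<lambda>i. P N i + Noise N \<omega> i / sqrt (real N))" for N \<omega>
    define Pm where "Pm N = mode_unfold d (n N) l (P N)" for N
    define Qt where "Qt N \<omega> = minv (cmat ((1 / \<sigma> N) \<cdot>\<^sub>m (Tm N \<omega> * transpose_mat (Tm N \<omega>) - \<mu> N \<cdot>\<^sub>m 1\<^sub>m (n N l)))
                                 - z \<cdot>\<^sub>m 1\<^sub>m (n N l))" for N \<omega>
    define Qbar where "Qbar N = minv (cmat ((1 / \<sigma> N) \<cdot>\<^sub>m (Pm N * transpose_mat (Pm N))) + (1 / m z) \<cdot>\<^sub>m 1\<^sub>m (n N l))" for N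
    define nn where "nn N = n N l" for N
    define pp where "pp N = (\<Prod>l'\<in>{..<d} - {l}. n N l')" for N
    define s where "s N = 1 / sqrt (real (nn N) * real (pp N))" for N
    define ui where "ui N a j = unfold_index d (n N) l a j" for N a j
    define G0 where "G0 N a j = sqrt (real N) * P N (ui N a j)" for N a j
    \<comment> \<open>From here \<open>X\<close> denotes the unfolded noise and hides the factor
      matrices of the statement.\<close>
    define X where "X N i \<omega> = Noise N \<omega> (ui N (fst i) (snd i))" for N i \<omega>
    define c' where "c' = (\<Prod>l'\<in>{..<d} - {l}. c l')"
    \<comment> \<open>The first entry serves 1 / n \<le> D / sqrt N, the second s n = sqrt (n / p)
      \<le> D / sqrt N. In \<open>N1\<close>, the bound D^2 makes D / sqrt N at most 1, and the
      entry 1 excludes N = 0.\<close>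
    define D where "D = max (1 / c l) (sqrt (c l / c'))"
    define N1 where "N1 = max (max N0 N2) (max 1 (nat \<lceil>D\<^sup>2\<rceil>))"
    have cl: "c l > 0" and c': "c' > 0" using c l by (auto simp: c'_def intro!: prod_pos)
    have Dpos: "D > 0" unfolding D_def using cl by (simp add: less_max_iff_disj)
    have N1: "N \<ge> N0" "N \<ge> N2" "N > 0" "real N \<ge> D\<^sup>2" if "N \<ge> N1" for N
      using that unfolding N1_def by (auto simp: nat_le_iff ceiling_le_iff)
    have npos: "0 < n N l'" if "N \<ge> N1" "l' < d" for N l'
    proof -
      have "real (n N l') > 0" using N0[OF N1(1)[OF that(1)] that(2)] c that N1(3)[OF that(1)] by simp
      then show ?thesis by simp
    qed
    have nn: "real (nn N) = c l * real N" if "N \<ge> N1" for N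
      unfolding nn_def using N0[OF N1(1)[OF that] l] .
    have pp: "real (pp N) = c' * real N ^ (d - 1)" if "N \<ge> N1" for N
    proof -
      have "real (pp N) = (\<Prod>l'\<in>{..<d} - {l}. c l' * real N)"
        unfolding pp_def of_nat_prod by (intro prod.cong refl) (use N0[OF N1(1)[OF that]] in auto)
      then show ?thesis using l by (simp add: prod.distrib c'_def)
    qed
    have nnpos: "0 < nn N" and pppos: "0 < pp N" if "N \<ge> N1" for N
      using npos[OF that] l by (auto simp: nn_def pp_def)
    have ratio: "real (nn N) / real (pp N) \<le> (D / sqrt (real N))\<^sup>2" if "N \<ge> N1" for N
    proof -
      have Np: "real N \<ge> 1" "real N > 0" using N1(3)[OF that] by auto
      \<comment> \<open>Here d \<ge> 3 enters: p grows at least like N^2, so n / p is of order at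
        most 1 / N.\<close>
      have "real N ^ 2 \<le> real N ^ (d - 1)" using Np d by (intro power_increasing) auto
      then have "real (nn N) / real (pp N) \<le> (c l * real N) / (c' * real N ^ 2)"
        unfolding nn[OF that] pp[OF that] using cl c' Np by (intro divide_left_mono mult_left_mono mult_pos_pos) auto
      also have "\<dots> = (sqrt (c l / c'))\<^sup>2 / real N" using cl c' Np by (simp add: power2_eq_square)
      also have "\<dots> \<le> D\<^sup>2 / real N" 
        unfolding D_def using cl c' by (intro divide_right_mono power_mono) auto
      finally show ?thesis by (simp add: power_divide)
    qed
    have d3: "D / sqrt (real N) \<le> 1" if "N \<ge> N1" for N
      using N1(3,4)[OF that] Dpos real_le_rsqrt[of D "real N"] by (simp add: divide_le_eq)
    have d1: "1 / real (nn N) \<le> D / sqrt (real N)" if "N \<ge> N1" for N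
    proof -
      have Np: "real N \<ge> 1" using N1(3)[OF that] by auto
      have "sqrt (real N) \<le> real N" using Np by (simp add: real_sqrt_le_iff' real_le_lsqrt power2_eq_square)
      then have "1 / real (nn N) \<le> (1 / c l) / sqrt (real N)"
        unfolding nn[OF that] using cl Np by (simp add: divide_simps)
      also have "\<dots> \<le> D / sqrt (real N)" unfolding D_def by (intro divide_right_mono) auto
      finally show ?thesis .
    qed
    have d2: "s N * real (nn N) \<le> D / sqrt (real N)" if "N \<ge> N1" for N
    proof -
      have "s N * real (nn N) = sqrt (real (nn N) / real (pp N))"
        using nnpos[OF that] pppos[OF that]
        by (simp add: s_def real_sqrt_mult real_sqrt_divide field_simps)
      also have "\<dots> \<le> sqrt ((D / sqrt (real N))\<^sup>2)" using ratio[OF that] by (rule real_sqrt_le_mono)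
      finally show ?thesis using Dpos by simp
    qed
    have np: "nn N \<le> pp N" if "N \<ge> N1" for N
    proof -
      have "real (nn N) / real (pp N) \<le> 1 ^ 2"
        using ratio[OF that] d3[OF that] Dpos by (meson divide_nonneg_nonneg less_imp_le order_trans power_mono real_sqrt_ge_zero of_nat_0_le_iff)
      then show ?thesis using pppos[OF that] by (simp add: divide_le_eq)
    qed
    have prod_n: "(\<Prod>l'<d. real (n N l')) = real (nn N) * real (pp N)" for N
      using l by (subst prod.remove[of "{..<d}" l]) (auto simp: nn_def pp_def)
    have s\<sigma>: "s N = 1 / (\<sigma> N * real N)" if "N \<ge> N1" for N
      using N1(3)[OF that] by (simp add: s_def \<sigma>_def prod_n)
    have inj: "inj_on (\<lambda>(a, j). ui N a j) ({..<nn N} \<times> {..<pp N})" for N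
      unfolding ui_def nn_def pp_def by (rule unfold_index_inj[OF l])
    have ui_in: "ui N a j \<in> tidx d (n N)" if "N \<ge> N1" "a < nn N" for N a j
      unfolding ui_def using that npos l by (intro unfold_index_in_tidx) (auto simp: nn_def)
    \<comment> \<open>Since s N times N is 1 / \<sigma>_N, this is the assumed bound on the signal,
      transported to the unfolding by injectivity of the index map.\<close>
    have CP': "s N * (\<Sum>j<pp N. \<Sum>k<nn N. (G0 N k j)\<^sup>2) \<le> CP" if N: "N \<ge> N1" for N
    proof -
      have "(\<Sum>j<pp N. \<Sum>k<nn N. (P N (ui N k j))\<^sup>2) = (\<Sum>k<nn N. \<Sum>j<pp N. (P N (ui N k j))\<^sup>2)"
        by (rule sum.swap)
      also have "\<dots> = (\<Sum>i\<in>{..<nn N} \<times> {..<pp N}. (P N ((\<lambda>(a, j). ui N a j) i))\<^sup>2)"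
        by (simp add: sum.cartesian_product case_prod_beta)
      also have "\<dots> = (\<Sum>i\<in>(\<lambda>(a, j). ui N a j) ` ({..<nn N} \<times> {..<pp N}). (P N i)\<^sup>2)"
        by (simp add: sum.reindex[OF inj])
      also have "\<dots> \<le> (\<Sum>i\<in>tidx d (n N). (P N i)\<^sup>2)"
        using ui_in[OF N] by (intro sum_mono2 finite_tidx) auto
      finally have le: "(\<Sum>j<pp N. \<Sum>k<nn N. (P N (ui N k j))\<^sup>2) \<le> (\<Sum>i\<in>tidx d (n N). (P N i)\<^sup>2)" .
      have spos: "s N * real N > 0" using nnpos[OF N] pppos[OF N] N1(3)[OF N] by (simp add: s_def)
      have "s N * (\<Sum>j<pp N. \<Sum>k<nn N. (G0 N k j)\<^sup>2) = s N * real N * (\<Sum>j<pp N. \<Sum>k<nn N. (P N (ui N k j))\<^sup>2)"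
        by (simp add: G0_def power_mult_distrib sum_distrib_left mult.assoc)
      also have "\<dots> \<le> s N * real N * (\<Sum>i\<in>tidx d (n N). (P N i)\<^sup>2)"
        using le spos by (intro mult_left_mono) auto
      also have "\<dots> = (\<Sum>i\<in>tidx d (n N). (P N i)\<^sup>2) / ((1 / real N) * sqrt (\<Prod>l<d. real (n N l)))"
        unfolding prod_n s_def by simp
      also have "\<dots> \<le> CP" by (rule CP[OF N1(2)[OF N]])
      finally show ?thesis .
    qed
    have ind: "indep_vars (\<lambda>_. borel) (X N) ({..<nn N} \<times> {..<pp N})" if N: "N \<ge> N1" for N
    proof -
      have "indep_vars (\<lambda>_. borel) (\<lambda>i \<omega>. Noise N \<omega> ((\<lambda>(a, j). ui N a j) i)) ({..<nn N} \<times> {..<pp N})"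
        by (rule indep_vars_inj_reindex[OF inj _ noise_indep[rule_format]]) (use ui_in[OF N] in auto)
      then show ?thesis by (simp add: X_def[abs_def] case_prod_beta')
    qed
    have dist: "distributed M lborel (X N i) std_normal_density" if "N \<ge> N1" "i \<in> {..<nn N} \<times> {..<pp N}" for N i
      unfolding X_def using noise_gauss ui_in[OF that(1)] that(2) by auto
    interpret S: gram_resolvent_sequence M nn pp s G0 X CP D z "m z" N1
      by unfold_locales (use z m nnpos np d1 d2 d3 s_def CP' ind dist in auto)
    have Tcar: "Tm N \<omega> \<in> carrier_mat (nn N) (pp N)" "Pm N \<in> carrier_mat (nn N) (pp N)" for N \<omega>
      by (auto simp: Tm_def Pm_def mode_unfold_def nn_def pp_def)
    have Qt: "Qt N \<omega> = minv (gram_mat (nn N) (pp N) (s N) z (\<lambda>a j. G0 N a j + X N (a, j) \<omega>))" if N: "N \<ge> N1" for N \<omega>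
      unfolding Qt_def nn_def[symmetric]
    proof (rule arg_cong[of _ _ minv], rule scaled_gram_eq_gram_mat[OF Tcar(1) _ _ s\<sigma>[OF N]])
      fix a j assume "a < nn N" "j < pp N"
      then show "Tm N \<omega> $$ (a, j) = (G0 N a j + X N (a, j) \<omega>) / sqrt (real N)"
        using N1(3)[OF N] by (simp add: Tm_def mode_unfold_def nn_def pp_def G0_def X_def ui_def add_divide_distrib)
    qed (use N1(3)[OF N] in \<open>auto simp: \<mu>_def pp_def\<close>)
    \<comment> \<open>The quadratic equation divided by m; it gives the stated equivalent the same
      shift -(z + m) as \<open>S.Qb\<close>.\<close>
    have mz: "1 / m z = - (z + m z)"
    proof -
      have "m z \<noteq> 0" using m[OF z] by auto
      moreover have "- (z + m z) * m z = 1 - ((m z)\<^sup>2 + z * m z + 1)" by (simp add: power2_eq_square algebra_simps)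
      ultimately show ?thesis using m[OF z] by (simp add: divide_eq_eq)
    qed
    have Qb: "Qbar N = minv (shift_mat (nn N) (\<lambda>a b. s N * (\<Sum>j<pp N. G0 N a j * G0 N b j)) (- (z + m z)))" if N: "N \<ge> N1" for N
      unfolding Qbar_def nn_def[symmetric] mz
    proof (rule arg_cong[of _ _ minv], rule scaled_spike_eq_shift_mat[OF Tcar(2) _ _ s\<sigma>[OF N]])
      fix a j assume "a < nn N" "j < pp N"
      then show "Pm N $$ (a, j) = G0 N a j / sqrt (real N)"
        using N1(3)[OF N] by (simp add: Pm_def mode_unfold_def nn_def pp_def G0_def ui_def)
    qed (use N1(3)[OF N] in auto)
    have Qt_car: "Qt N \<omega> \<in> carrier_mat (nn N) (nn N)" if N: "N \<ge> N1" for N \<omega>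
      unfolding Qt[OF N] gram_mat_def
      by (intro minv_inverts(1) shift_mat_carrier shift_mat_det) (use z in \<open>auto simp: mult.commute\<close>)
    have Qb_car: "Qbar N \<in> carrier_mat (nn N) (nn N)" if N: "N \<ge> N1" for N
      unfolding Qb[OF N]
      by (intro minv_inverts(1) shift_mat_carrier shift_mat_det)
        (use m[OF z] in \<open>auto simp: mult.commute zero_less_mult_iff\<close>)
    have Qt_entry: "Qt N \<omega> $$ (a, b) = S.Qm N (\<lambda>i. X N i \<omega>) a b" if N: "N \<ge> N1" for N \<omega> a b
      by (simp add: Qt[OF N] S.Qm_def)
    have Qb_entry: "Qbar N $$ (a, b) = S.Qb N a b" if N: "N \<ge> N1" for N a b
      by (simp add: Qb[OF N] S.Qb_def)
    \<comment> \<open>The matrices are identified with the abstract resolvents only from N1 on, so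
      each limit below is transferred through an eventual equality.\<close>
    have ev: "\<forall>\<^sub>F N in sequentially. N \<ge> N1" by (rule eventually_ge_at_top)
    have "AE \<omega> in M. (\<lambda>N. mtrace (Qt N \<omega>) / of_nat (n N l)) \<longlonglongrightarrow> m z"
      using S.trace_tendsto
    proof eventually_elim
      case (elim \<omega>)
      show ?case
      proof (rule Lim_transform_eventually[OF elim], rule eventually_mono[OF ev])
        fix N assume N: "N1 \<le> N"
        show "(\<Sum>k<nn N. S.Qm N (\<lambda>i. X N i \<omega>) k k) / of_nat (nn N) = mtrace (Qt N \<omega>) / of_nat (n N l)"
          using Qt_car[OF N, of \<omega>] by (simp add: mtrace_def Qt_entry[OF N] nn_def)
      qed
    qed
    moreover have "det_equiv M (\<lambda>N. n N l) Qt Qbar"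
      unfolding det_equiv_def
    proof (intro allI impI, elim conjE exE)
      fix A :: "nat \<Rightarrow> real mat" and a b :: "nat \<Rightarrow> real vec" and CA Ca Cb
      assume car: "\<forall>N. A N \<in> carrier_mat (n N l) (n N l) \<and> a N \<in> carrier_vec (n N l) \<and> b N \<in> carrier_vec (n N l)"
        and CA: "\<forall>N. spec_norm (A N) \<le> CA" and Ca: "\<forall>N. vnorm (a N) \<le> Ca" and Cb: "\<forall>N. vnorm (b N) \<le> Cb"
      have car': "A N \<in> carrier_mat (nn N) (nn N)" "a N \<in> carrier_vec (nn N)" "b N \<in> carrier_vec (nn N)" for N
        using car by (auto simp: nn_def)
      have "AE \<omega> in M. (\<lambda>N. (\<Sum>k<nn N. \<Sum>i<nn N. complex_of_real (A N $$ (k, i)) *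
          (S.Qm N (\<lambda>i. X N i \<omega>) i k - S.Qb N i k)) / of_nat (nn N)) \<longlonglongrightarrow> 0"
        by (rule S.weighted_trace_tendsto[where CA = CA])
           (use CA car' in \<open>auto intro!: nrm_row_le_spec_norm\<close>)
      then have 1: "AE \<omega> in M. (\<lambda>N. mtrace (cmat (A N) * (Qt N \<omega> - Qbar N)) / of_nat (n N l)) \<longlonglongrightarrow> 0"
      proof eventually_elim
        case (elim \<omega>)
        show ?case
        proof (rule Lim_transform_eventually[OF elim], rule eventually_mono[OF ev])
          fix N assume N: "N1 \<le> N"
          have "mtrace (cmat (A N) * (Qt N \<omega> - Qbar N)) =
              (\<Sum>k<nn N. \<Sum>i<nn N. complex_of_real (A N $$ (k, i)) * (Qt N \<omega> $$ (i, k) - Qbar N $$ (i, k)))"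
            using Qt_car[OF N, of \<omega>] Qb_car[OF N] car'(1)[of N]
            by (auto simp: mtrace_def cmat_def scalar_prod_def atLeast0LessThan intro!: sum.cong)
          then show "(\<Sum>k<nn N. \<Sum>i<nn N. complex_of_real (A N $$ (k, i)) *
              (S.Qm N (\<lambda>i. X N i \<omega>) i k - S.Qb N i k)) / of_nat (nn N) =
              mtrace (cmat (A N) * (Qt N \<omega> - Qbar N)) / of_nat (n N l)"
            by (simp add: Qt_entry[OF N] Qb_entry[OF N] nn_def)
        qed
      qed
      have "AE \<omega> in M. (\<lambda>N. \<Sum>i<nn N. \<Sum>k<nn N. cvec (a N) $ i * (S.Qm N (\<lambda>i. X N i \<omega>) i k - S.Qb N i k) * cvec (b N) $ k) \<longlonglongrightarrow> 0"
        by (rule S.bilinear_tendsto[where CA = Ca and CB = Cb]) (use Ca Cb nrm_cvec[OF car'(2)] nrm_cvec[OF car'(3)] in auto)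
      then have 2: "AE \<omega> in M. (\<lambda>N. cvec (a N) \<bullet> ((Qt N \<omega> - Qbar N) *\<^sub>v cvec (b N))) \<longlonglongrightarrow> 0"
      proof eventually_elim
        case (elim \<omega>)
        show ?case
        proof (rule Lim_transform_eventually[OF elim], rule eventually_mono[OF ev])
          fix N assume N: "N1 \<le> N"
          have "cvec (a N) \<bullet> ((Qt N \<omega> - Qbar N) *\<^sub>v cvec (b N)) =
              (\<Sum>i<nn N. cvec (a N) $ i * (\<Sum>k<nn N. (Qt N \<omega> $$ (i, k) - Qbar N $$ (i, k)) * cvec (b N) $ k))"
            using Qt_car[OF N, of \<omega>] Qb_car[OF N] car'(2,3)[of N]
            by (auto simp: cvec_def scalar_prod_def atLeast0LessThan intro!: sum.cong)
          then show "(\<Sum>i<nn N. \<Sum>k<nn N. cvec (a N) $ i * (S.Qm N (\<lambda>i. X N i \<omega>) i k - S.Qb N i k) * cvec (b N) $ k) =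
              cvec (a N) \<bullet> ((Qt N \<omega> - Qbar N) *\<^sub>v cvec (b N))"
            by (simp add: Qt_entry[OF N] Qb_entry[OF N] sum_distrib_left mult.assoc)
        qed
      qed
      show "(AE \<omega> in M. (\<lambda>N. mtrace (cmat (A N) * (Qt N \<omega> - Qbar N)) / of_nat (n N l)) \<longlonglongrightarrow> 0)
        \<and> (AE \<omega> in M. (\<lambda>N. cvec (a N) \<bullet> ((Qt N \<omega> - Qbar N) *\<^sub>v cvec (b N))) \<longlonglongrightarrow> 0)"
        using 1 2 by blast
    qed
    ultimately show ?thesis
      unfolding Let_def Qt_def[abs_def] Qbar_def[abs_def] Tm_def Pm_def \<sigma>_def \<mu>_def by blast
  qed
  show ?thesis
    by (rule exI[of _ m]) (use m main in blast)
qed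

end
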